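(* Up to isomorphism of fusion rings, the only noncommutative integral Drinfeld ring of rank at most $6$ is the group ring $\mathbb{Z}S_3$ (with basis $S_3$).
   Context: A fusion ring $\mathcal{R}$ is a ring that is a free $\mathbb{Z}$-module with finite basis $b_1=1,b_2,\dots,b_r$ ($r$ is the rank), products $b_ib_j=\sum_k N_{i,j}^k b_k$ with $N_{i,j}^k\in\mathbb{Z}_{\ge 0}$, and an involution $i\mapsto i^*$ of the index set such that $b_i\mapsto b_i^*:=b_{i^*}$ extends to an anti-automorphism and the coefficient of $b_1$ in $b_ib_j^*$ is $\delta_{i,j}$. Isomorphisms of fusion rings are ring isomorphisms mapping basis to basis. $\mathrm{FPdim}:\mathcal{R}\to\mathbb{R}$ is the unique ring homomorphism with $d_i:=\mathrm{FPdim}(b_i)>0$ for all $i$; $\mathrm{FPdim}(\mathcal{R})=\sum_i d_i^2$. $\mathcal{R}$ is integral if all $d_i\in\mathbb{Z}$. Formal codegrees: $\mathcal{R}_{\mathbb{C}}=\mathcal{R}\otimes_{\mathbb{Z}}\mathbb{C}$ is semisimple and $Z=\sum_i b_ib_i^*$ is central. For an irreducible representation $V$ of $\mathcal{R}_{\mathbb{C}}$ of dimension $n_V$, $Z$ acts on $V$ by a scalar $\alpha_V$, and $f_V=\alpha_V/n_V$ is the formal codegree of $V$. An integral fusion ring is called a Drinfeld ring if all its formal codegrees are integers dividing $\mathrm{FPdim}(\mathcal{R})$. *)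

theory Defs
  imports
    Complex_Main
    "HOL-Library.FuncSet"
    "HOL-Algebra.QuotRing"
    "HOL-Algebra.Sym_Groups"
    "Jordan_Normal_Form.VS_Connect"
begin

section \<open>Fusion rings\<close>

record 'a based_ring = "'a ring" +
  basis :: "'a set"
  star :: "'a \<Rightarrow> 'a"

text \<open>Integer coordinates with respect to the basis; meaningful when the ring is free over the
  integers on its basis. Coordinate vectors are \<^term>\<open>undefined\<close> outside the basis, which makes
  them unique.\<close>

definition is_coords :: "('a, 'm) based_ring_scheme \<Rightarrow> 'a \<Rightarrow> ('a \<Rightarrow> int) \<Rightarrow> bool" where
  "is_coords R x c \<longleftrightarrow>
     c \<in> basis R \<rightarrow>\<^sub>E UNIV \<and> x = (\<Oplus>\<^bsub>R\<^esub>b\<in>basis R. [c b] \<cdot>\<^bsub>R\<^esub> b)"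

definition coords :: "('a, 'm) based_ring_scheme \<Rightarrow> 'a \<Rightarrow> 'a \<Rightarrow> int" where
  "coords R x = (THE c. is_coords R x c)"

definition opposite_ring :: "('a, 'm) ring_scheme \<Rightarrow> ('a, 'm) ring_scheme" where
  "opposite_ring R = R\<lparr>monoid.mult := \<lambda>x y. y \<otimes>\<^bsub>R\<^esub> x\<rparr>"

text \<open>Only the values of \<^const>\<open>star\<close> on the basis matter. The structure constants are
  \<open>N\<^sub>i\<^sub>j\<^sup>k = coords R (b\<^sub>i \<otimes> b\<^sub>j) b\<^sub>k\<close>.\<close>

locale fusion_ring = ring R for R :: "('a, 'm) based_ring_scheme" (structure) +
  assumes finite_basis: "finite (basis R)"
    and basis_subset: "basis R \<subseteq> carrier R"
    and free: "x \<in> carrier R \<Longrightarrow> \<exists>!c. is_coords R x c"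
    and one_in_basis: "\<one> \<in> basis R"
    and nonneg: "\<lbrakk>a \<in> basis R; b \<in> basis R; c \<in> basis R\<rbrakk> \<Longrightarrow> 0 \<le> coords R (a \<otimes> b) c"
    and star_closed: "b \<in> basis R \<Longrightarrow> star R b \<in> basis R"
    and star_star: "b \<in> basis R \<Longrightarrow> star R (star R b) = b"
    and star_anti: "\<exists>\<phi>\<in>ring_iso R (opposite_ring R). \<forall>b\<in>basis R. \<phi> b = star R b"
    and star_orth: "\<lbrakk>a \<in> basis R; b \<in> basis R\<rbrakk> \<Longrightarrow>
      coords R (a \<otimes> star R b) \<one> = (if a = b then 1 else 0)"

definition fusion_rank :: "('a, 'm) based_ring_scheme \<Rightarrow> nat" where
  "fusion_rank R = card (basis R)"

definition fusion_ring_iso ::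
    "('a, 'm) based_ring_scheme \<Rightarrow> ('b, 'n) based_ring_scheme \<Rightarrow> ('a \<Rightarrow> 'b) set" where
  "fusion_ring_iso R S = {h \<in> ring_iso R S. h ` basis R = basis S}"

definition fusion_ring_isomorphic ::
    "('a, 'm) based_ring_scheme \<Rightarrow> ('b, 'n) based_ring_scheme \<Rightarrow> bool" where
  "fusion_ring_isomorphic R S \<longleftrightarrow> fusion_ring_iso R S \<noteq> {}"


section \<open>Frobenius-Perron dimension\<close>

definition FPdim :: "('a, 'm) based_ring_scheme \<Rightarrow> 'a \<Rightarrow> real" where
  "FPdim R = (THE d. d \<in> Ring.ring_hom R class_ring \<and> d \<in> extensional (carrier R) \<and>
     (\<forall>b\<in>basis R. d b > 0))"

definition FPdim_ring :: "('a, 'm) based_ring_scheme \<Rightarrow> real" where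
  "FPdim_ring R = (\<Sum>b\<in>basis R. (FPdim R b)\<^sup>2)"

definition integral_fusion_ring :: "('a, 'm) based_ring_scheme \<Rightarrow> bool" where
  "integral_fusion_ring R \<longleftrightarrow> fusion_ring R \<and> (\<forall>b\<in>basis R. FPdim R b \<in> \<int>)"


section \<open>Formal codegrees\<close>

text \<open>The tensor product of \<open>R\<close> with the complex numbers: as \<open>R\<close> is free over the integers on its
  basis, this is the complex vector space of coordinate functions on the basis, with
  multiplication given by the structure constants of \<open>R\<close>.\<close>

definition complexification ::
    "('a, 'm) based_ring_scheme \<Rightarrow> (complex, 'a \<Rightarrow> complex) module" where
  "complexification R = \<lparr>
     carrier = basis R \<rightarrow>\<^sub>E UNIV,
     monoid.mult = (\<lambda>u v. \<lambda>k\<in>basis R. \<Sum>i\<in>basis R. \<Sum>j\<in>basis R.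
               u i * v j * of_int (coords R (i \<otimes>\<^bsub>R\<^esub> j) k)),
     one = (\<lambda>k\<in>basis R. if k = \<one>\<^bsub>R\<^esub> then 1 else 0),
     zero = (\<lambda>k\<in>basis R. 0),
     add = (\<lambda>u v. \<lambda>k\<in>basis R. u k + v k),
     module.smult = (\<lambda>c u. \<lambda>k\<in>basis R. c * u k)\<rparr>"

text \<open>The canonical map \<open>x \<mapsto> x \<otimes> 1\<close>.\<close>

definition to_complexification ::
    "('a, 'm) based_ring_scheme \<Rightarrow> 'a \<Rightarrow> 'a \<Rightarrow> complex" where
  "to_complexification R x = (\<lambda>k\<in>basis R. of_int (coords R x k))"

definition central_Z :: "('a, 'm) based_ring_scheme \<Rightarrow> 'a" where
  "central_Z R = (\<Oplus>\<^bsub>R\<^esub>b\<in>basis R. b \<otimes>\<^bsub>R\<^esub> star R b)"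

text \<open>Representations of a complex algebra \<open>A\<close> on \<open>\<complex>\<^sup>n\<close>. When \<open>A\<close> is finite-dimensional, every
  irreducible representation is finite-dimensional, hence isomorphic to one of these.\<close>

definition algebra_rep ::
    "(complex, 'v) module \<Rightarrow> nat \<Rightarrow> ('v \<Rightarrow> complex mat) \<Rightarrow> bool" where
  "algebra_rep A n \<rho> \<longleftrightarrow> \<rho> \<in> Ring.ring_hom A (ring_mat TYPE(complex) n ()) \<and>
     (\<forall>c. \<forall>x\<in>carrier A. \<rho> (c \<odot>\<^bsub>A\<^esub> x) = c \<cdot>\<^sub>m \<rho> x)"

definition irreducible_rep ::
    "(complex, 'v) module \<Rightarrow> nat \<Rightarrow> ('v \<Rightarrow> complex mat) \<Rightarrow> bool" where
  "irreducible_rep A n \<rho> \<longleftrightarrow> algebra_rep A n \<rho> \<and> n > 0 \<and>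
     (\<forall>W. VectorSpace.subspace class_ring W (module_vec TYPE(complex) n) \<and>
          (\<forall>x\<in>carrier A. \<forall>w\<in>W. \<rho> x *\<^sub>v w \<in> W) \<longrightarrow>
          W = {0\<^sub>v n} \<or> W = carrier_vec n)"

definition formal_codegrees :: "('a, 'm) based_ring_scheme \<Rightarrow> complex set" where
  "formal_codegrees R = {\<alpha> / of_nat n | \<alpha> n \<rho>.
     irreducible_rep (complexification R) n \<rho> \<and>
     \<rho> (to_complexification R (central_Z R)) = \<alpha> \<cdot>\<^sub>m 1\<^sub>m n}"

definition drinfeld_ring :: "('a, 'm) based_ring_scheme \<Rightarrow> bool" where
  "drinfeld_ring R \<longleftrightarrow> integral_fusion_ring R \<and>
     (\<forall>f\<in>formal_codegrees R. \<exists>m D :: int.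
        f = of_int m \<and> FPdim_ring R = of_int D \<and> m dvd D)"


section \<open>Group rings\<close>

text \<open>The integral group ring of a finite group, its elements being the integer-valued functions
  on the group under convolution; the function \<open>group_basis_elt G g\<close> corresponds to \<open>g\<close>.\<close>

definition group_basis_elt :: "('g, 'm) monoid_scheme \<Rightarrow> 'g \<Rightarrow> 'g \<Rightarrow> int" where
  "group_basis_elt G g = (\<lambda>h\<in>carrier G. if h = g then 1 else 0)"

definition group_ring :: "('g, 'm) monoid_scheme \<Rightarrow> ('g \<Rightarrow> int) based_ring" where
  "group_ring G = \<lparr>
     carrier = carrier G \<rightarrow>\<^sub>E UNIV,
     monoid.mult = (\<lambda>u v. \<lambda>g\<in>carrier G. \<Sum>h\<in>carrier G. u h * v (inv\<^bsub>G\<^esub> h \<otimes>\<^bsub>G\<^esub> g)),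
     one = group_basis_elt G \<one>\<^bsub>G\<^esub>,
     zero = (\<lambda>g\<in>carrier G. 0),
     add = (\<lambda>u v. \<lambda>g\<in>carrier G. u g + v g),
     basis = group_basis_elt G ` carrier G,
     star = (\<lambda>u. \<lambda>g\<in>carrier G. u (inv\<^bsub>G\<^esub> g))\<rparr>"

end

theory Submission
  imports
    Defs
    "HOL-Library.Function_Algebras"
    "HOL-Analysis.Function_Topology"
    "HOL-Computational_Algebra.Fundamental_Theorem_Algebra"
    "HOL-Algebra.Multiplicative_Group"
    "Jordan_Normal_Form.Spectral_Radius"
begin

text \<open>
  Let \<open>A\<close> be the complexification of a noncommutative Drinfeld ring of rank at most \<open>6\<close>, with its
  positive involution, and let \<open>D\<close> be its dimension. A minimal left ideal \<open>V\<close> inside \<open>A c\<close>, for a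
  nonzero commutator \<open>c\<close>, has dimension at least \<open>2\<close> and is not two-sided, so some right translate
  \<open>V y\<close> is an independent copy of \<open>V\<close>; together with the line of the Frobenius-Perron character this
  leaves room only for \<open>dim V = 2\<close> and at most one further dimension. Left multiplication by
  \<open>Z\<^sup>-\<^sup>1\<close> has trace \<open>1\<close> on \<open>A\<close>, because the trace of left multiplication by \<open>z\<close> is the coefficient of
  \<open>1\<close> in \<open>z Z\<close>. Reading the trace off the above decomposition gives
  \<open>1/D + 2/f = 1\<close> in rank \<open>5\<close> and \<open>1/D + 2/f + 1/f' = 1\<close> in rank \<open>6\<close> for formal codegrees
  \<open>f\<close> and \<open>f'\<close>. As these divide \<open>D\<close>, the rank is \<open>6\<close> and \<open>D\<close> is \<open>6\<close>, \<open>10\<close> or \<open>12\<close>. Now \<open>10\<close> is not a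
  sum of six positive squares, \<open>12 = 1 + 1 + 1 + 1 + 4 + 4\<close> forces commutativity, and for \<open>D = 6\<close>
  the basis is a noncommutative group of order \<open>6\<close>.
\<close>

text \<open>Wedderburn's theorem is never invoked. Its place is taken by the positive form in which
  the basis is orthonormal: the coefficient of 1 in \<open>adj u \<star> u\<close> is the squared
  norm of \<open>u\<close>, so no nonzero element is killed by its own adjoint, and
  \<open>Z\<close>, a sum of products \<open>b \<star> adj b\<close>, has only eigenvalues that are
  at least 1. Left ideals with explicit bases then suffice: if \<open>r\<close> is the eigenvalue of
  \<open>Z\<close> on \<open>V\<close>, then \<open>V\<close> and its translate put four entries
  \<open>1 / r\<close> into the trace and the character line puts in \<open>1 / D\<close>; here
  \<open>r\<close> is twice the codegree. If a sixth dimension is left, the quotient by the other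
  five is one-dimensional and is therefore given by a character; no invariant complement is
  required. Two definitions shape the rest. \<open>FPdim\<close> is a definite description, so a
  positive character has to be constructed; formal codegrees refer to matrix representations, so
  minimal left ideals have to be turned into matrices. For the group ring itself \<open>Z\<close> is
  6 times the identity, its codegrees are 6 / n, and it remains to bound the dimension n of an
  irreducible representation by 2.\<close>

lemma sum_last_first:
  "(\<Sum>b\<in>B. \<Sum>c\<in>C. \<Sum>m\<in>M. f b c m) = (\<Sum>m\<in>M. \<Sum>b\<in>B. \<Sum>c\<in>C. f b c m)"
proof -
  have "(\<Sum>b\<in>B. \<Sum>c\<in>C. \<Sum>m\<in>M. f b c m) = (\<Sum>b\<in>B. \<Sum>m\<in>M. \<Sum>c\<in>C. f b c m)"
    by (intro sum.cong refl) (rule sum.swap)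
  also have "\<dots> = (\<Sum>m\<in>M. \<Sum>b\<in>B. \<Sum>c\<in>C. f b c m)"
    by (rule sum.swap)
  finally show ?thesis .
qed

lemma sum_reverse_pairs:
  "(\<Sum>m\<in>M. \<Sum>c\<in>C. \<Sum>a\<in>A. \<Sum>b\<in>B. f m c a b) = (\<Sum>a\<in>A. \<Sum>b\<in>B. \<Sum>c\<in>C. \<Sum>m\<in>M. f m c a b)"
proof -
  have "(\<Sum>m\<in>M. \<Sum>c\<in>C. \<Sum>a\<in>A. \<Sum>b\<in>B. f m c a b) = (\<Sum>c\<in>C. \<Sum>m\<in>M. \<Sum>a\<in>A. \<Sum>b\<in>B. f m c a b)"
    by (rule sum.swap)
  also have "\<dots> = (\<Sum>c\<in>C. \<Sum>a\<in>A. \<Sum>b\<in>B. \<Sum>m\<in>M. f m c a b)"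
    by (intro sum.cong refl) (rule sum_last_first[symmetric])
  also have "\<dots> = (\<Sum>a\<in>A. \<Sum>b\<in>B. \<Sum>c\<in>C. \<Sum>m\<in>M. f m c a b)"
    by (rule sum_last_first[symmetric])
  finally show ?thesis .
qed

section \<open>Structure constants with their symmetries, and the algebra they define\<close>

locale structure_constants =
  fixes B :: "'a set" and N :: "'a \<Rightarrow> 'a \<Rightarrow> 'a \<Rightarrow> int" and s :: "'a \<Rightarrow> 'a" and e :: 'a
  assumes fin: "finite B"
    and e_in [simp]: "e \<in> B"
    and N_nonneg: "\<lbrakk>a \<in> B; b \<in> B; c \<in> B\<rbrakk> \<Longrightarrow> 0 \<le> N a b c"
    and s_in [simp]: "b \<in> B \<Longrightarrow> s b \<in> B"
    and s_s [simp]: "b \<in> B \<Longrightarrow> s (s b) = b"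
    and N_assoc: "\<lbrakk>a \<in> B; b \<in> B; c \<in> B; k \<in> B\<rbrakk> \<Longrightarrow>
      (\<Sum>m\<in>B. N a b m * N m c k) = (\<Sum>m\<in>B. N b c m * N a m k)"
    and N_one_left: "\<lbrakk>b \<in> B; k \<in> B\<rbrakk> \<Longrightarrow> N e b k = (if b = k then 1 else 0)"
    and N_one_right: "\<lbrakk>b \<in> B; k \<in> B\<rbrakk> \<Longrightarrow> N b e k = (if b = k then 1 else 0)"
    and N_star: "\<lbrakk>a \<in> B; b \<in> B; k \<in> B\<rbrakk> \<Longrightarrow> N (s b) (s a) (s k) = N a b k"
    and N_orth: "\<lbrakk>a \<in> B; b \<in> B\<rbrakk> \<Longrightarrow> N a (s b) e = (if a = b then 1 else 0)"
begin

lemma s_e [simp]: "s e = e"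
  using N_orth[of e e] N_one_left[of "s e" e] by (auto split: if_splits)

lemma bij_s: "bij_betw s B B"
  by (rule bij_betwI[where g = s]) auto

lemma sum_s: "(\<Sum>k\<in>B. f (s k)) = (\<Sum>k\<in>B. f k)"
  using sum.reindex_bij_betw[OF bij_s] .

lemma N_e: "\<lbrakk>a \<in> B; b \<in> B\<rbrakk> \<Longrightarrow> N a b e = (if b = s a then 1 else 0)"
  using N_orth[of a "s b"] by auto

text \<open>Frobenius reciprocity: both sides are the coefficient of \<open>e\<close> in the triple
  product of \<open>a\<close>, \<open>b\<close> and \<open>s c\<close>, computed with the two
  bracketings.\<close>

lemma N_rotate:
  assumes "a \<in> B" "b \<in> B" "c \<in> B"
  shows "N a b c = N b (s c) (s a)"
proof -
  have "N a b c = (\<Sum>m\<in>B. N a b m * N m (s c) e)"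
    using assms by (simp add: N_orth fin if_distrib cong: if_cong)
  also have "\<dots> = (\<Sum>m\<in>B. N b (s c) m * N a m e)"
    using assms by (intro N_assoc) auto
  also have "\<dots> = N b (s c) (s a)"
    using assms by (simp add: N_e fin if_distrib cong: if_cong)
  finally show ?thesis .
qed

text \<open>In the form with orthonormal basis, left multiplication by \<open>s a\<close> is adjoint
  to left multiplication by \<open>a\<close>. Two rotations followed by \<open>N_star\<close> give
  this.\<close>

lemma N_adjoint_left: "\<lbrakk>a \<in> B; b \<in> B; c \<in> B\<rbrakk> \<Longrightarrow> N a b c = N (s a) c b"
  using N_rotate[of a b c] N_rotate[of b "s c" "s a"] N_star[of "s a" c b] by simp

lemma N_adjoint_right: "\<lbrakk>a \<in> B; b \<in> B; c \<in> B\<rbrakk> \<Longrightarrow> N a b c = N c (s b) a"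
  using N_rotate[of a b c] N_star[of c "s b" a] by simp

lemma N_rotate': "\<lbrakk>a \<in> B; b \<in> B; c \<in> B\<rbrakk> \<Longrightarrow> N a b c = N (s c) a (s b)"
  using N_rotate[of a b c] N_rotate[of b "s c" "s a"] by simp

text \<open>Coefficients are polymorphic: real ones serve the Frobenius-Perron character, complex
  ones the representations. Arguments are read only on \<open>B\<close> and the result is 0
  elsewhere, so associativity and bilinearity hold for arbitrary functions.\<close>

definition amul :: "('a \<Rightarrow> 'f::comm_ring_1) \<Rightarrow> ('a \<Rightarrow> 'f) \<Rightarrow> 'a \<Rightarrow> 'f" (infixl "\<star>" 70) where
  "u \<star> v = (\<lambda>k. if k \<in> B then \<Sum>i\<in>B. \<Sum>j\<in>B. u i * v j * of_int (N i j k) else 0)"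

text \<open>Elements vanish off \<open>B\<close>, whereas those of \<open>complexification\<close>
  are \<open>undefined\<close> there. With the value 0 they form a subspace of all functions under
  pointwise operations.\<close>

definition algebra :: "('a \<Rightarrow> 'f::comm_ring_1) set" where
  "algebra = {u. \<forall>k. k \<notin> B \<longrightarrow> u k = 0}"

definition unit_vec :: "'a \<Rightarrow> 'a \<Rightarrow> 'f::comm_ring_1" where
  "unit_vec b = (\<lambda>k. if k = b then 1 else 0)"

lemma amul_in [simp]: "u \<star> v \<in> algebra"
  by (simp add: amul_def algebra_def)

lemma unit_vec_in [simp]: "b \<in> B \<Longrightarrow> unit_vec b \<in> algebra"
  by (auto simp: unit_vec_def algebra_def)

lemma zero_in [simp]: "0 \<in> algebra" and
  add_in [simp]: "\<lbrakk>u \<in> algebra; v \<in> algebra\<rbrakk> \<Longrightarrow> u + v \<in> algebra" and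
  diff_in [simp]: "\<lbrakk>u \<in> algebra; v \<in> algebra\<rbrakk> \<Longrightarrow> u - v \<in> algebra" and
  scale_in [simp]: "u \<in> algebra \<Longrightarrow> (\<lambda>x. c * u x) \<in> algebra"
  by (auto simp: algebra_def)

lemma algebra_eqI: "\<lbrakk>u \<in> algebra; v \<in> algebra; \<And>k. k \<in> B \<Longrightarrow> u k = v k\<rbrakk> \<Longrightarrow> u = v"
proof
  fix k assume "u \<in> algebra" "v \<in> algebra" "\<And>k. k \<in> B \<Longrightarrow> u k = v k"
  then show "u k = v k" by (cases "k \<in> B") (auto simp: algebra_def)
qed

lemma amul_add_left: "(u + u') \<star> v = u \<star> v + u' \<star> v"
  by (auto simp: amul_def sum.distrib distrib_right)

lemma amul_add_right: "u \<star> (v + v') = u \<star> v + u \<star> v'"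
  by (auto simp: amul_def sum.distrib distrib_right distrib_left)

lemma amul_diff_left: "(u - u') \<star> v = u \<star> v - u' \<star> v"
  by (auto simp: amul_def sum_subtractf left_diff_distrib)

lemma amul_diff_right: "u \<star> (v - v') = u \<star> v - u \<star> v'"
  by (auto simp: amul_def sum_subtractf left_diff_distrib right_diff_distrib)

lemma amul_scale_left: "(\<lambda>x. c * u x) \<star> v = (\<lambda>x. c * (u \<star> v) x)"
  by (auto simp: amul_def sum_distrib_left mult.assoc)

lemma amul_scale_right: "u \<star> (\<lambda>x. c * v x) = (\<lambda>x. c * (u \<star> v) x)"
  by (auto simp: amul_def sum_distrib_left mult_ac)

lemma amul_zero [simp]: "0 \<star> v = 0" "u \<star> 0 = 0"
  by (auto simp: amul_def)

lemma amul_assoc: "(u \<star> v) \<star> w = u \<star> (v \<star> w)"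
proof
  fix k
  show "((u \<star> v) \<star> w) k = (u \<star> (v \<star> w)) k"
  proof (cases "k \<in> B")
    case k: True
    have "((u \<star> v) \<star> w) k = (\<Sum>m\<in>B. \<Sum>c\<in>B. \<Sum>a\<in>B. \<Sum>b\<in>B.
        u a * v b * w c * of_int (N a b m * N m c k))"
      using k by (simp add: amul_def sum_distrib_left sum_distrib_right mult_ac)
    also have "\<dots> = (\<Sum>a\<in>B. \<Sum>b\<in>B. \<Sum>c\<in>B. \<Sum>m\<in>B. u a * v b * w c * of_int (N a b m * N m c k))"
      by (rule sum_reverse_pairs)
    also have "\<dots> = (\<Sum>a\<in>B. \<Sum>b\<in>B. \<Sum>c\<in>B. \<Sum>m\<in>B. u a * v b * w c * of_int (N b c m * N a m k))"
    proof -
      have "(\<Sum>m\<in>B. u a * v b * w c * of_int (N a b m * N m c k)) =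
          (\<Sum>m\<in>B. u a * v b * w c * of_int (N b c m * N a m k))"
        if "a \<in> B" "b \<in> B" "c \<in> B" for a b c
        by (simp only: sum_distrib_left[symmetric] of_int_sum[symmetric] N_assoc that k)
      then show ?thesis by simp
    qed
    also have "\<dots> = (\<Sum>a\<in>B. \<Sum>m\<in>B. \<Sum>b\<in>B. \<Sum>c\<in>B. u a * v b * w c * of_int (N b c m * N a m k))"
      by (rule sum.cong[OF refl], rule sum_last_first)
    also have "\<dots> = (u \<star> (v \<star> w)) k"
      using k by (simp add: amul_def sum_distrib_left sum_distrib_right mult_ac)
    finally show ?thesis .
  qed (simp add: amul_def)
qed

lemma amul_unit_right: "u \<in> algebra \<Longrightarrow> u \<star> unit_vec e = u"
proof (rule algebra_eqI)
  fix k assume "k \<in> B"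
  then have "(u \<star> unit_vec e) k = (\<Sum>i\<in>B. u i * of_int (N i e k))"
    by (simp add: amul_def unit_vec_def fin if_distrib if_distribR mult.commute cong: if_cong)
  also have "\<dots> = u k"
    using \<open>k \<in> B\<close> by (simp add: N_one_right fin if_distrib cong: if_cong)
  finally show "(u \<star> unit_vec e) k = u k" .
qed auto

lemma amul_unit_left: "u \<in> algebra \<Longrightarrow> unit_vec e \<star> u = u"
proof (rule algebra_eqI)
  fix k assume "k \<in> B"
  have "(unit_vec e \<star> u) k = (\<Sum>i\<in>B. if i = e then (\<Sum>j\<in>B. u j * of_int (N e j k)) else 0)"
    using \<open>k \<in> B\<close> unfolding amul_def unit_vec_def by (auto intro!: sum.cong)
  also have "\<dots> = u k"
    using \<open>k \<in> B\<close> by (simp add: N_one_left fin if_distrib cong: if_cong)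
  finally show "(unit_vec e \<star> u) k = u k" .
qed auto

lemma amul_unit_vec_right: "b \<in> B \<Longrightarrow> k \<in> B \<Longrightarrow> (v \<star> unit_vec b) k = (\<Sum>i\<in>B. v i * of_int (N i b k))"
  by (simp add: amul_def unit_vec_def fin if_distrib if_distribR mult.commute cong: if_cong)

lemma algebra_expansion: "u \<in> algebra \<Longrightarrow> u = (\<Sum>b\<in>B. (\<lambda>k. u b * unit_vec b k))"
proof
  fix k assume "u \<in> algebra"
  have "(\<Sum>b\<in>B. (\<lambda>k. u b * unit_vec b k)) k = (\<Sum>b\<in>B. if k = b then u b else 0)"
    by (simp add: unit_vec_def fin if_distrib cong: if_cong)
       (induct rule: finite_induct[OF fin]; auto)
  then show "u k = (\<Sum>b\<in>B. (\<lambda>k. u b * unit_vec b k)) k"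
    using \<open>u \<in> algebra\<close> by (auto simp: fin algebra_def)
qed

lemma amul_sum_left: "(\<Sum>i\<in>I. f i) \<star> v = (\<Sum>i\<in>I. f i \<star> v)"
  by (induct I rule: infinite_finite_induct) (simp_all only: sum.infinite sum.empty sum.insert amul_add_left amul_zero not_False_eq_True)

lemma amul_sum_right: "v \<star> (\<Sum>i\<in>I. f i) = (\<Sum>i\<in>I. v \<star> f i)"
  by (induct I rule: infinite_finite_induct) (simp_all only: sum.infinite sum.empty sum.insert amul_add_right amul_zero not_False_eq_True)

lemma unit_vec_amul:
  assumes "a \<in> B" "b \<in> B"
  shows "unit_vec a \<star> unit_vec b = (\<Sum>k\<in>B. (\<lambda>l. of_int (N a b k) * unit_vec k l :: 'f::comm_ring_1))"
proof -
  have "(unit_vec a \<star> unit_vec b) k = (of_int (N a b k) :: 'f)" if "k \<in> B" for k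
  proof -
    have "(unit_vec a \<star> unit_vec b) k = (\<Sum>i\<in>B. if i = a then of_int (N i b k) else (0 :: 'f))"
      using assms that unfolding amul_unit_vec_right[OF assms(2) that]
      by (intro sum.cong refl) (simp add: unit_vec_def)
    then show ?thesis using assms by (simp add: fin)
  qed
  then show ?thesis
    using algebra_expansion[OF amul_in, of "unit_vec a :: 'a \<Rightarrow> 'f" "unit_vec b"] by simp
qed

subsection \<open>Characters\<close>

definition character :: "('a \<Rightarrow> 'f::comm_ring_1) \<Rightarrow> bool" where
  "character \<chi> \<longleftrightarrow> \<chi> e = 1 \<and> (\<forall>a\<in>B. \<forall>b\<in>B. \<chi> a * \<chi> b = (\<Sum>k\<in>B. of_int (N a b k) * \<chi> k))"

text \<open>Rotation turns the left side into the expansion of the product of \<open>s k\<close> and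
  \<open>a\<close>. This identity makes \<open>char_vec \<chi>\<close> a common eigenvector of all
  left multiplications.\<close>

lemma character_sum:
  assumes "character \<chi>" "a \<in> B" "k \<in> B"
  shows "(\<Sum>i\<in>B. \<chi> (s i) * of_int (N a i k)) = \<chi> a * \<chi> (s k)"
proof -
  have "(\<Sum>i\<in>B. \<chi> (s i) * of_int (N a i k)) = (\<Sum>i\<in>B. of_int (N (s k) a (s i)) * \<chi> (s i))"
    using assms by (intro sum.cong refl) (simp add: N_rotate'[of a _ k] mult.commute)
  also have "\<dots> = (\<Sum>i\<in>B. of_int (N (s k) a i) * \<chi> i)"
    by (rule sum_s)
  also have "\<dots> = \<chi> (s k) * \<chi> a"
    using assms by (simp add: character_def)
  also have "\<dots> = \<chi> a * \<chi> (s k)" by (rule mult.commute)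
  finally show ?thesis .
qed

text \<open>Up to the factor \<open>f\<^sub>\<chi>\<close>, the central idempotent of \<open>\<chi>\<close>.\<close>

definition char_vec :: "('a \<Rightarrow> 'f::comm_ring_1) \<Rightarrow> 'a \<Rightarrow> 'f" where
  "char_vec \<chi> = (\<lambda>k. if k \<in> B then \<chi> (s k) else 0)"

definition eval_char :: "('a \<Rightarrow> 'f::comm_ring_1) \<Rightarrow> ('a \<Rightarrow> 'f) \<Rightarrow> 'f" where
  "eval_char \<chi> u = (\<Sum>k\<in>B. u k * \<chi> k)"

lemma char_vec_in [simp]: "char_vec \<chi> \<in> algebra"
  by (auto simp: char_vec_def algebra_def)

lemma amul_char_vec:
  assumes "character \<chi>"
  shows "u \<star> char_vec \<chi> = (\<lambda>k. eval_char \<chi> u * char_vec \<chi> k)"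
proof
  fix k
  show "(u \<star> char_vec \<chi>) k = eval_char \<chi> u * char_vec \<chi> k"
  proof (cases "k \<in> B")
    case True
    then have "(u \<star> char_vec \<chi>) k = (\<Sum>i\<in>B. u i * (\<Sum>j\<in>B. \<chi> (s j) * of_int (N i j k)))"
      by (simp add: amul_def char_vec_def sum_distrib_left mult.assoc)
    also have "\<dots> = (\<Sum>i\<in>B. u i * (\<chi> i * \<chi> (s k)))"
      using True by (simp add: character_sum[OF assms])
    finally show ?thesis
      using True by (simp add: char_vec_def eval_char_def sum_distrib_right mult.assoc)
  qed (simp add: amul_def char_vec_def)
qed

text \<open>Multiplicativity is read off from the action on the eigenvector
  \<open>char_vec \<chi>\<close>, whose coordinate at \<open>e\<close> is 1: apply
  \<open>u \<star> v\<close> to it with both bracketings.\<close>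

lemma eval_char_mult:
  assumes "character \<chi>"
  shows "eval_char \<chi> (u \<star> v) = eval_char \<chi> u * eval_char \<chi> v"
proof -
  have "eval_char \<chi> (u \<star> v) = (u \<star> v \<star> char_vec \<chi>) e"
    unfolding amul_char_vec[OF assms] using assms by (simp add: char_vec_def character_def)
  also have "\<dots> = (u \<star> (v \<star> char_vec \<chi>)) e"
    by (simp add: amul_assoc)
  also have "\<dots> = eval_char \<chi> u * eval_char \<chi> v"
    unfolding amul_char_vec[OF assms] amul_scale_right
    using assms by (simp add: char_vec_def character_def mult.commute)
  finally show ?thesis .
qed

lemma eval_char_add: "eval_char \<chi> (u + v) = eval_char \<chi> u + eval_char \<chi> v"
  by (simp add: eval_char_def sum.distrib distrib_right)

lemma eval_char_diff: "eval_char \<chi> (u - v) = eval_char \<chi> u - eval_char \<chi> v"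
  by (simp add: eval_char_def sum_subtractf left_diff_distrib)

lemma eval_char_scale: "eval_char \<chi> (\<lambda>k. c * u k) = c * eval_char \<chi> u"
  by (simp add: eval_char_def sum_distrib_left mult.assoc)

lemma eval_char_unit_vec: "b \<in> B \<Longrightarrow> eval_char \<chi> (unit_vec b) = \<chi> b"
  by (simp add: eval_char_def unit_vec_def fin if_distrib if_distribR mult.commute cong: if_cong)

text \<open>The vector \<open>w\<close> of \<open>\<chi>\<close> satisfies
  \<open>a w = \<chi>(a) w\<close>. Applying \<open>\<psi>\<close> gives
  \<open>\<psi>(a) \<psi>(w) = \<chi>(a) \<psi>(w)\<close>, and \<open>\<psi>(w)\<close> is a sum of
  positive terms.\<close>

lemma character_unique:
  fixes \<chi> \<psi> :: "'a \<Rightarrow> real"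
  assumes \<chi>: "character \<chi>" "\<forall>b\<in>B. \<chi> b > 0" and \<psi>: "character \<psi>" "\<forall>b\<in>B. \<psi> b > 0" and a: "a \<in> B"
  shows "\<chi> a = \<psi> a"
proof -
  let ?w = "char_vec \<chi>"
  have "\<psi> a * eval_char \<psi> ?w = eval_char \<psi> (unit_vec a \<star> ?w)"
    by (simp add: eval_char_mult[OF \<psi>(1)] eval_char_unit_vec a)
  also have "\<dots> = \<chi> a * eval_char \<psi> ?w"
    by (simp add: amul_char_vec[OF \<chi>(1)] eval_char_scale eval_char_unit_vec a)
  finally have *: "\<psi> a * eval_char \<psi> ?w = \<chi> a * eval_char \<psi> ?w" .
  have "eval_char \<psi> ?w > 0"
    unfolding eval_char_def using \<chi> \<psi> fin by (intro sum_pos) (auto simp: char_vec_def intro: e_in)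
  with * show ?thesis by simp
qed

text \<open>Composing with the star gives another positive character, since reversing the factors is
  harmless for values in a commutative ring; uniqueness then applies.\<close>

lemma character_s:
  fixes \<chi> :: "'a \<Rightarrow> real"
  assumes \<chi>: "character \<chi>" "\<forall>b\<in>B. \<chi> b > 0" and a: "a \<in> B"
  shows "\<chi> (s a) = \<chi> a"
proof (rule character_unique[where \<chi> = "\<lambda>b. \<chi> (s b)", OF _ _ \<chi> a])
  show "character (\<lambda>b. \<chi> (s b))"
    unfolding character_def
  proof safe
    fix a b assume ab: "a \<in> B" "b \<in> B"
    have "\<chi> (s a) * \<chi> (s b) = (\<Sum>k\<in>B. of_int (N (s b) (s a) k) * \<chi> k)"
      using \<chi>(1) ab by (subst mult.commute) (simp add: character_def)
    also have "\<dots> = (\<Sum>k\<in>B. of_int (N (s b) (s a) (s k)) * \<chi> (s k))"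
      by (rule sum_s[symmetric])
    also have "\<dots> = (\<Sum>k\<in>B. of_int (N a b k) * \<chi> (s k))"
      using ab by (simp add: N_star)
    finally show "\<chi> (s a) * \<chi> (s b) = (\<Sum>k\<in>B. of_int (N a b k) * \<chi> (s k))" .
  qed (use \<chi> in \<open>simp add: character_def\<close>)
qed (use \<chi> in auto)

end

context structure_constants
begin

subsection \<open>Existence of the positive character\<close>

text \<open>Matrix of left multiplication by the sum of all basis elements. It is symmetric with
  positive entries, so its top eigenvector is positive and unique up to scalars; it commutes with
  right multiplications, which therefore act on that eigenvector by scalars. These scalars form the
  positive character.\<close>

definition sum_matrix :: "'a \<Rightarrow> 'a \<Rightarrow> real" where
  "sum_matrix i j = (\<Sum>a\<in>B. of_int (N a j i))"

text \<open>A vanishing entry means, by adjunction, that the product of \<open>i\<close> and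
  \<open>s j\<close> is 0. But multiplying that product by \<open>j\<close> on the right yields
  something containing \<open>i\<close>, because \<open>s j\<close> times \<open>j\<close> contains
  \<open>e\<close>.\<close>

lemma sum_matrix_pos:
  assumes "i \<in> B" "j \<in> B"
  shows "sum_matrix i j > 0"
proof (rule ccontr)
  assume "\<not> sum_matrix i j > 0"
  moreover have "sum_matrix i j \<ge> 0"
    unfolding sum_matrix_def using assms by (intro sum_nonneg) (simp add: N_nonneg)
  ultimately have "(\<Sum>a\<in>B. of_int (N a j i) :: real) = 0"
    by (simp add: sum_matrix_def)
  then have "N a j i = 0" if "a \<in> B" for a
    using that assms fin by (subst (asm) sum_nonneg_eq_0_iff) (auto simp: N_nonneg)
  then have z: "N i (s j) a = 0" if "a \<in> B" for a
    using that assms N_adjoint_right[of i "s j" a] by simp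
  have "(\<Sum>m\<in>B. N i (s j) m * N m j i) = (\<Sum>m\<in>B. N (s j) j m * N i m i)"
    using assms by (intro N_assoc) auto
  then have "0 = (\<Sum>m\<in>B. N (s j) j m * N i m i)"
    by (simp add: z)
  moreover have "(\<Sum>m\<in>B. N (s j) j m * N i m i) \<ge> N (s j) j e * N i e i"
    using assms fin by (intro member_le_sum) (auto simp: N_nonneg)
  ultimately show False
    using assms by (simp add: N_e N_one_right)
qed

text \<open>The sum of all basis elements is fixed by the star, so its left multiplication is
  self-adjoint.\<close>

lemma sum_matrix_sym:
  assumes "i \<in> B" "j \<in> B"
  shows "sum_matrix i j = sum_matrix j i"
proof -
  have "sum_matrix i j = (\<Sum>a\<in>B. of_int (N (s a) i j))"
    unfolding sum_matrix_def using assms by (intro sum.cong refl) (simp add: N_adjoint_left[of _ j i])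
  also have "\<dots> = sum_matrix j i"
    unfolding sum_matrix_def by (rule sum_s)
  finally show ?thesis .
qed

lemma rayleigh_attained:
  "\<exists>x::'a \<Rightarrow> real. (\<Sum>i\<in>B. (x i)\<^sup>2) = 1 \<and>
     (\<forall>y. (\<Sum>i\<in>B. (y i)\<^sup>2) = 1 \<longrightarrow>
        (\<Sum>i\<in>B. \<Sum>j\<in>B. sum_matrix i j * y i * y j) \<le> (\<Sum>i\<in>B. \<Sum>j\<in>B. sum_matrix i j * x i * x j))"
proof -
  \<comment> \<open>The index type may be infinite. Pinning the coordinates off \<open>B\<close> to
    0 makes \<open>C\<close> a product of compact sets, hence compact by Tychonoff.\<close>
  define C :: "('a \<Rightarrow> real) set" where "C = PiE UNIV (\<lambda>i. if i \<in> B then {-1..1} else {0})"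
  define S :: "('a \<Rightarrow> real) set" where "S = C \<inter> {x. (\<Sum>i\<in>B. (x i)\<^sup>2) = 1}"
  have "compactin (product_topology (\<lambda>i. euclidean) UNIV) C"
    unfolding C_def by (subst compactin_PiE) (auto simp: compactin_euclidean_iff)
  then have "compact C"
    by (simp add: euclidean_product_topology)
  moreover have "closed {x::'a \<Rightarrow> real. (\<Sum>i\<in>B. (x i)\<^sup>2) = 1}"
    by (intro closed_Collect_eq continuous_intros continuous_on_product_coordinates)
  ultimately have "compact S"
    unfolding S_def by (rule compact_Int_closed)
  moreover have "unit_vec e \<in> S"
    using e_in by (auto simp: S_def C_def unit_vec_def fin if_distrib if_distribR cong: if_cong)
  moreover have "continuous_on S (\<lambda>x. \<Sum>i\<in>B. \<Sum>j\<in>B. sum_matrix i j * x i * x j)"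
    by (intro continuous_intros continuous_on_subset[OF continuous_on_product_coordinates]) auto
  ultimately obtain x where x: "x \<in> S"
    "\<And>y. y \<in> S \<Longrightarrow> (\<Sum>i\<in>B. \<Sum>j\<in>B. sum_matrix i j * y i * y j) \<le> (\<Sum>i\<in>B. \<Sum>j\<in>B. sum_matrix i j * x i * x j)"
    using continuous_attains_sup[of S "\<lambda>x. \<Sum>i\<in>B. \<Sum>j\<in>B. sum_matrix i j * x i * x j"] by blast
  have "(\<Sum>i\<in>B. \<Sum>j\<in>B. sum_matrix i j * y i * y j) \<le> (\<Sum>i\<in>B. \<Sum>j\<in>B. sum_matrix i j * x i * x j)"
    if y: "(\<Sum>i\<in>B. (y i)\<^sup>2) = 1" for y
  proof -
    have "\<bar>y i\<bar> \<le> 1" if "i \<in> B" for i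
    proof -
      have "(y i)\<^sup>2 \<le> (\<Sum>i\<in>B. (y i)\<^sup>2)"
        using that fin by (intro member_le_sum) auto
      then show ?thesis
        using y by (simp add: abs_square_le_1)
    qed
    then have "(\<lambda>i. if i \<in> B then y i else 0) \<in> S"
      using y by (auto simp: S_def C_def abs_le_iff)
    from x(2)[OF this] show ?thesis by (simp cong: sum.cong)
  qed
  then show ?thesis using x(1) by (auto simp: S_def)
qed

text \<open>For a small \<open>t\<close> of the same sign as \<open>a\<close> the linear term is
  positive and outweighs the quadratic one.\<close>

lemma linear_coeff_zero:
  fixes a b :: real
  assumes "\<And>t. a * t + b * t\<^sup>2 \<le> 0"
  shows "a = 0"
proof (rule ccontr)
  assume "a \<noteq> 0"
  define c where "c = \<bar>b\<bar> + 1"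
  define t where "t = a / (2 * c)"
  have c: "c > 0" "- b < c" by (auto simp: c_def)
  then have a: "a = 2 * c * t" and "t \<noteq> 0"
    using \<open>a \<noteq> 0\<close> by (auto simp: t_def)
  have "a * t + b * t\<^sup>2 = (2 * c + b) * t\<^sup>2"
    by (simp add: a power2_eq_square algebra_simps)
  moreover have "(2 * c + b) * t\<^sup>2 > 0"
    using c \<open>t \<noteq> 0\<close> by (intro mult_pos_pos) auto
  ultimately show False
    using assms[of t] by linarith
qed

text \<open>A maximiser of the Rayleigh quotient may be replaced by its absolute value, as all entries are
  positive; the first variation then makes it an eigenvector.\<close>

lemma positive_eigenvector:
  "\<exists>v \<mu>. (\<forall>i\<in>B. v i > (0::real)) \<and> (\<forall>i\<in>B. (\<Sum>j\<in>B. sum_matrix i j * v j) = \<mu> * v i)"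
proof -
  define Q where "Q x = (\<Sum>i\<in>B. \<Sum>j\<in>B. sum_matrix i j * x i * x j)" for x :: "'a \<Rightarrow> real"
  define n where "n x = (\<Sum>i\<in>B. (x i)\<^sup>2)" for x :: "'a \<Rightarrow> real"
  obtain x0 where x0: "n x0 = 1" "\<And>y. n y = 1 \<Longrightarrow> Q y \<le> Q x0"
    using rayleigh_attained unfolding Q_def n_def by blast
  define x where "x i = \<bar>x0 i\<bar>" for i
  have nx: "n x = 1"
    using x0(1) by (simp add: n_def x_def)
  have "Q x0 \<le> Q x"
    unfolding Q_def x_def
  proof (intro sum_mono)
    fix i j assume "i \<in> B" "j \<in> B"
    then have "sum_matrix i j * (x0 i * x0 j) \<le> sum_matrix i j * (\<bar>x0 i\<bar> * \<bar>x0 j\<bar>)"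
      using sum_matrix_pos[of i j] by (intro mult_left_mono) (auto simp: abs_mult[symmetric])
    then show "sum_matrix i j * x0 i * x0 j \<le> sum_matrix i j * \<bar>x0 i\<bar> * \<bar>x0 j\<bar>"
      by (simp add: mult.assoc)
  qed
  then have max1: "Q y \<le> Q x" if "n y = 1" for y
    using x0(2)[OF that] by linarith
  define \<mu> where "\<mu> = Q x"
  \<comment> \<open>The homogeneous form of maximality, so that perturbed vectors need not be
    normalised.\<close>
  have max: "Q y \<le> \<mu> * n y" for y
  proof (cases "n y = 0")
    case True
    then have "\<forall>i\<in>B. y i = 0"
      by (simp add: n_def sum_nonneg_eq_0_iff fin)
    then have "Q y = 0" by (simp add: Q_def)
    then show ?thesis using True by simp
  next
    case False
    moreover have "n y \<ge> 0" by (simp add: n_def sum_nonneg)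
    ultimately have pos: "n y > 0" by linarith
    define r where "r = sqrt (n y)"
    have r: "r > 0" "r\<^sup>2 = n y" using pos by (auto simp: r_def)
    have "n (\<lambda>i. y i / r) = n y / r\<^sup>2"
      by (simp add: n_def power_divide sum_divide_distrib)
    then have "Q (\<lambda>i. y i / r) \<le> \<mu>"
      using r pos max1 by (simp add: \<mu>_def)
    moreover have "Q (\<lambda>i. y i / r) = Q y / r\<^sup>2"
      by (simp add: Q_def sum_divide_distrib power2_eq_square)
    ultimately show ?thesis
      using r pos by (simp add: divide_simps)
  qed
  have eig: "(\<Sum>j\<in>B. sum_matrix k j * x j) = \<mu> * x k" if k: "k \<in> B" for k
  proof -
    define Mx where "Mx = (\<Sum>j\<in>B. sum_matrix k j * x j)"
    have Qt: "Q (\<lambda>i. x i + t * unit_vec k i) = Q x + 2 * t * Mx + t\<^sup>2 * sum_matrix k k" for t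
    proof -
      have "Q (\<lambda>i. x i + t * unit_vec k i) = Q x
          + t * (\<Sum>i\<in>B. \<Sum>j\<in>B. sum_matrix i j * x i * unit_vec k j)
          + t * (\<Sum>i\<in>B. \<Sum>j\<in>B. sum_matrix i j * unit_vec k i * x j)
          + t\<^sup>2 * (\<Sum>i\<in>B. \<Sum>j\<in>B. sum_matrix i j * unit_vec k i * unit_vec k j)"
        unfolding Q_def sum_distrib_left sum.distrib[symmetric]
        by (intro sum.cong refl) (simp add: algebra_simps power2_eq_square)
      moreover have "(\<Sum>i\<in>B. \<Sum>j\<in>B. sum_matrix i j * x i * unit_vec k j) = Mx"
      proof -
        have "(\<Sum>i\<in>B. \<Sum>j\<in>B. sum_matrix i j * x i * unit_vec k j) = (\<Sum>i\<in>B. sum_matrix i k * x i)"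
          using k by (simp add: unit_vec_def fin if_distrib cong: if_cong)
        also have "\<dots> = Mx"
          unfolding Mx_def using k by (intro sum.cong refl) (simp add: sum_matrix_sym)
        finally show ?thesis .
      qed
      moreover have "(\<Sum>i\<in>B. \<Sum>j\<in>B. sum_matrix i j * unit_vec k i * x j) = Mx"
      proof -
        have "(\<Sum>i\<in>B. \<Sum>j\<in>B. sum_matrix i j * unit_vec k i * x j)
            = (\<Sum>i\<in>B. if i = k then (\<Sum>j\<in>B. sum_matrix i j * x j) else 0)"
          by (intro sum.cong refl) (auto simp: unit_vec_def)
        then show ?thesis using k by (simp add: fin Mx_def)
      qed
      moreover have "(\<Sum>i\<in>B. \<Sum>j\<in>B. sum_matrix i j * unit_vec k i * unit_vec k j) = sum_matrix k k"
      proof -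
        have "(\<Sum>i\<in>B. \<Sum>j\<in>B. sum_matrix i j * unit_vec k i * unit_vec k j)
            = (\<Sum>i\<in>B. if i = k then sum_matrix k k else 0)"
          using k by (intro sum.cong refl)
            (auto simp: unit_vec_def fin if_distrib cong: if_cong)
        then show ?thesis using k by (simp add: fin)
      qed
      ultimately show ?thesis by simp
    qed
    have nt: "n (\<lambda>i. x i + t * unit_vec k i) = 1 + 2 * t * x k + t\<^sup>2" for t
    proof -
      have "n (\<lambda>i. x i + t * unit_vec k i)
          = n x + 2 * t * (\<Sum>i\<in>B. x i * unit_vec k i) + t\<^sup>2 * (\<Sum>i\<in>B. unit_vec k i)"
        unfolding n_def sum_distrib_left sum.distrib[symmetric]
        by (intro sum.cong refl) (simp add: unit_vec_def power2_eq_square algebra_simps)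
      then show ?thesis
        using k nx by (simp add: unit_vec_def fin if_distrib cong: if_cong)
    qed
    \<comment> \<open>Maximality along the line through \<open>x\<close> in direction
      \<open>k\<close>; the terms constant in \<open>t\<close> cancel because
      \<open>Q x = \<mu>\<close> and \<open>n x = 1\<close>.\<close>
    have "2 * (Mx - \<mu> * x k) * t + (sum_matrix k k - \<mu>) * t\<^sup>2 \<le> 0" for t
      using max[of "\<lambda>i. x i + t * unit_vec k i"] unfolding Qt nt
      by (simp add: algebra_simps \<mu>_def)
    then have "2 * (Mx - \<mu> * x k) = 0"
      by (rule linear_coeff_zero)
    then show ?thesis by (simp add: Mx_def)
  qed
  obtain k where k: "k \<in> B" "x k > 0"
  proof -
    have "\<exists>k\<in>B. x k \<noteq> 0"
      using nx by (auto simp: n_def intro: ccontr)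
    then show thesis using that by (force simp: x_def)
  qed
  \<comment> \<open>One positive coordinate and positive matrix entries make the image of
    \<open>x\<close> positive everywhere; by the eigenvector equation no coordinate of
    \<open>x\<close> can vanish.\<close>
  have Mpos: "(\<Sum>j\<in>B. sum_matrix i j * x j) > 0" if "i \<in> B" for i
    using that k fin
    by (intro sum_pos2[of B k]) (auto simp: x_def intro!: mult_nonneg_nonneg less_imp_le[OF sum_matrix_pos] mult_pos_pos sum_matrix_pos)
  have "x i > 0" if "i \<in> B" for i
    using Mpos[OF that] eig[OF that] by (cases "x i = 0") (auto simp: x_def)
  with eig show ?thesis by blast
qed

text \<open>Subtract from \<open>u\<close> the largest multiple of \<open>v\<close> that leaves a
  nonnegative vector \<open>y\<close>. It vanishes at some \<open>k\<close>, and the eigenvector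
  equation at \<open>k\<close> is a sum of nonnegative terms equal to 0, so positive entries force
  \<open>y = 0\<close> on \<open>B\<close>.\<close>

lemma eigenvector_multiple:
  fixes u v :: "'a \<Rightarrow> real"
  assumes v: "\<And>i. i \<in> B \<Longrightarrow> v i > 0" "\<And>i. i \<in> B \<Longrightarrow> (\<Sum>j\<in>B. sum_matrix i j * v j) = \<mu> * v i"
    and u: "\<And>i. i \<in> B \<Longrightarrow> (\<Sum>j\<in>B. sum_matrix i j * u j) = \<mu> * u i"
  shows "\<exists>c. \<forall>i\<in>B. u i = c * v i"
proof -
  define c where "c = Min ((\<lambda>i. u i / v i) ` B)"
  have "c \<in> (\<lambda>i. u i / v i) ` B"
    unfolding c_def using fin e_in by (intro Min_in) (auto simp del: e_in)
  then obtain k where k: "k \<in> B" "c = u k / v k" by auto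
  define y where "y i = u i - c * v i" for i
  have y0: "y i \<ge> 0" if "i \<in> B" for i
  proof -
    have "c \<le> u i / v i" unfolding c_def using fin that by (intro Min_le) auto
    then show ?thesis using v(1)[OF that] by (simp add: y_def field_simps)
  qed
  have yk: "y k = 0" using k v(1)[of k] by (simp add: y_def)
  have "(\<Sum>j\<in>B. sum_matrix k j * y j) = \<mu> * y k"
    using u[OF k(1)] v(2)[OF k(1)]
    by (simp add: y_def right_diff_distrib sum_subtractf sum_distrib_left[symmetric] mult.left_commute)
  then have "(\<Sum>j\<in>B. sum_matrix k j * y j) = 0" using yk by simp
  then have "sum_matrix k j * y j = 0" if "j \<in> B" for j
    using that k y0 fin
    by (subst (asm) sum_nonneg_eq_0_iff) (auto intro!: mult_nonneg_nonneg less_imp_le[OF sum_matrix_pos])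
  then have "y j = 0" if "j \<in> B" for j
    using that k sum_matrix_pos[of k j] by fastforce
  then show ?thesis by (auto simp: y_def)
qed

text \<open>The constant function 1 stands for the sum of all basis elements, since
  \<open>amul\<close> reads it only on \<open>B\<close>.\<close>

lemma sum_matrix_amul:
  assumes "i \<in> B"
  shows "(\<Sum>j\<in>B. sum_matrix i j * u j) = ((\<lambda>_. 1) \<star> u) i"
  using assms unfolding amul_def sum_matrix_def
  by (simp add: sum_distrib_left mult.commute) (rule sum.swap)

theorem positive_character_exists:
  "\<exists>\<chi>::'a \<Rightarrow> real. character \<chi> \<and> (\<forall>b\<in>B. \<chi> b > 0)"
proof -
  obtain v0 \<mu> where v0: "\<And>i. i \<in> B \<Longrightarrow> v0 i > (0::real)" "\<And>i. i \<in> B \<Longrightarrow> (\<Sum>j\<in>B. sum_matrix i j * v0 j) = \<mu> * v0 i"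
    using positive_eigenvector by metis
  define v where "v = (\<lambda>i. if i \<in> B then v0 i else 0)"
  have vpos: "v i > 0" if "i \<in> B" for i using that v0 by (simp add: v_def)
  have vin: "v \<in> algebra" by (simp add: v_def algebra_def)
  have veig: "(\<Sum>j\<in>B. sum_matrix i j * v j) = \<mu> * v i" if "i \<in> B" for i
    using v0(2)[OF that] that by (simp add: v_def cong: sum.cong)
  have sv: "(\<lambda>_. 1) \<star> v = (\<lambda>k. \<mu> * v k)"
    using veig vin by (intro algebra_eqI) (auto simp: sum_matrix_amul)
  \<comment> \<open>Right multiplication by \<open>b\<close> commutes with left multiplication, so
    \<open>v \<star> unit_vec b\<close> is an eigenvector for the same \<open>\<mu>\<close> and
    hence a multiple of \<open>v\<close>. The factor is the value of the character at
    \<open>b\<close>.\<close>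
  have "\<exists>c. v \<star> unit_vec b = (\<lambda>k. c * v k)" for b
  proof -
    have "(\<lambda>_. 1) \<star> (v \<star> unit_vec b) = (\<lambda>k. \<mu> * (v \<star> unit_vec b) k)"
      by (simp add: amul_assoc[symmetric] sv amul_scale_left)
    then have "\<exists>c. \<forall>i\<in>B. (v \<star> unit_vec b) i = c * v i"
      by (intro eigenvector_multiple[OF vpos veig]) (auto simp: sum_matrix_amul)
    then show ?thesis
      using vin by (auto intro!: algebra_eqI)
  qed
  then obtain \<chi> where \<chi>: "\<And>b. v \<star> unit_vec b = (\<lambda>k. \<chi> b * v k)" by metis
  have ve: "v e > 0" using vpos by simp
  have "\<chi> e = 1"
    using \<chi>[of e] ve by (simp add: amul_unit_right vin fun_eq_iff) (metis less_irrefl mult_cancel_right1)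
  moreover have "\<chi> a * \<chi> b = (\<Sum>k\<in>B. of_int (N a b k) * \<chi> k)" if ab: "a \<in> B" "b \<in> B" for a b
  proof -
    have "(\<lambda>k. \<chi> a * \<chi> b * v k) = v \<star> unit_vec a \<star> unit_vec b"
      by (simp add: \<chi> amul_scale_left mult.assoc)
    also have "\<dots> = v \<star> (\<Sum>k\<in>B. (\<lambda>l. of_int (N a b k) * unit_vec k l))"
      by (simp add: amul_assoc unit_vec_amul[OF ab])
    also have "\<dots> = (\<Sum>k\<in>B. (\<lambda>l. of_int (N a b k) * (\<chi> k * v l)))"
      by (simp add: amul_sum_right amul_scale_right \<chi>)
    finally have "\<chi> a * \<chi> b * v e = (\<Sum>k\<in>B. (\<lambda>l. of_int (N a b k) * (\<chi> k * v l))) e"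
      by metis
    also have "\<dots> = (\<Sum>k\<in>B. of_int (N a b k) * (\<chi> k * v e))"
      by (induct rule: finite_induct[OF fin]) auto
    also have "\<dots> = (\<Sum>k\<in>B. of_int (N a b k) * \<chi> k) * v e"
      by (simp add: sum_distrib_right mult.assoc)
    finally show ?thesis using ve by simp
  qed
  moreover have "\<chi> b > 0" if b: "b \<in> B" for b
  proof -
    have "\<chi> b * v b = (v \<star> unit_vec b) b" by (simp add: \<chi>)
    also have "\<dots> = (\<Sum>i\<in>B. v i * of_int (N i b b))"
      using b by (simp add: amul_unit_vec_right)
    \<comment> \<open>The term \<open>i = e\<close> equals \<open>v e\<close>, because
      \<open>e\<close> times \<open>b\<close> is \<open>b\<close>.\<close>
    also have "\<dots> > 0"
      using b vpos N_one_left[of b b] fin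
      by (intro sum_pos2[of B e]) (auto simp: N_nonneg less_imp_le)
    finally show ?thesis using vpos[OF b] by (simp add: zero_less_mult_iff)
  qed
  ultimately show ?thesis
    unfolding character_def by blast
qed

end

subsection \<open>Linear algebra\<close>

lemma (in vector_space) independent_Un:
  assumes "finite S" "finite T" "independent S" "independent T" "span S \<inter> span T \<subseteq> {0}"
  shows "independent (S \<union> T) \<and> S \<inter> T = {}"
proof
  have "0 \<notin> S" using assms(3) dependent_zero by blast
  then show disj: "S \<inter> T = {}"
    using assms(5) span_base by blast
  show "independent (S \<union> T)"
  proof
    assume "dependent (S \<union> T)"
    then obtain u where u: "\<exists>v\<in>S \<union> T. u v \<noteq> 0" "(\<Sum>v\<in>S \<union> T. u v *s v) = 0"
      using assms(1,2) dependent_finite[of "S \<union> T"] by auto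
    have "(\<Sum>v\<in>S. u v *s v) + (\<Sum>v\<in>T. u v *s v) = 0"
      using u(2) sum.union_disjoint[OF assms(1,2) disj, of "\<lambda>v. u v *s v"] by simp
    then have eq: "(\<Sum>v\<in>S. u v *s v) = - (\<Sum>v\<in>T. u v *s v)"
      by (simp add: eq_neg_iff_add_eq_0)
    have "(\<Sum>v\<in>S. u v *s v) \<in> span S" "- (\<Sum>v\<in>T. u v *s v) \<in> span T"
      by (intro span_neg span_sum span_scale span_base; assumption)+
    then have "(\<Sum>v\<in>S. u v *s v) = 0" "(\<Sum>v\<in>T. u v *s v) = 0"
      using eq assms(5) by (auto simp: eq)
    then have "\<forall>v\<in>S. u v = 0" "\<forall>v\<in>T. u v = 0"
      using assms dependent_finite by blast+
    then show False using u(1) by blast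
  qed
qed

text \<open>Finite dimension enters through the spanning set \<open>F\<close>, because the ambient
  space of functions may be infinite-dimensional.\<close>

lemma (in vector_space) dim_psubset_span:
  assumes "finite F" "V \<subseteq> span F" "subspace V" "subspace W" "W \<subset> V"
  shows "dim W < dim V"
proof -
  obtain C where C: "C \<subseteq> W" "independent C" "W \<subseteq> span C" "card C = dim W"
    using basis_exists by blast
  obtain x where x: "x \<in> V" "x \<notin> W" using assms by blast
  have "span C \<subseteq> W" using C(1) assms(4) by (rule span_minimal)
  then have "x \<notin> span C" using x by blast
  then have ind: "independent (insert x C)"
    using C(2) by (metis independent_insert span_base)
  have sub: "insert x C \<subseteq> V" using x C assms by blast
  obtain E where E: "insert x C \<subseteq> E" "E \<subseteq> V" "independent E" "V \<subseteq> span E"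
    using maximal_independent_subset_extend[OF sub ind] by metis
  have "finite E"
    using independent_span_bound[OF assms(1) E(3)] E(2) assms(2) by blast
  moreover have "dim V = card E"
    by (rule dim_eq_card) (use span_subspace[OF E(2,4) assms(3)] assms(3) E(3) span_eq_iff[of V] in metis)+
  moreover have "card (insert x C) = Suc (card C)"
  proof -
    have "finite C" using \<open>finite E\<close> E(1) by (meson finite_insert finite_subset)
    moreover have "x \<notin> C" using \<open>x \<notin> span C\<close> span_base by blast
    ultimately show ?thesis by simp
  qed
  ultimately show ?thesis
    using card_mono[of E "insert x C"] E(1) C(4) by simp
qed

text \<open>The polynomial \<open>p\<close> in the operator \<open>T\<close>, applied to
  \<open>x\<close> by Horner's rule.\<close>

definition poly_app :: "(complex \<Rightarrow> 'b::ab_group_add \<Rightarrow> 'b) \<Rightarrow> ('b \<Rightarrow> 'b) \<Rightarrow> complex poly \<Rightarrow> 'b \<Rightarrow> 'b" where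
  "poly_app sc T p x = fold_coeffs (\<lambda>a y. sc a x + T y) p 0"

text \<open>Too many iterates of \<open>x0\<close> under \<open>T\<close> are dependent, so some
  nonzero polynomial in \<open>T\<close> kills \<open>x0\<close>. Split off a root \<open>z\<close>,
  \<open>p = (X - z) q\<close>: either \<open>q\<close> applied to \<open>x0\<close> is nonzero and
  is an eigenvector for \<open>z\<close>, or \<open>q\<close> kills \<open>x0\<close> and has
  smaller degree.\<close>

lemma eigenvector_exists:
  fixes sc :: "complex \<Rightarrow> 'b::ab_group_add \<Rightarrow> 'b"
  assumes "vector_space sc"
    and V: "module.subspace sc V" "V \<subseteq> module.span sc F" "finite F" "x0 \<in> V" "x0 \<noteq> 0"
    and T: "\<And>x. x \<in> V \<Longrightarrow> T x \<in> V" "\<And>x y. T (x + y) = T x + T y" "\<And>c x. T (sc c x) = sc c (T x)"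
  shows "\<exists>c. \<exists>v\<in>V. v \<noteq> 0 \<and> T v = sc c v"
proof -
  interpret vector_space sc by fact
  have T0: "T 0 = 0" using T(3)[of 0 0] by simp
  let ?a = "poly_app sc T"
  have a_pCons: "?a (pCons c p) x = sc c x + T (?a p x)" for c p x
    by (cases "p = 0"; cases "c = 0") (auto simp: poly_app_def T0)
  have a_0: "?a 0 x = 0" for x by (simp add: poly_app_def)
  have a_add: "?a (p + q) x = ?a p x + ?a q x" for p q x
  proof (induct p q rule: poly_induct2)
    case (pCons a p b q)
    then show ?case by (simp add: a_pCons T(2) scale_left_distrib algebra_simps)
  qed (simp add: a_0)
  have a_smult: "?a (Polynomial.smult c p) x = sc c (?a p x)" for c p x
    by (induct p) (auto simp: a_pCons a_0 T(3) scale_right_distrib)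
  have a_in: "?a p x \<in> V" if "x \<in> V" for p x
    by (induct p) (simp_all add: a_pCons a_0 that V(1) subspace_add subspace_scale subspace_0 T(1))
  have a_monom: "?a (Polynomial.monom c i) x = sc c ((T ^^ i) x)" for c i x
    by (induct i) (auto simp: monom_0 monom_Suc a_pCons a_0 T(3) T0)
  have a_sum: "?a (\<Sum>i\<in>I. f i) x = (\<Sum>i\<in>I. ?a (f i) x)" for I :: "nat set" and f x
    by (induct I rule: infinite_finite_induct) (auto simp: a_0 a_add)
  have annihilated: "\<exists>p. p \<noteq> 0 \<and> ?a p x0 = 0"
  \<comment> \<open>Dependence is a property of sets, so coinciding iterates have to be treated
    apart; there the difference of two monomials annihilates \<open>x0\<close>.\<close>
  proof (cases "inj_on (\<lambda>i. (T ^^ i) x0) {..card F}")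
    case False
    then obtain i j where "i \<noteq> j" "(T ^^ i) x0 = (T ^^ j) x0"
      by (auto simp: inj_on_def)
    then have "?a (Polynomial.monom 1 i + Polynomial.smult (-1) (Polynomial.monom 1 j)) x0 = 0"
      unfolding a_add a_smult a_monom by simp
    moreover have "Polynomial.coeff (Polynomial.monom 1 i + Polynomial.smult (-1) (Polynomial.monom 1 j)) i = (1 :: complex)"
      using \<open>i \<noteq> j\<close> by simp
    then have "Polynomial.monom 1 i + Polynomial.smult (-1) (Polynomial.monom 1 j) \<noteq> (0 :: complex poly)"
      by (metis coeff_0 zero_neq_one)
    ultimately show ?thesis by blast
  next
    case True
    let ?S = "(\<lambda>i. (T ^^ i) x0) ` {..card F}"
    have "(T ^^ i) x0 \<in> V" for i
      by (induct i) (auto simp: V T(1))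
    then have "?S \<subseteq> span F" using V(2) by blast
    moreover have "card ?S = Suc (card F)" using True by (simp add: card_image)
    ultimately have "dependent ?S"
      using independent_span_bound[OF V(3), of ?S] by auto
    then obtain u where u: "\<exists>v\<in>?S. u v \<noteq> 0" "(\<Sum>v\<in>?S. sc (u v) v) = 0"
      by (subst (asm) dependent_finite) auto
    let ?p = "\<Sum>i\<in>{..card F}. Polynomial.monom (u ((T ^^ i) x0)) i"
    have "?a ?p x0 = 0"
      using u(2) True by (simp add: a_sum a_monom sum.reindex)
    moreover obtain i where i: "i \<le> card F" "u ((T ^^ i) x0) \<noteq> 0" using u(1) by auto
    have "Polynomial.coeff ?p i = u ((T ^^ i) x0)"
      using i by (simp add: coeff_sum)
    then have "?p \<noteq> 0" using i by auto
    ultimately show ?thesis by blast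
  qed
  have "\<exists>c. \<exists>v\<in>V. v \<noteq> 0 \<and> T v = sc c v"
    if "p \<noteq> 0" "?a p x0 = 0" for p
    using that
  proof (induct "degree p" arbitrary: p rule: less_induct)
    case less
    show ?case
    proof (cases "degree p = 0")
      case True
      then obtain c where "p = [:c:]" by (meson degree_eq_zeroE)
      then show ?thesis using less V(5) by (auto simp: a_pCons a_0 T0)
    next
      case False
      then obtain z where "poly p z = 0"
        using fundamental_theorem_of_algebra[of p] by (auto simp: constant_degree)
      then obtain q where q: "p = [:-z, 1:] * q" by (metis dvdE poly_eq_0_iff_dvd)
      with less(2) have "q \<noteq> 0" by auto
      have "?a p x0 = T (?a q x0) - sc z (?a q x0)"
      proof -
        have "p = Polynomial.smult (-z) q + pCons 0 q" by (simp add: q)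
        then have "?a p x0 = sc (-z) (?a q x0) + (sc 0 x0 + T (?a q x0))"
          by (simp only: a_add a_smult a_pCons)
        then show ?thesis by simp
      qed
      then have *: "T (?a q x0) = sc z (?a q x0)" using less(3) by simp
      have "degree p = Suc (degree q)"
        using \<open>q \<noteq> 0\<close> unfolding q by (subst degree_mult_eq) auto
      then show ?thesis
        using less(1)[of q] \<open>q \<noteq> 0\<close> * a_in[OF V(4), of q] by (cases "?a q x0 = 0") auto
    qed
  qed
  then show ?thesis using annihilated by blast
qed

interpretation fv: vector_space "(\<lambda>c f x. c * f x) :: complex \<Rightarrow> ('a \<Rightarrow> complex) \<Rightarrow> 'a \<Rightarrow> complex"
  by unfold_locales (auto simp: algebra_simps)

context structure_constants
begin

subsection \<open>The complex star algebra\<close>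

lemma algebra_subspace: "fv.subspace algebra"
  by (auto simp: fv.subspace_def)

lemma algebra_eq_span: "algebra = fv.span (unit_vec ` B)"
proof
  show "algebra \<subseteq> fv.span (unit_vec ` B)"
  proof
    fix u :: "'a \<Rightarrow> complex" assume "u \<in> algebra"
    then have "u = (\<Sum>b\<in>B. (\<lambda>k. u b * unit_vec b k))" by (rule algebra_expansion)
    also have "\<dots> \<in> fv.span (unit_vec ` B)"
      by (intro fv.span_sum fv.span_scale fv.span_base) auto
    finally show "u \<in> fv.span (unit_vec ` B)" .
  qed
  show "fv.span (unit_vec ` B) \<subseteq> algebra"
    by (rule fv.span_minimal) (auto simp: algebra_subspace)
qed

lemma independent_bound:
  assumes "fv.independent S" "S \<subseteq> algebra"
  shows "finite S" "card S \<le> card B"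
proof -
  have *: "finite S \<and> card S \<le> card (unit_vec ` B :: ('a \<Rightarrow> complex) set)"
    using assms fin by (intro fv.independent_span_bound) (auto simp: algebra_eq_span)
  show "finite S" using * by simp
  show "card S \<le> card B" using * card_image_le[OF fin, of "unit_vec :: _ \<Rightarrow> _ \<Rightarrow> complex"] by linarith
qed

lemma sum_fun_apply: "(\<Sum>i\<in>I. f i) x = (\<Sum>i\<in>I. f i x)"
  by (induct I rule: infinite_finite_induct) auto

definition adj :: "('a \<Rightarrow> complex) \<Rightarrow> 'a \<Rightarrow> complex" where
  "adj u = (\<lambda>k. if k \<in> B then cnj (u (s k)) else 0)"

lemma adj_in [simp]: "adj u \<in> algebra"
  by (simp add: adj_def algebra_def)

lemma adj_unit_vec: "b \<in> B \<Longrightarrow> adj (unit_vec b) = unit_vec (s b)"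
proof
  fix k assume "b \<in> B"
  then show "adj (unit_vec b) k = unit_vec (s b) k"
    by (cases "k \<in> B") (auto simp: adj_def unit_vec_def)
qed

lemma adj_diff: "adj (u - v) = adj u - adj v"
  by (auto simp: adj_def)

lemma adj_amul: "adj (u \<star> v) = adj v \<star> adj u"
proof (rule algebra_eqI)
  fix k assume k: "k \<in> B"
  have "adj (u \<star> v) k = (\<Sum>i\<in>B. \<Sum>j\<in>B. cnj (u i) * cnj (v j) * of_int (N i j (s k)))"
    using k by (simp add: adj_def amul_def)
  also have "\<dots> = (\<Sum>i\<in>B. \<Sum>j\<in>B. cnj (u (s i)) * cnj (v (s j)) * of_int (N (s i) (s j) (s k)))"
    by (subst sum_s[symmetric], subst (2) sum_s[symmetric]) simp
  also have "\<dots> = (\<Sum>i\<in>B. \<Sum>j\<in>B. cnj (u (s i)) * cnj (v (s j)) * of_int (N j i k))"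
    using k by (simp add: N_star)
  also have "\<dots> = (\<Sum>j\<in>B. \<Sum>i\<in>B. cnj (u (s i)) * cnj (v (s j)) * of_int (N j i k))"
    by (rule sum.swap)
  also have "\<dots> = (adj v \<star> adj u) k"
    using k by (simp add: adj_def amul_def mult_ac)
  finally show "adj (u \<star> v) k = (adj v \<star> adj u) k" .
qed auto

text \<open>By \<open>N_e\<close> only the pairs of \<open>i\<close> with \<open>s i\<close> reach
  the coordinate \<open>e\<close>. This positivity is what replaces semisimplicity.\<close>

lemma amul_adj_e:
  assumes "u \<in> algebra"
  shows "(adj u \<star> u) e = of_real (\<Sum>i\<in>B. (cmod (u i))\<^sup>2)" (is ?t1)
    and "(u \<star> adj u) e = of_real (\<Sum>i\<in>B. (cmod (u i))\<^sup>2)" (is ?t2)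
proof -
  have "(adj u \<star> u) e = (\<Sum>i\<in>B. \<Sum>j\<in>B. if j = s i then cnj (u (s i)) * u (s i) else 0)"
    by (auto simp: amul_def adj_def N_e intro!: sum.cong)
  also have "\<dots> = (\<Sum>i\<in>B. cnj (u (s i)) * u (s i))"
    by (simp add: fin)
  also have "\<dots> = (\<Sum>i\<in>B. cnj (u i) * u i)"
    by (rule sum_s)
  finally show ?t1
    by (simp only: of_real_sum complex_norm_square mult.commute)
  have "(u \<star> adj u) e = (\<Sum>i\<in>B. \<Sum>j\<in>B. if j = s i then u i * cnj (u i) else 0)"
    by (auto simp: amul_def adj_def N_e intro!: sum.cong)
  also have "\<dots> = (\<Sum>i\<in>B. u i * cnj (u i))"
    by (simp add: fin)
  finally show ?t2
    by (simp only: of_real_sum complex_norm_square)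
qed

lemma norm_eq_0: "u \<in> algebra \<Longrightarrow> (\<Sum>i\<in>B. (cmod (u i))\<^sup>2) = 0 \<Longrightarrow> u = 0"
  by (rule algebra_eqI) (auto simp: sum_nonneg_eq_0_iff fin)

lemma adj_amul_eq_0: "u \<in> algebra \<Longrightarrow> adj u \<star> u = 0 \<Longrightarrow> u = 0"
  using amul_adj_e(1)[of u] norm_eq_0[of u] by (metis of_real_eq_0_iff zero_fun_apply)

lemma amul_adj_eq_0: "u \<in> algebra \<Longrightarrow> u \<star> adj u = 0 \<Longrightarrow> u = 0"
  using amul_adj_e(2)[of u] norm_eq_0[of u] by (metis of_real_eq_0_iff zero_fun_apply)

section \<open>The element Z as a Casimir element, and traces\<close>

definition casimir :: "'a \<Rightarrow> complex" where
  "casimir = (\<Sum>b\<in>B. unit_vec b \<star> unit_vec (s b))"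

lemma sum_in [simp]: "(\<And>i. i \<in> I \<Longrightarrow> f i \<in> algebra) \<Longrightarrow> (\<Sum>i\<in>I. f i) \<in> algebra"
  by (simp add: algebra_def sum_fun_apply)

lemma casimir_in [simp]: "casimir \<in> algebra"
  by (simp add: casimir_def)

text \<open>For the form given by the coefficient of \<open>e\<close>, the elements \<open>b\<close>
  and \<open>s b\<close> form dual bases. The usual Casimir argument applies: moving
  \<open>a\<close> across replaces the coefficient \<open>N (s k) a (s b)\<close> by
  \<open>N a b k\<close>, and rotation says that they agree.\<close>

lemma casimir_unit_vec:
  assumes "a \<in> B"
  shows "casimir \<star> unit_vec a = unit_vec a \<star> casimir"
proof -
  have "casimir \<star> unit_vec a = (\<Sum>k\<in>B. unit_vec k \<star> (unit_vec (s k) \<star> unit_vec a))"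
    by (simp only: casimir_def amul_sum_left amul_assoc)
  also have "\<dots> = (\<Sum>k\<in>B. \<Sum>b\<in>B. (\<lambda>l. of_int (N (s k) a b) * (unit_vec k \<star> unit_vec b) l))"
    using assms by (intro sum.cong refl) (simp only: unit_vec_amul s_in amul_sum_right amul_scale_right)
  also have "\<dots> = (\<Sum>k\<in>B. \<Sum>b\<in>B. (\<lambda>l. of_int (N (s k) a (s b)) * (unit_vec k \<star> unit_vec (s b)) l))"
    by (rule sum.cong[OF refl], rule sum_s[symmetric])
  also have "\<dots> = (\<Sum>k\<in>B. \<Sum>b\<in>B. (\<lambda>l. of_int (N a b k) * (unit_vec k \<star> unit_vec (s b)) l))"
    using assms by (intro sum.cong refl) (simp only: N_rotate'[symmetric])
  also have "\<dots> = (\<Sum>b\<in>B. \<Sum>k\<in>B. (\<lambda>l. of_int (N a b k) * (unit_vec k \<star> unit_vec (s b)) l))"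
    by (rule sum.swap)
  also have "\<dots> = (\<Sum>b\<in>B. unit_vec a \<star> unit_vec b \<star> unit_vec (s b))"
    using assms by (intro sum.cong refl) (simp only: unit_vec_amul s_in amul_sum_left amul_scale_left)
  also have "\<dots> = unit_vec a \<star> casimir"
    by (simp only: casimir_def amul_sum_right amul_assoc)
  finally show ?thesis .
qed

lemma casimir_central:
  assumes "u \<in> algebra"
  shows "casimir \<star> u = u \<star> casimir"
proof -
  have "casimir \<star> u = (\<Sum>b\<in>B. (\<lambda>k. u b * (casimir \<star> unit_vec b) k))"
    by (subst algebra_expansion[OF assms]) (simp only: amul_sum_right amul_scale_right)
  also have "\<dots> = (\<Sum>b\<in>B. (\<lambda>k. u b * (unit_vec b \<star> casimir) k))"
    by (intro sum.cong refl) (simp only: casimir_unit_vec)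
  also have "\<dots> = u \<star> casimir"
    by (subst (2) algebra_expansion[OF assms]) (simp only: amul_sum_left amul_scale_left)
  finally show ?thesis .
qed

text \<open>Pairing \<open>casimir \<star> v\<close> with \<open>v\<close> gives the sum over
  \<open>b\<close> of the squared norms of \<open>unit_vec (s b) \<star> v\<close>. The summand for
  \<open>b = e\<close> is already the squared norm of \<open>v\<close>, so the quotient is real and
  at least 1.\<close>

lemma casimir_eigenvalue:
  assumes v: "v \<in> algebra" "v \<noteq> 0" and eig: "casimir \<star> v = (\<lambda>k. \<alpha> * v k)"
  shows "\<exists>r\<ge>1. \<alpha> = of_real r"
proof -
  define n where "n u = (\<Sum>i\<in>B. (cmod (u i))\<^sup>2)" for u :: "'a \<Rightarrow> complex"
  have n0: "n u \<ge> 0" for u by (simp add: n_def sum_nonneg)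
  have "n v \<noteq> 0" using norm_eq_0 v by (auto simp: n_def)
  then have nv: "n v > 0" using n0[of v] by linarith
  have "(adj v \<star> (casimir \<star> v)) e = (\<Sum>b\<in>B. (adj v \<star> (unit_vec b \<star> (unit_vec (s b) \<star> v))) e)"
    by (simp only: casimir_def amul_sum_left amul_sum_right amul_assoc sum_fun_apply)
  also have "\<dots> = (\<Sum>b\<in>B. (adj (unit_vec (s b) \<star> v) \<star> (unit_vec (s b) \<star> v)) e)"
    by (intro sum.cong refl) (simp add: adj_amul adj_unit_vec amul_assoc)
  also have "\<dots> = of_real (\<Sum>b\<in>B. n (unit_vec (s b) \<star> v))"
    by (simp add: amul_adj_e(1) n_def)
  finally have "\<alpha> * of_real (n v) = of_real (\<Sum>b\<in>B. n (unit_vec (s b) \<star> v))"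
    using v by (simp add: eig amul_scale_right amul_adj_e(1) n_def)
  then have \<alpha>: "\<alpha> = of_real ((\<Sum>b\<in>B. n (unit_vec (s b) \<star> v)) / n v)"
    using nv by (simp add: field_simps)
  have "n (unit_vec (s e) \<star> v) \<le> (\<Sum>b\<in>B. n (unit_vec (s b) \<star> v))"
    using fin n0 by (intro member_le_sum) auto
  then have "n v \<le> (\<Sum>b\<in>B. n (unit_vec (s b) \<star> v))"
    using v by (simp add: amul_unit_left)
  then show ?thesis
    using nv \<alpha> by (intro exI[of _ "(\<Sum>b\<in>B. n (unit_vec (s b) \<star> v)) / n v"]) (simp add: field_simps)
qed

text \<open>By orthogonality the coefficient of \<open>b\<close> in an element \<open>x\<close> is
  the coefficient of \<open>e\<close> in \<open>x\<close> times \<open>s b\<close>; take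
  \<open>x = z b\<close> and sum over \<open>b\<close>.\<close>

lemma trace_left_mult: "(\<Sum>b\<in>B. (z \<star> unit_vec b) b) = (z \<star> casimir) e"
proof -
  have "(z \<star> casimir) e = (\<Sum>b\<in>B. (z \<star> unit_vec b \<star> unit_vec (s b)) e)"
    by (simp only: casimir_def amul_sum_right amul_assoc sum_fun_apply)
  also have "\<dots> = (\<Sum>b\<in>B. (z \<star> unit_vec b) b)"
  proof (intro sum.cong refl)
    fix b assume b: "b \<in> B"
    then show "(z \<star> unit_vec b \<star> unit_vec (s b)) e = (z \<star> unit_vec b) b"
      by (simp add: amul_unit_vec_right N_orth fin if_distrib cong: if_cong)
  qed
  finally show ?thesis ..
qed

text \<open>Independence of the trace from the basis. Expanding every unit vector in
  \<open>U\<close>, and every \<open>T u\<close> in unit vectors, turns both sides into the same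
  double sum.\<close>

lemma trace_basis:
  assumes U: "fv.independent U" "U \<subseteq> algebra" "algebra \<subseteq> fv.span U"
    and T: "\<And>x y. T (x + y) = T x + T y" "\<And>c x. T (\<lambda>k. c * x k) = (\<lambda>k. c * T x k)" "\<And>x. T x \<in> algebra"
  shows "(\<Sum>b\<in>B. T (unit_vec b) b) = (\<Sum>u\<in>U. fv.representation U (T u) u)"
proof -
  have finU: "finite U" using independent_bound U by blast
  have T0: "T 0 = 0" using T(2)[of 0 0] by (auto simp: zero_fun_def)
  have T_sum: "T (\<Sum>i\<in>I. f i) = (\<Sum>i\<in>I. T (f i))" for I :: "('a \<Rightarrow> complex) set" and f
    by (induct I rule: infinite_finite_induct) (simp_all only: sum.infinite sum.empty sum.insert T T0 not_False_eq_True)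
  let ?r = "fv.representation U"
  have "T (unit_vec b) b = (\<Sum>u\<in>U. ?r (unit_vec b) u * T u b)" if b: "b \<in> B" for b
  proof -
    have "(\<Sum>u\<in>U. (\<lambda>k. ?r (unit_vec b) u * u k)) = unit_vec b"
      using U(3) unit_vec_in[OF b] by (intro fv.sum_representation_eq[OF U(1) _ finU]) auto
    then have "T (unit_vec b) = T (\<Sum>u\<in>U. (\<lambda>k. ?r (unit_vec b) u * u k))"
      by (rule arg_cong[OF sym])
    also have "\<dots> = (\<Sum>u\<in>U. (\<lambda>k. ?r (unit_vec b) u * T u k))"
      by (simp only: T_sum T(2))
    finally have "T (unit_vec b) = (\<Sum>u\<in>U. (\<lambda>k. ?r (unit_vec b) u * T u k))" .
    then show ?thesis by (simp add: sum_fun_apply)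
  qed
  then have "(\<Sum>b\<in>B. T (unit_vec b) b) = (\<Sum>b\<in>B. \<Sum>u\<in>U. ?r (unit_vec b) u * T u b)"
    by simp
  also have "\<dots> = (\<Sum>u\<in>U. \<Sum>b\<in>B. T u b * ?r (unit_vec b) u)"
    by (subst sum.swap) (simp add: mult.commute)
  also have "\<dots> = (\<Sum>u\<in>U. ?r (T u) u)"
  proof (intro sum.cong refl)
    fix u assume "u \<in> U"
    have "?r (T u) = ?r (\<Sum>b\<in>B. (\<lambda>k. T u b * unit_vec b k))"
      using algebra_expansion[OF T(3)[of u]] by simp
    also have "\<dots> = (\<lambda>w. \<Sum>b\<in>B. ?r (\<lambda>k. T u b * unit_vec b k) w)"
      using U(3) by (intro fv.representation_sum[OF U(1)]) auto
    also have "\<dots> = (\<lambda>w. \<Sum>b\<in>B. T u b * ?r (unit_vec b) w)"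
    proof (intro ext sum.cong refl)
      fix w b assume "b \<in> B"
      then have "unit_vec b \<in> fv.span U" using U(3) unit_vec_in by blast
      then show "?r (\<lambda>k. T u b * unit_vec b k) w = T u b * ?r (unit_vec b) w"
        by (simp add: fv.representation_scale[OF U(1)])
    qed
    finally show "(\<Sum>b\<in>B. T u b * ?r (unit_vec b) u) = ?r (T u) u" by simp
  qed
  finally show ?thesis .
qed

end

context structure_constants
begin

subsection \<open>Minimal left ideals\<close>

text \<open>The multiplier \<open>x\<close> ranges over all functions; \<open>amul\<close> reads it
  only on \<open>B\<close>, so this amounts to multipliers from \<open>algebra\<close>.\<close>

definition left_ideal :: "('a \<Rightarrow> complex) set \<Rightarrow> bool" where
  "left_ideal V \<longleftrightarrow> fv.subspace V \<and> V \<subseteq> algebra \<and> (\<forall>x. \<forall>v\<in>V. x \<star> v \<in> V)"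

definition minimal_left_ideal :: "('a \<Rightarrow> complex) set \<Rightarrow> bool" where
  "minimal_left_ideal V \<longleftrightarrow> left_ideal V \<and> V \<noteq> {0} \<and>
     (\<forall>W. left_ideal W \<and> W \<subseteq> V \<longrightarrow> W = {0} \<or> W = V)"

lemma left_idealD:
  assumes "left_ideal V"
  shows "fv.subspace V" "V \<subseteq> algebra" "\<And>x v. v \<in> V \<Longrightarrow> x \<star> v \<in> V" "0 \<in> V"
    "\<And>u v. \<lbrakk>u \<in> V; v \<in> V\<rbrakk> \<Longrightarrow> u + v \<in> V" "\<And>c v. v \<in> V \<Longrightarrow> (\<lambda>k. c * v k) \<in> V"
  using assms by (auto simp: left_ideal_def fv.subspace_def)

lemma minimal_left_ideal_exists:
  assumes "left_ideal L" "L \<noteq> {0}"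
  shows "\<exists>V. minimal_left_ideal V \<and> V \<subseteq> L"
proof -
  obtain V where V: "left_ideal V \<and> V \<noteq> {0} \<and> V \<subseteq> L"
    "\<And>W. left_ideal W \<and> W \<noteq> {0} \<and> W \<subseteq> L \<Longrightarrow> fv.dim V \<le> fv.dim W"
    using ex_has_least_nat[of "\<lambda>V. left_ideal V \<and> V \<noteq> {0} \<and> V \<subseteq> L" L fv.dim] assms by auto
  have "W = {0} \<or> W = V" if W: "left_ideal W" "W \<subseteq> V" for W
  proof (rule ccontr)
    assume *: "\<not> (W = {0} \<or> W = V)"
    have "fv.dim W < fv.dim V"
    proof (rule fv.dim_psubset_span)
      show "V \<subseteq> fv.span (unit_vec ` B)"
        using V(1) by (auto simp: left_ideal_def algebra_eq_span)
    qed (use fin V(1) W * in \<open>auto simp: left_ideal_def\<close>)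
    moreover have "fv.dim V \<le> fv.dim W" using V W * by blast
    ultimately show False by simp
  qed
  then show ?thesis using V(1) unfolding minimal_left_ideal_def by blast
qed

text \<open>Over the complex numbers \<open>T\<close> has an eigenvector in \<open>V\<close>. Its
  eigenspace within \<open>V\<close> is a nonzero left ideal, hence all of \<open>V\<close>.\<close>

lemma schur:
  assumes V: "minimal_left_ideal V"
    and T: "\<And>x. x \<in> V \<Longrightarrow> T x \<in> V" "\<And>x y. T (x + y) = T x + T y" "\<And>c x. T (\<lambda>k. c * x k) = (\<lambda>k. c * T x k)"
      "\<And>u x. x \<in> V \<Longrightarrow> T (u \<star> x) = u \<star> T x"
  shows "\<exists>c. \<forall>x\<in>V. T x = (\<lambda>k. c * x k)"
proof -
  have LV: "left_ideal V" using V by (simp add: minimal_left_ideal_def)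
  note V' = left_idealD[OF LV]
  obtain x0 where x0: "x0 \<in> V" "x0 \<noteq> 0" using V V'(4) by (auto simp: minimal_left_ideal_def)
  obtain c v where cv: "v \<in> V" "v \<noteq> 0" "T v = (\<lambda>k. c * v k)"
  proof -
    have "V \<subseteq> fv.span (unit_vec ` B)" "finite (unit_vec ` B :: ('a \<Rightarrow> complex) set)"
      using V'(2) fin by (simp_all add: algebra_eq_span[symmetric])
    then have "\<exists>c. \<exists>v\<in>V. v \<noteq> 0 \<and> T v = (\<lambda>k. c * v k)"
      using eigenvector_exists[where T = T and F = "unit_vec ` B", OF fv.vector_space_axioms V'(1) _ _ x0] T(1-3)
      by simp
    then show thesis using that by metis
  qed
  define W where "W = {x \<in> V. T x = (\<lambda>k. c * x k)}"
  have "T 0 = 0" using T(3)[of 0 0] by (auto simp: zero_fun_def)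
  moreover have "T (u \<star> x) = (\<lambda>k. c * (u \<star> x) k)" if "x \<in> W" for u x
    using that T(4)[of x u] by (simp add: W_def amul_scale_right)
  moreover have "T (x + y) = (\<lambda>k. c * (x + y) k)" if "x \<in> W" "y \<in> W" for x y
    using that by (auto simp: W_def T(2) distrib_left)
  moreover have "T (\<lambda>k. c' * x k) = (\<lambda>k. c * (c' * x k))" if "x \<in> W" for c' x
    using that by (simp add: W_def T(3) mult.left_commute)
  ultimately have "left_ideal W"
    unfolding left_ideal_def fv.subspace_def using V' by (auto simp: W_def)
  moreover have "v \<in> W" using cv by (simp add: W_def)
  ultimately have "W = V" using V cv(2) unfolding minimal_left_ideal_def W_def by blast
  then show ?thesis unfolding W_def by blast
qed

text \<open>A minimal left ideal on which the algebra acts by scalars, from the left or from the right, is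
  killed by all commutators and hence, by positivity, not generated by a commutator.\<close>

lemma commutator_ideal:
  assumes ab: "a \<in> B" "b \<in> B" and c: "c = unit_vec a \<star> unit_vec b - unit_vec b \<star> unit_vec a"
    and V: "minimal_left_ideal V" "V \<subseteq> range (\<lambda>x. x \<star> c)"
  shows "\<exists>v\<in>V. \<exists>w\<in>V. v \<noteq> 0 \<and> w \<notin> fv.span {v}" and "\<exists>v\<in>V. \<exists>y. v \<star> y \<notin> V"
proof -
  have LV: "left_ideal V" using V by (simp add: minimal_left_ideal_def)
  note V' = left_idealD[OF LV]
  obtain v where v: "v \<in> V" "v \<noteq> 0" using V V'(4) by (auto simp: minimal_left_ideal_def)
  then obtain x where x: "v = x \<star> c" using V(2) by blast
  \<comment> \<open>The adjoint of \<open>c\<close> is again a commutator, of \<open>p\<close> and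
    \<open>q\<close>, so scalar actions kill it. Since \<open>v = x \<star> c\<close>, the factor
    \<open>adj c\<close> also occurs in \<open>adj v\<close>, and this yields
    \<open>adj v \<star> v = 0\<close> or \<open>v \<star> adj v = 0\<close>.\<close>
  define p q where "p = (unit_vec (s b) :: 'a \<Rightarrow> complex)" and "q = (unit_vec (s a) :: 'a \<Rightarrow> complex)"
  have adjc: "adj c = p \<star> q - q \<star> p"
    using ab by (simp add: c adj_diff adj_amul adj_unit_vec p_def q_def)
  have adjv: "adj v = adj c \<star> adj x" by (simp add: x adj_amul)
  have v_in: "v \<in> algebra" using v V'(2) by blast
  have "\<exists>w\<in>V. w \<notin> fv.span {v}"
  proof (rule ccontr)
    assume "\<not> (\<exists>w\<in>V. w \<notin> fv.span {v})"
    then have "\<exists>k. y \<star> v = (\<lambda>i. k * v i)" for y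
      using V'(3)[OF v(1)] by (auto simp: fv.span_singleton)
    then obtain \<chi> where \<chi>: "\<And>y. y \<star> v = (\<lambda>i. \<chi> y * v i)" by metis
    have "adj c \<star> v = 0"
    proof -
      have pq: "p' \<star> (q' \<star> v) = (\<lambda>i. \<chi> q' * (\<chi> p' * v i))" for p' q'
        by (simp only: \<chi>[of q'] amul_scale_right \<chi>[of p'])
      have "adj c \<star> v = p \<star> (q \<star> v) - q \<star> (p \<star> v)"
        by (simp only: adjc amul_diff_left amul_assoc)
      also have "\<dots> = 0"
        unfolding pq by (rule ext) (simp add: mult.left_commute)
      finally show ?thesis .
    qed
    moreover have "adj v \<star> v = (\<lambda>i. \<chi> (adj x) * (adj c \<star> v) i)"
      unfolding adjv amul_assoc \<chi>[of "adj x"] amul_scale_right ..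
    ultimately have "adj v \<star> v = 0"
      by (auto simp del: \<chi>)
    then show False using adj_amul_eq_0 v v_in by blast
  qed
  then show "\<exists>v\<in>V. \<exists>w\<in>V. v \<noteq> 0 \<and> w \<notin> fv.span {v}" using v by blast
  show "\<exists>v\<in>V. \<exists>y. v \<star> y \<notin> V"
  proof (rule ccontr)
    assume "\<not> (\<exists>v\<in>V. \<exists>y. v \<star> y \<notin> V)"
    \<comment> \<open>If \<open>V\<close> is stable under right multiplications, these are
      endomorphisms of the left module \<open>V\<close>, hence scalars by
      \<open>schur\<close>.\<close>
    then have "\<exists>k. \<forall>x\<in>V. x \<star> y = (\<lambda>i. k * x i)" for y
      by (intro schur[OF V(1)]) (auto simp: amul_add_left amul_scale_left amul_assoc)
    then obtain \<chi> where \<chi>: "\<And>y x. x \<in> V \<Longrightarrow> x \<star> y = (\<lambda>i. \<chi> y * x i)" by metis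
    have "v \<star> adj c = 0"
      by (auto simp: adjc amul_diff_right amul_assoc[symmetric] \<chi> v amul_scale_left)
    then have "v \<star> adj v = 0"
      by (simp add: adjv amul_assoc[symmetric])
    then show False using amul_adj_eq_0 v v_in by blast
  qed
qed

lemma module_hom_amul_left: "module_hom (\<lambda>c f x. c * f x) (\<lambda>c f x. c * f x) (\<lambda>v :: 'a \<Rightarrow> complex. u \<star> v)"
  by unfold_locales (auto simp: amul_add_right amul_scale_right algebra_simps)

lemma module_hom_amul_right: "module_hom (\<lambda>c f x. c * f x) (\<lambda>c f x. c * f x) (\<lambda>v :: 'a \<Rightarrow> complex. v \<star> u)"
  by unfold_locales (auto simp: amul_add_left amul_scale_left algebra_simps)

text \<open>The elements \<open>v\<close> of \<open>V\<close> with \<open>v y\<close> in \<open>V\<close> form a proper left subideal of \<open>V\<close>, so only \<open>0\<close> is one of them.\<close>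

lemma independent_two_copies:
  assumes V: "minimal_left_ideal V" and y: "v0 \<in> V" "v0 \<star> y \<notin> V"
    and \<chi>: "\<forall>v\<in>V. eval_char \<chi> v = 0" "character \<chi>" and w0: "eval_char \<chi> w0 \<noteq> 0"
    and S: "finite S" "fv.independent S" "S \<subseteq> V"
  shows "fv.independent (insert w0 (S \<union> (\<lambda>v. v \<star> y) ` S))"
    "card (insert w0 (S \<union> (\<lambda>v. v \<star> y) ` S)) = 2 * card S + 1"
    "w0 \<notin> S \<union> (\<lambda>v. v \<star> y) ` S" "S \<inter> (\<lambda>v. v \<star> y) ` S = {}" "inj_on (\<lambda>v. v \<star> y) S"
proof -
  have LV: "left_ideal V" using V by (simp add: minimal_left_ideal_def)
  note V' = left_idealD[OF LV]
  define W where "W = {x \<in> V. x \<star> y \<in> V}"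
  have "left_ideal W"
    using V' unfolding left_ideal_def fv.subspace_def W_def
    by (auto simp: amul_add_left amul_scale_left amul_assoc subset_iff)
  moreover have "W \<noteq> V" "W \<subseteq> V" using y by (auto simp: W_def)
  ultimately have "W = {0}" using V by (auto simp: minimal_left_ideal_def)
  then have inter: "x = 0" if "x \<in> V" "x \<star> y \<in> V" for x
    using that by (auto simp: W_def)
  have span_S: "fv.span S \<subseteq> V" using S(3) V'(1) by (rule fv.span_minimal)
  have inj: "inj_on (\<lambda>v. v \<star> y) V"
  proof (rule inj_onI)
    fix x x' assume "x \<in> V" "x' \<in> V" "x \<star> y = x' \<star> y"
    then have "x - x' \<in> V" "(x - x') \<star> y = 0"
      using V'(1) by (auto simp: amul_diff_left fv.subspace_diff)
    then show "x = x'" using inter[of "x - x'"] V'(4) by simp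
  qed
  then show injS: "inj_on (\<lambda>v. v \<star> y) S" using S(3) by (rule inj_on_subset)
  have ind: "fv.independent ((\<lambda>v. v \<star> y) ` S)"
    by (rule module_hom.independent_injective_image[OF module_hom_amul_right S(2)])
      (use inj span_S in \<open>rule inj_on_subset\<close>)
  have span_Sy: "fv.span ((\<lambda>v. v \<star> y) ` S) \<subseteq> (\<lambda>v. v \<star> y) ` V"
    using module_hom.subspace_image[OF module_hom_amul_right V'(1)] S(3)
    by (intro fv.span_minimal) auto
  have "fv.span S \<inter> fv.span ((\<lambda>v. v \<star> y) ` S) \<subseteq> {0}"
    using span_S span_Sy inter by fastforce
  then have un: "fv.independent (S \<union> (\<lambda>v. v \<star> y) ` S)" "S \<inter> (\<lambda>v. v \<star> y) ` S = {}"
    using fv.independent_Un[OF S(1) _ S(2) ind] S(1) by auto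
  \<comment> \<open>The kernel of the character contains \<open>V\<close> and its translate but not
    \<open>w0\<close>, which makes \<open>w0\<close> independent of both copies.\<close>
  have "fv.subspace {x. eval_char \<chi> x = 0}"
    unfolding fv.subspace_def using eval_char_add[of \<chi>] eval_char_scale[of \<chi>]
    by (auto simp: eval_char_def)
  moreover have "S \<union> (\<lambda>v. v \<star> y) ` S \<subseteq> {x. eval_char \<chi> x = 0}"
    using S(3) \<chi> by (auto simp: eval_char_mult)
  ultimately have "fv.span (S \<union> (\<lambda>v. v \<star> y) ` S) \<subseteq> {x. eval_char \<chi> x = 0}"
    by (intro fv.span_minimal)
  then have w0': "w0 \<notin> fv.span (S \<union> (\<lambda>v. v \<star> y) ` S)" using w0 by auto
  then show "fv.independent (insert w0 (S \<union> (\<lambda>v. v \<star> y) ` S))"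
    using un(1) by (rule fv.independent_insertI)
  show "w0 \<notin> S \<union> (\<lambda>v. v \<star> y) ` S" by (rule contra_subsetD[OF fv.span_superset w0'])
  then show "card (insert w0 (S \<union> (\<lambda>v. v \<star> y) ` S)) = 2 * card S + 1"
    using S(1) un(2) injS by (simp add: card_Un_disjoint card_image)
  show "S \<inter> (\<lambda>v. v \<star> y) ` S = {}" by (rule un(2))
qed

text \<open>A kernel vector would have eigenvalue 0, against the lower bound 1. So the image of a
  basis is independent and of full size, and the unit lies in its span.\<close>

lemma casimir_invertible: "\<exists>z\<in>algebra. casimir \<star> z = unit_vec e \<and> z \<star> casimir = unit_vec e"
proof -
  have inj: "inj_on (\<lambda>v. casimir \<star> v) algebra"
  proof (rule inj_onI)
    fix x x' :: "'a \<Rightarrow> complex" assume *: "x \<in> algebra" "x' \<in> algebra" "casimir \<star> x = casimir \<star> x'"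
    then have "casimir \<star> (x - x') = (\<lambda>k. 0 * (x - x') k)"
      by (simp add: amul_diff_right fun_eq_iff)
    then show "x = x'" using casimir_eigenvalue[of "x - x'" 0] * by auto
  qed
  obtain E where E: "E \<subseteq> algebra" "fv.independent E" "algebra \<subseteq> fv.span E"
    using fv.maximal_independent_subset by metis
  have span_E: "fv.span E = algebra"
    using E algebra_subspace by (intro fv.span_subspace)
  let ?E' = "(\<lambda>v. casimir \<star> v) ` E"
  have ind: "fv.independent ?E'"
    by (rule module_hom.independent_injective_image[OF module_hom_amul_left E(2)])
      (simp add: span_E inj)
  have "unit_vec e \<in> fv.span ?E'"
  proof (rule ccontr)
    assume no: "unit_vec e \<notin> fv.span ?E'"
    then have "fv.independent (insert (unit_vec e) ?E')" using ind by (simp add: fv.independent_insert)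
    moreover have "insert (unit_vec e) ?E' \<subseteq> fv.span E" by (auto simp: span_E)
    moreover have finE: "finite E" using independent_bound E by blast
    ultimately have "card (insert (unit_vec e) ?E') \<le> card E"
      using fv.independent_span_bound[of E "insert (unit_vec e) ?E'"] by simp
    moreover have "unit_vec e \<notin> ?E'" by (rule contra_subsetD[OF fv.span_superset no])
    moreover have "card ?E' = card E" by (rule card_image[OF inj_on_subset[OF inj E(1)]])
    ultimately show False using finE by simp
  qed
  moreover have "fv.span ?E' \<subseteq> (\<lambda>v. casimir \<star> v) ` algebra"
    using module_hom.subspace_image[OF module_hom_amul_left algebra_subspace] E(1)
    by (intro fv.span_minimal) auto
  ultimately obtain z where "z \<in> algebra" "unit_vec e = casimir \<star> z" by auto
  then show ?thesis using casimir_central by metis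
qed

text \<open>A positive real character is invariant under the star, so both values become sums of
  squares. The last one, being nonzero, puts \<open>char_vec\<close> outside the kernel of its own
  character.\<close>

lemma eval_char_casimir:
  fixes d :: "'a \<Rightarrow> real"
  assumes d: "character d" "\<forall>b\<in>B. d b > 0"
  shows "eval_char (\<lambda>b. complex_of_real (d b)) casimir = of_real (\<Sum>b\<in>B. (d b)\<^sup>2)"
    and "character (\<lambda>b. complex_of_real (d b))"
    and "eval_char (\<lambda>b. complex_of_real (d b)) (char_vec (\<lambda>b. complex_of_real (d b))) = of_real (\<Sum>b\<in>B. (d b)\<^sup>2)"
proof -
  have e1: "complex_of_real (d a) * of_real (d b) = (\<Sum>k\<in>B. of_int (N a b k) * of_real (d k))" if "a \<in> B" "b \<in> B" for a b
  proof -
    have "complex_of_real (d a) * of_real (d b) = of_real (d a * d b)" by simp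
    also have "d a * d b = (\<Sum>k\<in>B. of_int (N a b k) * d k)" using d(1) that by (simp add: character_def)
    finally show ?thesis by simp
  qed
  then show c: "character (\<lambda>b. complex_of_real (d b))"
    using d(1) by (simp add: character_def)
  have sum: "eval_char \<chi> (\<Sum>i\<in>I. f i) = (\<Sum>i\<in>I. eval_char \<chi> (f i))" for \<chi> :: "'a \<Rightarrow> complex" and I :: "'a set" and f
  proof -
    have "eval_char \<chi> 0 = 0" by (simp add: eval_char_def)
    then show ?thesis
      by (induct I rule: infinite_finite_induct)
        (simp_all only: sum.infinite sum.empty sum.insert eval_char_add not_False_eq_True)
  qed
  show "eval_char (\<lambda>b. complex_of_real (d b)) casimir = of_real (\<Sum>b\<in>B. (d b)\<^sup>2)"
    unfolding casimir_def sum of_real_sum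
    by (intro sum.cong refl) (simp add: eval_char_mult[OF c] eval_char_unit_vec character_s[OF d] power2_eq_square)
  show "eval_char (\<lambda>b. complex_of_real (d b)) (char_vec (\<lambda>b. complex_of_real (d b))) = of_real (\<Sum>b\<in>B. (d b)\<^sup>2)"
    unfolding eval_char_def char_vec_def of_real_sum
    by (intro sum.cong refl) (simp add: character_s[OF d] power2_eq_square)
qed

section \<open>The trace equation for the inverse of Z\<close>

lemma character_of_functional:
  fixes \<psi> :: "('a \<Rightarrow> complex) \<Rightarrow> complex"
  assumes "\<psi> (unit_vec e) = 1" and add: "\<And>x y. \<psi> (x + y) = \<psi> x + \<psi> y"
    and scale: "\<And>c x. \<psi> (\<lambda>k. c * x k) = c * \<psi> x" and mult: "\<And>x y. \<psi> (x \<star> y) = \<psi> x * \<psi> y"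
  shows "character (\<lambda>b. \<psi> (unit_vec b))" "x \<in> algebra \<Longrightarrow> eval_char (\<lambda>b. \<psi> (unit_vec b)) x = \<psi> x"
proof -
  have "\<psi> 0 = 0" using scale[of 0 0] by (auto simp: zero_fun_def)
  then have sum: "\<psi> (\<Sum>i\<in>I. f i) = (\<Sum>i\<in>I. \<psi> (f i))" for I :: "'a set" and f
    by (induct I rule: infinite_finite_induct) (auto simp: add)
  show "character (\<lambda>b. \<psi> (unit_vec b))"
    unfolding character_def
    by (auto simp: assms(1) mult[symmetric] unit_vec_amul sum scale)
  show "eval_char (\<lambda>b. \<psi> (unit_vec b)) x = \<psi> x" if "x \<in> algebra"
    by (subst (2) algebra_expansion[OF that]) (simp add: sum scale eval_char_def)
qed

text \<open>The vectors \<open>v\<close>, \<open>w\<close> and their translates under a right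
  multiplication are eigenvectors of \<open>casimir\<close> for \<open>r\<close> and contribute
  \<open>4 / r\<close>; the character line contributes \<open>1 / D\<close>. The alternatives are
  that these five vectors span, or that one more basis vector is needed; in the latter case the
  algebra acts on the one-dimensional quotient by a character \<open>\<kappa>\<close>.\<close>

theorem trace_equation:
  fixes d :: "'a \<Rightarrow> real"
  assumes d: "character d" "\<forall>b\<in>B. d b > 0"
    and noncomm: "a \<in> B" "b \<in> B" "unit_vec a \<star> unit_vec b \<noteq> (unit_vec b \<star> unit_vec a :: 'a \<Rightarrow> complex)"
    and card: "card B \<le> 6"
  defines "D \<equiv> \<Sum>b\<in>B. (d b)\<^sup>2"
  shows "\<exists>V v w r. minimal_left_ideal V \<and> fv.independent {v, w} \<and> v \<noteq> w \<and> V = fv.span {v, w} \<and>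
     r \<ge> 1 \<and> (\<forall>x\<in>V. casimir \<star> x = (\<lambda>k. complex_of_real r * x k)) \<and>
     (card B \<ge> 5 \<and> 1 / D + 4 / r = 1 \<or>
      card B \<ge> 6 \<and> (\<exists>\<kappa> t. character \<kappa> \<and> eval_char \<kappa> casimir = complex_of_real t \<and> t \<ge> 1 \<and>
         1 / D + 4 / r + 1 / t = 1))"
proof -
  define c where "c = unit_vec a \<star> unit_vec b - (unit_vec b \<star> unit_vec a :: 'a \<Rightarrow> complex)"
  define \<chi> where "\<chi> = (\<lambda>b. complex_of_real (d b))"
  define w0 where "w0 = char_vec \<chi>"
  note \<chi>_facts = eval_char_casimir[OF d, folded \<chi>_def D_def w0_def]
  have Dpos: "D > 0"
    unfolding D_def using d(2) fin by (intro sum_pos) (auto intro: e_in)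
  have "left_ideal (range (\<lambda>x. x \<star> c))"
    unfolding left_ideal_def
    using module_hom.subspace_image[OF module_hom_amul_right fv.subspace_UNIV, of c]
    by (auto simp: amul_assoc[symmetric])
  moreover have "c \<in> range (\<lambda>x. x \<star> c)"
    using amul_unit_left[of c] by (metis amul_in c_def diff_in rangeI)
  moreover have "c \<noteq> 0" using noncomm(3) by (simp add: c_def)
  ultimately obtain V where V: "minimal_left_ideal V" "V \<subseteq> range (\<lambda>x. x \<star> c)"
    using minimal_left_ideal_exists by (metis singletonD)
  have LV: "left_ideal V" using V by (simp add: minimal_left_ideal_def)
  note V' = left_idealD[OF LV]
  note ci = commutator_ideal[OF noncomm(1,2) c_def V]
  obtain v w where vw: "v \<in> V" "w \<in> V" "v \<noteq> 0" "w \<notin> fv.span {v}" using ci(1) by blast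
  obtain v0 y where y: "v0 \<in> V" "v0 \<star> y \<notin> V" using ci(2) by blast
  \<comment> \<open>Characters vanish on commutators, so \<open>V\<close> lies in the kernel of
    \<open>\<chi>\<close>; this keeps it apart from the character line.\<close>
  have "eval_char \<chi> c = 0"
    by (simp add: c_def eval_char_diff eval_char_mult[OF \<chi>_facts(2)])
  then have \<chi>V: "\<forall>x\<in>V. eval_char \<chi> x = 0"
    using V(2) by (auto simp: eval_char_mult[OF \<chi>_facts(2)])
  have w0: "eval_char \<chi> w0 \<noteq> 0" using \<chi>_facts(3) Dpos by simp
  have ind2: "fv.independent {w, v}" "w \<noteq> v"
    using vw fv.span_base[of v "{v}"] by (auto simp: fv.independent_insert)
  note two = independent_two_copies[OF V(1) y \<chi>V \<chi>_facts(2) w0]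
  have VS: "V = fv.span {v, w}"
  proof
    show "fv.span {v, w} \<subseteq> V" using vw V'(1) by (intro fv.span_minimal) auto
    show "V \<subseteq> fv.span {v, w}"
    proof (rule ccontr)
      \<comment> \<open>A third independent vector of \<open>V\<close> would give 3 + 3 + 1 = 7
        independent vectors in an algebra of dimension at most 6.\<close>
      assume "\<not> V \<subseteq> fv.span {v, w}"
      then obtain x where x: "x \<in> V" "x \<notin> fv.span {v, w}" by blast
      then have xn: "x \<notin> {w, v}" using fv.span_base by (metis insert_commute)
      have ind3: "fv.independent {x, w, v}"
        by (rule fv.independent_insertI) (use x(2) ind2 in \<open>simp_all add: insert_commute\<close>)
      have c3: "card {x, w, v} = 3" using xn ind2 by auto
      let ?F = "insert w0 ({x, w, v} \<union> (\<lambda>v. v \<star> y) ` {x, w, v})"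
      have "card ?F = 7" "fv.independent ?F"
        using two[of "{x, w, v}"] x vw ind3 c3 by auto
      moreover have "?F \<subseteq> algebra" using x vw V'(2) by (auto simp: w0_def)
      ultimately show False using independent_bound(2)[of ?F] card by linarith
    qed
  qed
  obtain \<alpha> where \<alpha>: "\<And>x. x \<in> V \<Longrightarrow> casimir \<star> x = (\<lambda>k. \<alpha> * x k)"
  proof -
    have "\<exists>\<alpha>. \<forall>x\<in>V. casimir \<star> x = (\<lambda>k. \<alpha> * x k)"
    proof (rule schur[OF V(1)])
      fix u x assume "x \<in> V"
      have "casimir \<star> (u \<star> x) = (u \<star> x) \<star> casimir" by (simp add: casimir_central)
      also have "\<dots> = u \<star> (casimir \<star> x)"
        using casimir_central[of x] V'(2) \<open>x \<in> V\<close> by (auto simp: amul_assoc)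
      finally show "casimir \<star> (u \<star> x) = u \<star> (casimir \<star> x)" .
    qed (simp_all add: V'(3) amul_add_right amul_scale_right)
    then show thesis using that by blast
  qed
  obtain r where r: "r \<ge> 1" "\<alpha> = of_real r"
    using casimir_eigenvalue[of v \<alpha>] \<alpha> vw V'(2) by blast
  obtain z where z: "z \<in> algebra" "casimir \<star> z = unit_vec e" "z \<star> casimir = unit_vec e"
    using casimir_invertible by blast
  have z_eig: "z \<star> x = (\<lambda>k. (1 / \<gamma>) * x k)"
    if "casimir \<star> x = (\<lambda>k. \<gamma> * x k)" "\<gamma> \<noteq> 0" "x \<in> algebra" for x \<gamma>
  proof -
    have "(\<lambda>k. \<gamma> * (z \<star> x) k) = z \<star> (casimir \<star> x)" by (simp add: that amul_scale_right)
    also have "\<dots> = x" by (simp only: amul_assoc[symmetric] z(3) amul_unit_left that(3))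
    finally show ?thesis using that(2) by (auto simp: fun_eq_iff field_simps)
  qed
  define S where "S = {v, w}"
  define U5 where "U5 = insert w0 (S \<union> (\<lambda>v. v \<star> y) ` S)"
  have S: "finite S" "fv.independent S" "S \<subseteq> V" "card S = 2"
    using vw ind2 by (auto simp: S_def insert_commute)
  note U5_facts = two[OF S(1-3), folded U5_def]
  have U5_alg: "U5 \<subseteq> algebra" using S V'(2) by (auto simp: U5_def w0_def)
  have card5: "card U5 = 5" using U5_facts(2) S(4) by simp
  obtain U where U: "U5 \<subseteq> U" "U \<subseteq> algebra" "fv.independent U" "algebra \<subseteq> fv.span U"
    using fv.maximal_independent_subset_extend[OF U5_alg U5_facts(1)] by metis
  have U_bound: "finite U" "card U \<le> card B" using independent_bound[OF U(3,2)] by auto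
  have span_U: "x \<in> fv.span U" if "x \<in> algebra" for x using U(4) that by blast
  let ?r = "fv.representation U"
  have tr: "1 = (\<Sum>u\<in>U. ?r (z \<star> u) u)"
  proof -
    have "1 = (\<Sum>b\<in>B. (z \<star> unit_vec b) b)"
      unfolding trace_left_mult z(3) by (simp add: unit_vec_def)
    also have "\<dots> = (\<Sum>u\<in>U. ?r (z \<star> u) u)"
      by (rule trace_basis[OF U(3,2,4)]) (auto simp: amul_add_right amul_scale_right)
    finally show ?thesis .
  qed
  have rep_eig: "?r (z \<star> u) u = 1 / \<gamma>"
    if "casimir \<star> u = (\<lambda>k. \<gamma> * u k)" "\<gamma> \<noteq> 0" "u \<in> U" for u \<gamma>
  proof -
    have "u \<in> fv.span U" using that(3) by (rule fv.span_base)
    have "?r (z \<star> u) u = ?r (\<lambda>k. (1 / \<gamma>) * u k) u"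
      using z_eig[OF that(1,2)] that(3) U(2) by (metis subsetD)
    also have "\<dots> = (1 / \<gamma>) * ?r u u"
      by (simp only: fv.representation_scale[OF U(3) \<open>u \<in> fv.span U\<close>])
    also have "\<dots> = 1 / \<gamma>" using fv.representation_basis[OF U(3) that(3)] by simp
    finally show ?thesis .
  qed
  have eig_w0: "casimir \<star> w0 = (\<lambda>k. of_real D * w0 k)"
    unfolding w0_def amul_char_vec[OF \<chi>_facts(2)] \<chi>_facts(1) ..
  have eig_Sy: "casimir \<star> (u \<star> y) = (\<lambda>k. \<alpha> * (u \<star> y) k)" if "u \<in> V" for u
    by (simp add: amul_assoc[symmetric] \<alpha>[OF that] amul_scale_left)
  have sum5: "(\<Sum>u\<in>U5. ?r (z \<star> u) u) = of_real (1 / D + 4 / r)"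
  proof -
    have sub: "w0 \<in> U" "S \<subseteq> U" "(\<lambda>v. v \<star> y) ` S \<subseteq> U" using U(1) by (auto simp: U5_def)
    have "\<alpha> \<noteq> 0" using r by auto
    have "(\<Sum>u\<in>U5. ?r (z \<star> u) u) = ?r (z \<star> w0) w0 + ((\<Sum>u\<in>S. ?r (z \<star> u) u)
        + (\<Sum>u\<in>(\<lambda>v. v \<star> y) ` S. ?r (z \<star> u) u))"
      unfolding U5_def using S(1) U5_facts(3,4) by (simp add: sum.union_disjoint)
    also have "(\<Sum>u\<in>S. ?r (z \<star> u) u) = (\<Sum>u\<in>S. 1 / \<alpha>)"
      using sub S(3) \<alpha> \<open>\<alpha> \<noteq> 0\<close> by (intro sum.cong refl rep_eig) auto
    also have "(\<Sum>u\<in>(\<lambda>v. v \<star> y) ` S. ?r (z \<star> u) u) = (\<Sum>u\<in>(\<lambda>v. v \<star> y) ` S. 1 / \<alpha>)"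
    proof (intro sum.cong refl rep_eig)
      fix u assume "u \<in> (\<lambda>v. v \<star> y) ` S"
      then show "casimir \<star> u = (\<lambda>k. \<alpha> * u k)" using eig_Sy S(3) by blast
    qed (use sub \<open>\<alpha> \<noteq> 0\<close> in auto)
    also have "?r (z \<star> w0) w0 = 1 / of_real D"
      using rep_eig[OF eig_w0] Dpos sub by simp
    finally show ?thesis
      using S(4) U5_facts(5) by (simp add: card_image r(2))
  qed
  have main: "card B \<ge> 5 \<and> 1 / D + 4 / r = 1 \<or>
      card B \<ge> 6 \<and> (\<exists>\<kappa> t. character \<kappa> \<and> eval_char \<kappa> casimir = complex_of_real t \<and> t \<ge> 1 \<and>
         1 / D + 4 / r + 1 / t = 1)"
  proof (cases "U = U5")
    case True
    then have "complex_of_real (1 / D + 4 / r) = of_real 1" using tr sum5 by simp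
    then have "1 / D + 4 / r = 1" by (simp only: of_real_eq_iff)
    moreover have "card B \<ge> 5" using U_bound True card5 by simp
    ultimately show ?thesis by blast
  next
    case False
    then obtain b0 where b0: "b0 \<in> U" "b0 \<notin> U5" using U(1) by blast
    have finU5: "finite U5" using S(1) by (simp add: U5_def)
    have U_eq: "U = insert b0 U5" "card B \<ge> 6"
    proof -
      have c6: "card (insert b0 U5) = 6" using b0 finU5 card5 by simp
      moreover have "insert b0 U5 \<subseteq> U" using b0 U(1) by simp
      ultimately show "U = insert b0 U5" "card B \<ge> 6"
        using U_bound card card_mono[of U "insert b0 U5"] card_seteq[of U "insert b0 U5"] by auto
    qed
    \<comment> \<open>A left ideal of codimension one in the algebra: it is spanned by the line of
      \<open>w0\<close>, by \<open>V\<close> and by the translate of \<open>V\<close>.\<close>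
    define L where "L = fv.span U5"
    have L_in: "u \<star> l \<in> L" if "l \<in> L" for u l
    proof -
      have "fv.subspace {l. u \<star> l \<in> L}"
        unfolding fv.subspace_def L_def
        by (auto simp: amul_add_right amul_scale_right fv.span_add fv.span_scale fv.span_zero)
      moreover have "U5 \<subseteq> {l. u \<star> l \<in> L}"
      proof
        fix l assume l: "l \<in> U5"
        have VL: "V \<subseteq> L" unfolding VS L_def by (rule fv.span_mono) (auto simp: U5_def S_def)
        have "(\<lambda>v. v \<star> y) ` V \<subseteq> L"
        proof -
          have "(\<lambda>v. v \<star> y) ` fv.span S = fv.span ((\<lambda>v. v \<star> y) ` S)"
            using module_hom.span_image[OF module_hom_amul_right] by metis
          also have "\<dots> \<subseteq> L" unfolding L_def by (rule fv.span_mono) (auto simp: U5_def)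
          finally show ?thesis by (simp add: VS S_def)
        qed
        then have "u \<star> (l' \<star> y) \<in> L" if "l' \<in> S" for l'
          using V'(3)[of l' u] that S(3) by (auto simp: amul_assoc[symmetric])
        moreover have "u \<star> l' \<in> L" if "l' \<in> S" for l'
          using V'(3)[of l' u] that S(3) VL by auto
        moreover have "u \<star> w0 \<in> L"
          unfolding w0_def amul_char_vec[OF \<chi>_facts(2)]
          unfolding L_def by (intro fv.span_scale fv.span_base) (simp add: U5_def w0_def)
        ultimately show "l \<in> {l. u \<star> l \<in> L}" using l by (auto simp: U5_def)
      qed
      ultimately have "L \<subseteq> {l. u \<star> l \<in> L}" unfolding L_def by (intro fv.span_minimal)
      then show ?thesis using that by blast
    qed
    have rep_L: "?r l b0 = 0" if "l \<in> L" for l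
      using fv.representation_extend[OF U(3) _ U(1), of l] that b0(2) fv.representation_ne_zero[of U5 l b0]
      unfolding L_def by metis
    \<comment> \<open>The scalar by which \<open>x\<close> acts on the quotient by \<open>L\<close>,
      which is generated by the class of \<open>b0\<close>. Multiplicativity holds because
      \<open>L\<close> is stable under left multiplication.\<close>
    define \<psi> where "\<psi> x = ?r (x \<star> b0) b0" for x
    have b0_alg: "b0 \<in> algebra" using b0 U(2) by blast
    have sumU: "sum f U = f b0 + sum f U5" for f :: "('a \<Rightarrow> complex) \<Rightarrow> 'c::comm_monoid_add"
      unfolding U_eq(1) by (rule sum.insert[OF finU5 b0(2)])
    have decomp: "\<exists>l\<in>L. x = (\<lambda>k. ?r x b0 * b0 k) + l" if "x \<in> algebra" for x
    proof
      have "x = (\<Sum>u\<in>U. (\<lambda>k. ?r x u * u k))"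
        using fv.sum_representation_eq[OF U(3) span_U[OF that] U_bound(1)] by simp
      then show "x = (\<lambda>k. ?r x b0 * b0 k) + (\<Sum>u\<in>U5. (\<lambda>k. ?r x u * u k))"
        by (rule trans) (rule sumU)
      show "(\<Sum>u\<in>U5. (\<lambda>k. ?r x u * u k)) \<in> L"
        unfolding L_def by (intro fv.span_sum fv.span_scale fv.span_base)
    qed
    have \<psi>_one: "\<psi> (unit_vec e) = 1"
      by (simp add: \<psi>_def amul_unit_left b0_alg fv.representation_basis[OF U(3) b0(1)])
    have \<psi>_add: "\<psi> (x + x') = \<psi> x + \<psi> x'" for x x'
      by (simp add: \<psi>_def amul_add_left fv.representation_add[OF U(3)] span_U)
    have \<psi>_scale: "\<psi> (\<lambda>k. k' * x k) = k' * \<psi> x" for x k'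
      by (simp add: \<psi>_def amul_scale_left fv.representation_scale[OF U(3)] span_U)
    have \<psi>_mult: "\<psi> (x \<star> x') = \<psi> x * \<psi> x'" for x x'
    proof -
      obtain l where l: "l \<in> L" "x' \<star> b0 = (\<lambda>k. \<psi> x' * b0 k) + l"
        using decomp[of "x' \<star> b0"] by (auto simp: \<psi>_def)
      have "x \<star> x' \<star> b0 = (\<lambda>k. \<psi> x' * (x \<star> b0) k) + x \<star> l"
        by (simp only: amul_assoc l(2) amul_add_right amul_scale_right)
      then have "\<psi> (x \<star> x') = ?r ((\<lambda>k. \<psi> x' * (x \<star> b0) k) + x \<star> l) b0" by (simp add: \<psi>_def)
      also have "\<dots> = ?r (\<lambda>k. \<psi> x' * (x \<star> b0) k) b0 + ?r (x \<star> l) b0"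
        by (subst fv.representation_add[OF U(3)]) (simp_all only: span_U scale_in amul_in)
      also have "\<dots> = \<psi> x' * \<psi> x"
        by (simp only: fv.representation_scale[OF U(3) span_U[OF amul_in]] rep_L[OF L_in[OF l(1)]] \<psi>_def add_0_right)
      finally show ?thesis by simp
    qed
    define \<kappa> where "\<kappa> = (\<lambda>b. \<psi> (unit_vec b))"
    have \<kappa>: "character \<kappa>" and \<kappa>_eval: "eval_char \<kappa> x = \<psi> x" if "x \<in> algebra" for x
      using character_of_functional[of \<psi>, OF \<psi>_one \<psi>_add \<psi>_scale \<psi>_mult] that by (auto simp: \<kappa>_def)
    have \<kappa>: "character \<kappa>" using \<kappa>[of 0] by simp
    \<comment> \<open>\<open>char_vec \<kappa>\<close> is a nonzero eigenvector of
      \<open>casimir\<close> with eigenvalue \<open>eval_char \<kappa> casimir\<close>, so this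
      number is real and at least 1.\<close>
    have "char_vec \<kappa> e = 1" using \<kappa> by (simp add: char_vec_def character_def)
    then have "char_vec \<kappa> \<noteq> 0" by auto
    then obtain t where t: "t \<ge> 1" "eval_char \<kappa> casimir = of_real t"
      using casimir_eigenvalue[OF char_vec_in, of \<kappa>] amul_char_vec[OF \<kappa>] by blast
    \<comment> \<open>The diagonal entry of \<open>z\<close> at \<open>b0\<close> is
      \<open>\<psi> z\<close>, the inverse of \<open>\<psi> casimir\<close>, although
      \<open>b0\<close> itself need not be an eigenvector.\<close>
    have "\<psi> casimir = of_real t" using \<kappa>_eval[of casimir] t by simp
    moreover have "\<psi> z * \<psi> casimir = 1" using \<psi>_mult[of z casimir] z(3) \<psi>_one by simp
    ultimately have "\<psi> z = of_real (1 / t)" using t(1) by (simp add: field_simps)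
    then have "complex_of_real (1 / D + 4 / r + 1 / t) = of_real 1"
      using tr unfolding sumU sum5 \<psi>_def by (simp add: add.commute)
    then have "1 / D + 4 / r + 1 / t = 1" by (simp only: of_real_eq_iff)
    then show ?thesis using \<kappa> t U_eq(2) by blast
  qed
  have ind_vw: "fv.independent {v, w}" "v \<noteq> w" using ind2 by (auto simp: insert_commute)
  have "\<forall>x\<in>V. casimir \<star> x = (\<lambda>k. complex_of_real r * x k)" using \<alpha> r(2) by simp
  then show ?thesis using V(1) ind_vw VS r(1) main by blast
qed

end

subsection \<open>Structure constants of a fusion ring\<close>

context ring
begin

lemma int_pow_closed [simp]: "x \<in> carrier R \<Longrightarrow> [(n::int)] \<cdot> x \<in> carrier R"
  by (rule add.int_pow_closed)

lemma additive_int_pow: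
  fixes f :: "'a \<Rightarrow> 'c::ring_1"
  assumes f: "\<And>x y. \<lbrakk>x \<in> carrier R; y \<in> carrier R\<rbrakk> \<Longrightarrow> f (x \<oplus> y) = f x + f y" and y: "y \<in> carrier R"
  shows "f ([(n::int)] \<cdot> y) = of_int n * f y"
proof (induct n rule: int_induct[where k = 0])
  case base
  have "f \<zero> = 0" using f[of \<zero> \<zero>] by simp
  then show ?case using y by (simp add: add_pow_int_ge)
next
  case (step1 i)
  have "[(i + 1)] \<cdot> y = [i] \<cdot> y \<oplus> y" using y add.int_pow_mult[of y i 1] by (simp add: add_pow_int_ge)
  then show ?case using step1 y by (simp add: f distrib_right)
next
  case (step2 i)
  have "[i] \<cdot> y = [(i - 1)] \<cdot> y \<oplus> y" using y add.int_pow_mult[of y "i - 1" 1] by (simp add: add_pow_int_ge)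
  then have "f ([i] \<cdot> y) = f ([(i - 1)] \<cdot> y) + f y" using y by (simp add: f)
  then show ?case using step2 by (simp add: algebra_simps)
qed

lemma additive_finsum:
  fixes f :: "'a \<Rightarrow> 'c::ring_1"
  assumes f: "\<And>x y. \<lbrakk>x \<in> carrier R; y \<in> carrier R\<rbrakk> \<Longrightarrow> f (x \<oplus> y) = f x + f y"
    and S: "finite S" "\<And>b. b \<in> S \<Longrightarrow> x b \<in> carrier R"
  shows "f (\<Oplus>b\<in>S. x b) = (\<Sum>b\<in>S. f (x b))"
  using S
proof (induct S)
  case empty
  then show ?case using f[of \<zero> \<zero>] by simp
next
  case (insert b S)
  then have "(\<Oplus>b\<in>insert b S. x b) = x b \<oplus> (\<Oplus>b\<in>S. x b)"
    by (intro finsum_insert) auto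
  moreover have "(\<Oplus>b\<in>S. x b) \<in> carrier R"
    using insert by (intro finsum_closed) auto
  ultimately show ?case using insert by (simp add: f)
qed

end

context fusion_ring
begin

lemma basis_carrier [simp]: "b \<in> basis R \<Longrightarrow> b \<in> carrier R"
  using basis_subset by blast

lemma is_coords_coords: "x \<in> carrier R \<Longrightarrow> is_coords R x (coords R x)"
  unfolding coords_def using free by (rule theI')

lemma coords_unique: "x \<in> carrier R \<Longrightarrow> is_coords R x c \<Longrightarrow> coords R x = c"
  using free[of x] is_coords_coords[of x] by blast

lemma expansion: "x \<in> carrier R \<Longrightarrow> x = (\<Oplus>b\<in>basis R. [coords R x b] \<cdot> b)"
  using is_coords_coords by (simp add: is_coords_def)

lemma coords_lincomb:
  assumes "c \<in> basis R \<rightarrow>\<^sub>E UNIV"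
  shows "coords R (\<Oplus>b\<in>basis R. [c b] \<cdot> b) = c"
  using assms by (intro coords_unique finsum_closed) (auto simp: is_coords_def)

lemma coords_add:
  assumes "x \<in> carrier R" "y \<in> carrier R" "b \<in> basis R"
  shows "coords R (x \<oplus> y) b = coords R x b + coords R y b"
proof -
  have "x \<oplus> y = (\<Oplus>b\<in>basis R. [coords R x b] \<cdot> b \<oplus> [coords R y b] \<cdot> b)"
  proof -
    have "x \<oplus> y = (\<Oplus>b\<in>basis R. [coords R x b] \<cdot> b) \<oplus> (\<Oplus>b\<in>basis R. [coords R y b] \<cdot> b)"
      by (rule arg_cong2[OF expansion[OF assms(1)] expansion[OF assms(2)]])
    then show ?thesis by (simp add: finsum_addf Pi_iff)
  qed
  also have "\<dots> = (\<Oplus>b\<in>basis R. [(\<lambda>b\<in>basis R. coords R x b + coords R y b) b] \<cdot> b)"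
    by (intro finsum_cong') (auto simp: add.int_pow_mult)
  finally have eq: "x \<oplus> y = (\<Oplus>b\<in>basis R. [(\<lambda>b\<in>basis R. coords R x b + coords R y b) b] \<cdot> b)" .
  have "coords R (x \<oplus> y) = (\<lambda>b\<in>basis R. coords R x b + coords R y b)"
    unfolding eq by (rule coords_lincomb) auto
  then show ?thesis using assms by simp
qed

lemma coords_basis:
  assumes "b \<in> basis R" "k \<in> basis R"
  shows "coords R b k = (if b = k then 1 else 0)"
proof -
  let ?c = "\<lambda>k\<in>basis R. if b = k then 1 else (0::int)"
  have "(\<Oplus>k\<in>basis R. [?c k] \<cdot> k) = (\<Oplus>k\<in>basis R. if b = k then k else \<zero>)"
    by (intro finsum_cong') (auto simp: add_pow_int_ge)
  also have "\<dots> = b"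
    using assms finite_basis by (intro add.finprod_singleton) auto
  finally have "coords R b = ?c"
    using coords_lincomb[of ?c] by auto
  then show ?thesis using assms by simp
qed

text \<open>Used throughout with \<open>f\<close> a coordinate of a product as a function of one
  factor; it carries identities from the basis to the whole ring.\<close>

lemma additive_expansion:
  fixes f :: "'a \<Rightarrow> 'c::ring_1"
  assumes f: "\<And>x y. \<lbrakk>x \<in> carrier R; y \<in> carrier R\<rbrakk> \<Longrightarrow> f (x \<oplus> y) = f x + f y" and x: "x \<in> carrier R"
  shows "f x = (\<Sum>b\<in>basis R. of_int (coords R x b) * f b)"
proof -
  have "f x = f (\<Oplus>b\<in>basis R. [coords R x b] \<cdot> b)"
    using expansion[OF x] by (rule arg_cong)
  also have "\<dots> = (\<Sum>b\<in>basis R. f ([coords R x b] \<cdot> b))"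
    using finite_basis by (intro additive_finsum f) auto
  also have "\<dots> = (\<Sum>b\<in>basis R. of_int (coords R x b) * f b)"
    by (intro sum.cong refl additive_int_pow f) auto
  finally show ?thesis .
qed

lemma coords_eqI:
  assumes "x \<in> carrier R" "y \<in> carrier R" "\<And>k. k \<in> basis R \<Longrightarrow> coords R x k = coords R y k"
  shows "x = y"
proof -
  have "(\<Oplus>b\<in>basis R. [coords R x b] \<cdot> b) = (\<Oplus>b\<in>basis R. [coords R y b] \<cdot> b)"
    using assms by (intro finsum_cong') auto
  then show ?thesis using expansion assms by metis
qed

text \<open>Associativity compares the coordinates of a triple product, expanded through either
  inner product; the star symmetry expands a coordinate of the image under the
  anti-automorphism.\<close>

lemma structure_constants_coords: "structure_constants (basis R) (\<lambda>a b c. coords R (a \<otimes> b) c) (star R) \<one>"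
proof
  obtain \<phi> where \<phi>: "\<phi> \<in> ring_iso R (opposite_ring R)" "\<forall>b\<in>basis R. \<phi> b = star R b"
    using star_anti by blast
  have \<phi>_add: "\<phi> (x \<oplus> y) = \<phi> x \<oplus> \<phi> y" and \<phi>_mult: "\<phi> (x \<otimes> y) = \<phi> y \<otimes> \<phi> x"
    and \<phi>_closed: "\<phi> x \<in> carrier R" if "x \<in> carrier R" "y \<in> carrier R" for x y
    using ring_iso_memE[OF \<phi>(1)] that by (auto simp: opposite_ring_def)
  show "coords R (star R b \<otimes> star R a) (star R k) = coords R (a \<otimes> b) k"
    if abk: "a \<in> basis R" "b \<in> basis R" "k \<in> basis R" for a b k
  proof -
    let ?f = "\<lambda>x. coords R (\<phi> x) (star R k)"
    have "?f (a \<otimes> b) = (\<Sum>m\<in>basis R. of_int (coords R (a \<otimes> b) m) * ?f m)"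
      using abk by (intro additive_expansion) (auto simp: \<phi>_add \<phi>_closed coords_add star_closed)
    also have "\<dots> = (\<Sum>m\<in>basis R. if m = k then coords R (a \<otimes> b) m else 0)"
    proof (intro sum.cong refl)
      fix m assume m: "m \<in> basis R"
      then have "star R m = star R k \<longleftrightarrow> m = k" using star_star abk by metis
      then show "of_int (coords R (a \<otimes> b) m) * ?f m = (if m = k then coords R (a \<otimes> b) m else 0)"
        using m abk by (simp add: \<phi>(2) coords_basis star_closed)
    qed
    also have "\<dots> = coords R (a \<otimes> b) k" using abk by (simp add: finite_basis)
    finally show ?thesis using abk by (simp add: \<phi>_mult \<phi>(2))
  qed
  show "(\<Sum>m\<in>basis R. coords R (a \<otimes> b) m * coords R (m \<otimes> c) k) =
      (\<Sum>m\<in>basis R. coords R (b \<otimes> c) m * coords R (a \<otimes> m) k)"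
    if abck: "a \<in> basis R" "b \<in> basis R" "c \<in> basis R" "k \<in> basis R" for a b c k
  proof -
    have "(\<Sum>m\<in>basis R. of_int (coords R (a \<otimes> b) m) * coords R (m \<otimes> c) k) = coords R (a \<otimes> b \<otimes> c) k"
      using abck by (intro additive_expansion[symmetric]) (auto simp: l_distr coords_add)
    moreover have "(\<Sum>m\<in>basis R. of_int (coords R (b \<otimes> c) m) * coords R (a \<otimes> m) k) = coords R (a \<otimes> (b \<otimes> c)) k"
      using abck by (intro additive_expansion[symmetric]) (auto simp: r_distr coords_add)
    ultimately show ?thesis using abck by (simp add: m_assoc)
  qed
qed (auto simp: finite_basis one_in_basis nonneg star_closed star_star coords_basis star_orth)

end

sublocale fusion_ring \<subseteq> sc: structure_constants "basis R" "\<lambda>a b c. coords R (a \<otimes> b) c" "star R" \<one>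
  by (rule structure_constants_coords)

context fusion_ring
begin

subsection \<open>Frobenius-Perron dimension\<close>

lemma character_hom:
  fixes \<chi> :: "'a \<Rightarrow> real"
  assumes "sc.character \<chi>"
  shows "(\<lambda>x\<in>carrier R. \<Sum>b\<in>basis R. of_int (coords R x b) * \<chi> b) \<in> Ring.ring_hom R class_ring"
proof (rule ring_hom_memI)
  define h where "h x = (\<Sum>b\<in>basis R. of_int (coords R x b) * \<chi> b)" for x
  have add: "h (x \<oplus> y) = h x + h y" if "x \<in> carrier R" "y \<in> carrier R" for x y
    using that by (simp add: h_def coords_add distrib_right sum.distrib)
  have h_basis: "h b = \<chi> b" if "b \<in> basis R" for b
    using that by (simp add: h_def coords_basis finite_basis if_distrib if_distribR cong: if_cong)
  have mult_basis: "h (a \<otimes> b) = h a * h b" if "a \<in> basis R" "b \<in> basis R" for a b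
    using assms that by (simp add: h_basis sc.character_def) (simp add: h_def)
  have exp: "h x = (\<Sum>b\<in>basis R. of_int (coords R x b) * h b)" if "x \<in> carrier R" for x
    using that add by (intro additive_expansion)
  fix x y assume xy: "x \<in> carrier R" "y \<in> carrier R"
  have 1: "h (a \<otimes> y) = h a * h y" if a: "a \<in> basis R" for a
  proof -
    have "h (a \<otimes> y) = (\<Sum>b\<in>basis R. of_int (coords R y b) * h (a \<otimes> b))"
      using a xy by (intro additive_expansion) (auto simp: r_distr add)
    also have "\<dots> = (\<Sum>b\<in>basis R. h a * (of_int (coords R y b) * h b))"
      using a by (intro sum.cong refl) (simp add: mult_basis)
    also have "\<dots> = h a * h y"
      by (subst exp[OF xy(2)]) (simp add: sum_distrib_left)
    finally show ?thesis .
  qed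
  have "h (x \<otimes> y) = (\<Sum>a\<in>basis R. of_int (coords R x a) * h (a \<otimes> y))"
    using xy by (intro additive_expansion) (auto simp: l_distr add)
  also have "\<dots> = (\<Sum>a\<in>basis R. of_int (coords R x a) * h a * h y)"
    by (intro sum.cong refl) (simp add: 1)
  also have "\<dots> = h x * h y"
    by (subst exp[OF xy(1)]) (simp add: sum_distrib_right)
  finally show "(\<lambda>x\<in>carrier R. \<Sum>b\<in>basis R. of_int (coords R x b) * \<chi> b) (x \<otimes> y) =
      (\<lambda>x\<in>carrier R. \<Sum>b\<in>basis R. of_int (coords R x b) * \<chi> b) x \<otimes>\<^bsub>class_ring\<^esub>
      (\<lambda>x\<in>carrier R. \<Sum>b\<in>basis R. of_int (coords R x b) * \<chi> b) y"
    using xy by (simp add: h_def)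
  show "(\<lambda>x\<in>carrier R. \<Sum>b\<in>basis R. of_int (coords R x b) * \<chi> b) (x \<oplus> y) =
      (\<lambda>x\<in>carrier R. \<Sum>b\<in>basis R. of_int (coords R x b) * \<chi> b) x \<oplus>\<^bsub>class_ring\<^esub>
      (\<lambda>x\<in>carrier R. \<Sum>b\<in>basis R. of_int (coords R x b) * \<chi> b) y"
    using xy add[OF xy] by (simp add: h_def)
next
  have "(\<Sum>b\<in>basis R. of_int (coords R \<one> b) * \<chi> b) = \<chi> \<one>"
    by (simp add: coords_basis finite_basis one_in_basis if_distrib if_distribR cong: if_cong)
  then show "(\<lambda>x\<in>carrier R. \<Sum>b\<in>basis R. of_int (coords R x b) * \<chi> b) \<one> = \<one>\<^bsub>class_ring\<^esub>"
    using assms by (simp add: sc.character_def)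
qed simp

lemma hom_character:
  assumes "d \<in> Ring.ring_hom R (class_ring :: real ring)"
  shows "sc.character d" "x \<in> carrier R \<Longrightarrow> d x = (\<Sum>b\<in>basis R. of_int (coords R x b) * d b)"
proof -
  have exp: "d x = (\<Sum>b\<in>basis R. of_int (coords R x b) * d b)" if "x \<in> carrier R" for x
    using assms that by (intro additive_expansion) (auto simp: Ring.ring_hom_def)
  show "sc.character d"
    unfolding sc.character_def
  proof safe
    show "d \<one> = 1" using assms by (simp add: Ring.ring_hom_def)
    fix a b assume "a \<in> basis R" "b \<in> basis R"
    then show "d a * d b = (\<Sum>k\<in>basis R. of_int (coords R (a \<otimes> b) k) * d k)"
      using assms exp[of "a \<otimes> b"] by (simp add: Ring.ring_hom_def)
  qed
  show "x \<in> carrier R \<Longrightarrow> d x = (\<Sum>b\<in>basis R. of_int (coords R x b) * d b)" by (rule exp)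
qed

text \<open>Justifies the definite description. The additive extension of \<open>\<chi>\<close> is a
  homomorphism by \<open>character_hom\<close>; any competitor restricts to a positive character,
  hence agrees on the basis and by additivity on the carrier, and extensionality settles the
  rest.\<close>

lemma FPdim_eq:
  fixes \<chi> :: "'a \<Rightarrow> real"
  assumes \<chi>: "sc.character \<chi>" "\<forall>b\<in>basis R. \<chi> b > 0" and b: "b \<in> basis R"
  shows "FPdim R b = \<chi> b"
proof -
  define h where "h = (\<lambda>x\<in>carrier R. \<Sum>b\<in>basis R. of_int (coords R x b) * \<chi> b)"
  have h_basis: "h b = \<chi> b" if "b \<in> basis R" for b
    using that by (simp add: h_def coords_basis finite_basis if_distrib if_distribR cong: if_cong)
  have "FPdim R = h"
    unfolding FPdim_def
  proof (rule the_equality)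
    show "h \<in> Ring.ring_hom R class_ring \<and> h \<in> extensional (carrier R) \<and> (\<forall>b\<in>basis R. 0 < h b)"
      using \<chi> character_hom[OF \<chi>(1)] unfolding h_def[symmetric] by (auto simp: h_basis) (auto simp: h_def)
    fix d :: "'a \<Rightarrow> real"
    assume d: "d \<in> Ring.ring_hom R class_ring \<and> d \<in> extensional (carrier R) \<and> (\<forall>b\<in>basis R. 0 < d b)"
    then have "d b = \<chi> b" if "b \<in> basis R" for b
      using sc.character_unique[OF hom_character(1)[of d] _ \<chi> that] d by blast
    then have "d x = h x" if "x \<in> carrier R" for x
      using hom_character(2)[of d x] d that by (simp add: h_def)
    then show "d = h"
      using d by (intro extensionalityI[of d "carrier R"]) (auto simp: h_def)
  qed
  then show ?thesis using h_basis b by simp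
qed

lemma FPdim_character: "sc.character (FPdim R)" "b \<in> basis R \<Longrightarrow> FPdim R b > 0"
proof -
  obtain \<chi> :: "'a \<Rightarrow> real" where \<chi>: "sc.character \<chi>" "\<forall>b\<in>basis R. \<chi> b > 0"
    using sc.positive_character_exists by blast
  show "sc.character (FPdim R)"
    using \<chi>(1) unfolding sc.character_def by (simp add: FPdim_eq[OF \<chi>] one_in_basis cong: sum.cong)
  show "b \<in> basis R \<Longrightarrow> FPdim R b > 0" using FPdim_eq[OF \<chi>] \<chi>(2) by simp
qed

subsection \<open>Formal codegrees from minimal left ideals\<close>

text \<open>Equality is claimed on the basis only: elsewhere one side is \<open>undefined\<close>
  and the other is 0.\<close>

lemma to_complexification_central_Z:
  assumes "k \<in> basis R"
  shows "to_complexification R (central_Z R) k = sc.casimir k"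
proof -
  have "coords R (central_Z R) k = (\<Sum>b\<in>basis R. coords R (b \<otimes> star R b) k)"
    unfolding central_Z_def using finite_basis star_closed assms
    by (intro additive_finsum) (auto simp: coords_add)
  moreover have "(sc.amul (sc.unit_vec b) (sc.unit_vec (star R b)) :: 'a \<Rightarrow> complex) k = of_int (coords R (b \<otimes> star R b) k)"
    if "b \<in> basis R" for b
  proof -
    have "(sc.amul (sc.unit_vec b) (sc.unit_vec (star R b)) :: 'a \<Rightarrow> complex) k
        = (\<Sum>l\<in>basis R. of_int (coords R (b \<otimes> star R b) l) * sc.unit_vec l k)"
      using that star_closed by (simp only: sc.unit_vec_amul sc.sum_fun_apply)
    then show ?thesis
      using assms by (simp add: sc.unit_vec_def finite_basis if_distrib cong: if_cong)
  qed
  ultimately show ?thesis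
    using assms by (simp add: to_complexification_def sc.casimir_def sc.sum_fun_apply)
qed

lemma amul_cong_left:
  "(\<And>k. k \<in> basis R \<Longrightarrow> u k = u' k) \<Longrightarrow> sc.amul u v = sc.amul u' v"
  unfolding sc.amul_def by (intro ext if_cong sum.cong refl) simp

text \<open>With \<open>u\<close> a numbered basis of \<open>V\<close>, the matrices of the left
  multiplications in this basis form a representation. Invariant subspaces of the coordinate space
  correspond to left ideals inside \<open>V\<close>, so minimality becomes irreducibility.\<close>

lemma minimal_left_ideal_codegree:
  assumes V: "sc.minimal_left_ideal V"
    and u: "inj_on u {..<n}" "fv.independent (u ` {..<n})" "V = fv.span (u ` {..<n})" "n > 0"
    and \<alpha>: "\<And>x. x \<in> V \<Longrightarrow> sc.amul sc.casimir x = (\<lambda>k. \<alpha> * x k)"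
  shows "\<alpha> / of_nat n \<in> formal_codegrees R"
proof -
  let ?A = "complexification R"
  define r where "r x i = fv.representation (u ` {..<n}) x (u i)" for x i
  have LV: "sc.left_ideal V" using V by (simp add: sc.minimal_left_ideal_def)
  note V' = sc.left_idealD[OF LV]
  have u_in: "u i \<in> V" if "i < n" for i
    using u(3) that by (auto intro: fv.span_base)
  have r_add: "r (x + y) i = r x i + r y i" if "x \<in> V" "y \<in> V" for x y i
    using that unfolding r_def u(3) by (simp add: fv.representation_add[OF u(2)])
  have r_scale: "r (\<lambda>k. c * x k) i = c * r x i" if "x \<in> V" for x c i
    using that unfolding r_def u(3) by (simp only: fv.representation_scale[OF u(2)])
  have sum_in: "(\<Sum>j<m. (\<lambda>k. c j * u j k)) \<in> V" if "m \<le> n" for m and c :: "nat \<Rightarrow> complex"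
    using that by (induct m) (auto intro!: V'(4-6) simp: u_in)
  have r_u: "r (u j) i = (if j = i then 1 else 0)" if "i < n" "j < n" for i j
    using that u(1) unfolding r_def by (subst fv.representation_basis[OF u(2)]) (auto simp: inj_on_def)
  have r_0: "r 0 i = 0" for i by (simp add: r_def fv.representation_zero)
  have r_sum: "r (\<Sum>j<m. (\<lambda>k. c j * f j k)) i = (\<Sum>j<m. c j * r (f j) i)"
    if "\<And>j. j < m \<Longrightarrow> f j \<in> V" for m i and c :: "nat \<Rightarrow> complex" and f
  proof -
    have "(\<Sum>j<m. (\<lambda>k. c j * f j k)) \<in> V \<and> r (\<Sum>j<m. (\<lambda>k. c j * f j k)) i = (\<Sum>j<m. c j * r (f j) i)"
      using that
    proof (induct m)
      case 0
      then show ?case using V'(4) r_0 by (simp only: lessThan_0 sum.empty)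
    next
      case (Suc m)
      then have "(\<Sum>j<m. (\<lambda>k. c j * f j k)) \<in> V" "(\<lambda>k. c m * f m k) \<in> V" "f m \<in> V"
        using V'(6) by auto
      then show ?case using Suc by (simp only: sum.lessThan_Suc r_add r_scale V'(5) lessI less_SucI)
    qed
    then show ?thesis ..
  qed
  have expand: "x = (\<Sum>j<n. (\<lambda>k. r x j * u j k))" if "x \<in> V" for x
  proof -
    have "x = (\<Sum>b\<in>u ` {..<n}. (\<lambda>k. fv.representation (u ` {..<n}) x b * b k))"
      using that u(2,3) fv.sum_representation_eq[of "u ` {..<n}" x "u ` {..<n}"] by simp
    also have "\<dots> = (\<Sum>j<n. (\<lambda>k. r x j * u j k))"
      unfolding r_def by (rule sum.reindex[OF u(1), unfolded o_def])
    finally show ?thesis .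
  qed
  define \<rho> where "\<rho> f = mat n n (\<lambda>(i, j). r (sc.amul f (u j)) i)" for f
  define cv where "cv x = vec n (r x)" for x
  have \<rho>_cv: "\<rho> f *\<^sub>v cv x = cv (sc.amul f x)" if "x \<in> V" for f x
  proof (rule eq_vecI)
    fix i assume "i < dim_vec (cv (sc.amul f x))"
    then have i: "i < n" by (simp add: cv_def)
    have "cv (sc.amul f x) $ i = r (sc.amul f (\<Sum>j<n. (\<lambda>k. r x j * u j k))) i"
      using i expand[OF that] by (simp add: cv_def)
    also have "\<dots> = (\<Sum>j<n. r x j * r (sc.amul f (u j)) i)"
      by (simp only: sc.amul_sum_right sc.amul_scale_right) (intro r_sum V'(3) u_in)
    also have "\<dots> = (\<rho> f *\<^sub>v cv x) $ i"
      using i by (simp add: \<rho>_def cv_def scalar_prod_def lessThan_atLeast0 mult.commute)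
    finally show "(\<rho> f *\<^sub>v cv x) $ i = cv (sc.amul f x) $ i" ..
  qed (simp add: \<rho>_def cv_def)
  have \<rho>_add: "\<rho> (f + g) = \<rho> f + \<rho> g" for f g
    by (rule eq_matI) (auto simp: \<rho>_def sc.amul_add_left r_add V'(3) u_in)
  have \<rho>_scale: "\<rho> (\<lambda>k. c * f k) = c \<cdot>\<^sub>m \<rho> f" for c f
    by (rule eq_matI) (auto simp: \<rho>_def sc.amul_scale_left r_scale V'(3) u_in)
  have \<rho>_mult: "\<rho> (sc.amul f g) = \<rho> f * \<rho> g" for f g
  proof (rule eq_matI)
    fix i j assume "i < dim_row (\<rho> f * \<rho> g)" "j < dim_col (\<rho> f * \<rho> g)"
    then have ij: "i < n" "j < n" by (auto simp: \<rho>_def)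
    have "(\<rho> f * \<rho> g) $$ (i, j) = (\<rho> f *\<^sub>v cv (sc.amul g (u j))) $ i"
      using ij by (simp add: \<rho>_def cv_def scalar_prod_def)
    also have "\<dots> = cv (sc.amul f (sc.amul g (u j))) $ i"
      using ij by (simp add: \<rho>_cv V'(3) u_in)
    also have "\<dots> = \<rho> (sc.amul f g) $$ (i, j)"
      using ij by (simp add: \<rho>_def cv_def sc.amul_assoc)
    finally show "\<rho> (sc.amul f g) $$ (i, j) = (\<rho> f * \<rho> g) $$ (i, j)" ..
  qed (auto simp: \<rho>_def)
  have \<rho>_one: "\<rho> (sc.unit_vec \<one>) = 1\<^sub>m n"
  proof (rule eq_matI)
    fix i j assume "i < dim_row (1\<^sub>m n :: complex mat)" "j < dim_col (1\<^sub>m n :: complex mat)"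
    then have ij: "i < n" "j < n" by auto
    have "sc.amul (sc.unit_vec \<one>) (u j) = u j"
      using u_in[OF ij(2)] V'(2) by (intro sc.amul_unit_left) auto
    then show "\<rho> (sc.unit_vec \<one>) $$ (i, j) = 1\<^sub>m n $$ (i, j)"
      using ij by (simp add: \<rho>_def r_u)
  qed (auto simp: \<rho>_def)
  \<comment> \<open>Only coordinates on the basis matter to \<open>\<rho>\<close>; this bridges the
    value \<open>undefined\<close> in \<open>complexification\<close> and the value 0 in the
    function algebra.\<close>
  have \<rho>_cong: "\<rho> f = \<rho> g" if "\<And>k. k \<in> basis R \<Longrightarrow> f k = g k" for f g
    unfolding \<rho>_def using amul_cong_left[OF that] by simp
  have hom: "\<rho> \<in> Ring.ring_hom ?A (ring_mat TYPE(complex) n ())"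
  proof (rule ring_hom_memI)
    fix f g assume "f \<in> carrier ?A" "g \<in> carrier ?A"
    show "\<rho> f \<in> carrier (ring_mat TYPE(complex) n ())" by (simp add: \<rho>_def ring_mat_def)
    have "\<rho> (f \<otimes>\<^bsub>?A\<^esub> g) = \<rho> (sc.amul f g)"
      by (rule \<rho>_cong) (simp add: complexification_def sc.amul_def)
    then show "\<rho> (f \<otimes>\<^bsub>?A\<^esub> g) = \<rho> f \<otimes>\<^bsub>ring_mat TYPE(complex) n ()\<^esub> \<rho> g"
      by (simp add: \<rho>_mult ring_mat_def)
    have "\<rho> (f \<oplus>\<^bsub>?A\<^esub> g) = \<rho> (f + g)"
      by (rule \<rho>_cong) (simp add: complexification_def)
    then show "\<rho> (f \<oplus>\<^bsub>?A\<^esub> g) = \<rho> f \<oplus>\<^bsub>ring_mat TYPE(complex) n ()\<^esub> \<rho> g"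
      by (simp add: \<rho>_add ring_mat_def)
  next
    have "\<rho> (\<one>\<^bsub>?A\<^esub>) = \<rho> (sc.unit_vec \<one>)"
      by (rule \<rho>_cong) (simp add: complexification_def sc.unit_vec_def)
    then show "\<rho> (\<one>\<^bsub>?A\<^esub>) = \<one>\<^bsub>ring_mat TYPE(complex) n ()\<^esub>"
      by (simp add: \<rho>_one ring_mat_def)
  qed
  have rep: "algebra_rep ?A n \<rho>"
    unfolding algebra_rep_def
  proof (intro conjI hom allI ballI)
    fix c f assume "f \<in> carrier ?A"
    have "\<rho> (c \<odot>\<^bsub>?A\<^esub> f) = \<rho> (\<lambda>k. c * f k)"
      by (rule \<rho>_cong) (simp add: complexification_def)
    then show "\<rho> (c \<odot>\<^bsub>?A\<^esub> f) = c \<cdot>\<^sub>m \<rho> f" by (simp add: \<rho>_scale)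
  qed
  have cv_of_vec: "cv (\<Sum>j<n. (\<lambda>k. w $ j * u j k)) = w" if "w \<in> carrier_vec n" for w
  proof (rule eq_vecI)
    fix i assume "i < dim_vec w"
    then have i: "i < n" using that by simp
    have "r (\<Sum>j<n. (\<lambda>k. w $ j * u j k)) i = (\<Sum>j<n. w $ j * r (u j) i)"
      by (rule r_sum) (rule u_in)
    also have "\<dots> = (\<Sum>j<n. if j = i then w $ j else 0)"
      using i by (intro sum.cong refl) (simp add: r_u)
    finally show "cv (\<Sum>j<n. (\<lambda>k. w $ j * u j k)) $ i = w $ i"
      using i by (simp add: cv_def)
  qed (use that in \<open>simp add: cv_def\<close>)
  have irr: "irreducible_rep ?A n \<rho>"
    unfolding irreducible_rep_def
  proof (intro conjI rep u(4) allI impI)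
    fix W assume W: "VectorSpace.subspace class_ring W (module_vec TYPE(complex) n) \<and>
      (\<forall>x\<in>carrier ?A. \<forall>w\<in>W. \<rho> x *\<^sub>v w \<in> W)"
    then have sub: "submodule class_ring W (module_vec TYPE(complex) n)"
      by (simp add: VectorSpace.subspace_def)
    have W_sub: "W \<subseteq> carrier_vec n" and W0: "0\<^sub>v n \<in> W"
      and W_add: "\<And>v w. v \<in> W \<Longrightarrow> w \<in> W \<Longrightarrow> v + w \<in> W"
      and W_scale: "\<And>c w. w \<in> W \<Longrightarrow> c \<cdot>\<^sub>v w \<in> W"
      using submodule.subset[OF sub] submodule.zero_closed[OF sub]
        submodule.m_closed[OF sub] submodule.smult_closed[OF sub]
      by (auto simp: module_vec_def)
    have W_inv: "\<rho> f *\<^sub>v w \<in> W" if "w \<in> W" for f w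
    proof -
      have "\<rho> f = \<rho> (restrict f (basis R))" by (rule \<rho>_cong) simp
      moreover have "restrict f (basis R) \<in> carrier ?A" by (simp add: complexification_def)
      ultimately show ?thesis using W that by metis
    qed
    have cv0: "cv 0 = 0\<^sub>v n" by (rule eq_vecI) (auto simp: cv_def r_0)
    have cv_add: "cv (x + y) = cv x + cv y" if "x \<in> V" "y \<in> V" for x y
      by (rule eq_vecI) (auto simp: cv_def r_add that)
    have cv_scale: "cv (\<lambda>k. c * x k) = c \<cdot>\<^sub>v cv x" if "x \<in> V" for c x
      by (rule eq_vecI) (auto simp: cv_def r_scale that)
    \<comment> \<open>The invariant subspace \<open>W\<close> pulled back to \<open>V\<close> along
      the coordinate map is a left ideal, so it is 0 or all of \<open>V\<close>.\<close>
    define W' where "W' = {x \<in> V. cv x \<in> W}"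
    have "sc.left_ideal W'"
      unfolding sc.left_ideal_def fv.subspace_def
    proof (intro conjI allI ballI)
      show "0 \<in> W'" using W0 cv0 V'(4) by (simp add: W'_def)
      show "x + y \<in> W'" if "x \<in> W'" "y \<in> W'" for x y
        using that V'(5) cv_add W_add by (simp add: W'_def)
      show "(\<lambda>k. c * x k) \<in> W'" if "x \<in> W'" for c x
        using that V'(6) cv_scale W_scale by (simp add: W'_def)
      show "W' \<subseteq> sc.algebra" using V'(2) by (auto simp: W'_def)
      show "sc.amul f x \<in> W'" if "x \<in> W'" for f x
        using that V'(3) W_inv[of "cv x" f] by (simp add: W'_def \<rho>_cv)
    qed
    moreover have "W' \<subseteq> V" by (auto simp: W'_def)
    ultimately consider "W' = {0}" | "W' = V"
      using V by (auto simp: sc.minimal_left_ideal_def)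
    then show "W = {0\<^sub>v n} \<or> W = carrier_vec n"
    proof cases
      case 1
      have "w = 0\<^sub>v n" if "w \<in> W" for w
      proof -
        let ?x = "\<Sum>j<n. (\<lambda>k. w $ j * u j k)"
        have cvx: "cv ?x = w" using that W_sub by (intro cv_of_vec) auto
        then have "?x \<in> W'" using that sum_in[of n "\<lambda>j. w $ j"] by (simp only: W'_def mem_Collect_eq order_refl)
        then have "?x = 0" using 1 by blast
        then show ?thesis using cvx cv0 by simp
      qed
      then show ?thesis using W0 by blast
    next
      case 2
      have "w \<in> W" if "w \<in> carrier_vec n" for w
      proof -
        have "(\<Sum>j<n. (\<lambda>k. w $ j * u j k)) \<in> W'" using 2 sum_in[of n "\<lambda>j. w $ j"] by simp
        then show ?thesis using cv_of_vec[OF that] by (simp add: W'_def)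
      qed
      then show ?thesis using W_sub by blast
    qed
  qed
  have "\<rho> (to_complexification R (central_Z R)) = \<rho> sc.casimir"
    by (rule \<rho>_cong) (rule to_complexification_central_Z)
  also have "\<dots> = \<alpha> \<cdot>\<^sub>m 1\<^sub>m n"
    by (rule eq_matI) (auto simp: \<rho>_def \<alpha> u_in r_scale r_u)
  finally show ?thesis
    using irr unfolding formal_codegrees_def by blast
qed

text \<open>Every \<open>x\<close> multiplies \<open>char_vec \<kappa>\<close> by
  \<open>eval_char \<kappa> x\<close>, so the line through it is a left ideal, minimal for dimension
  reasons; the codegree is then the eigenvalue divided by 1.\<close>

lemma character_codegree:
  assumes "sc.character \<kappa>"
  shows "sc.eval_char \<kappa> sc.casimir \<in> formal_codegrees R"
proof -
  let ?w = "sc.char_vec \<kappa>"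
  have "?w \<one> = 1" using assms by (simp add: sc.char_vec_def sc.character_def one_in_basis)
  then have w0: "?w \<noteq> 0" by auto
  have span_w: "fv.span {?w} = range (\<lambda>c k. c * ?w k)" by (rule fv.span_singleton)
  have w_in: "(\<lambda>k. c * ?w k) \<in> fv.span {?w}" for c by (intro fv.span_scale fv.span_base) simp
  have LI: "sc.left_ideal (fv.span {?w})"
    unfolding sc.left_ideal_def
  proof (intro conjI allI ballI fv.subspace_span)
    show "fv.span {?w} \<subseteq> sc.algebra" by (intro fv.span_minimal sc.algebra_subspace) simp
    fix x v assume "v \<in> fv.span {?w}"
    then obtain c where c: "v = (\<lambda>k. c * ?w k)" by (auto simp: span_w)
    have "sc.amul x v = (\<lambda>k. (c * sc.eval_char \<kappa> x) * ?w k)"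
      unfolding c sc.amul_scale_right sc.amul_char_vec[OF assms] by (rule ext) (rule mult.assoc[symmetric])
    then show "sc.amul x v \<in> fv.span {?w}" by (rule ssubst) (rule w_in)
  qed
  have "sc.minimal_left_ideal (fv.span {?w})"
    unfolding sc.minimal_left_ideal_def
  proof (intro conjI LI allI impI)
    show "fv.span {?w} \<noteq> {0}" using w0 fv.span_base[of ?w "{?w}"] by blast
    fix W assume W: "sc.left_ideal W \<and> W \<subseteq> fv.span {?w}"
    show "W = {0} \<or> W = fv.span {?w}"
    proof (cases "W \<subseteq> {0}")
      case True
      then show ?thesis using W sc.left_idealD(4)[of W] by blast
    next
      case False
      then obtain x where x: "x \<in> W" "x \<noteq> 0" by blast
      then obtain c where c: "x = (\<lambda>k. c * ?w k)" using W by (auto simp: fv.span_singleton)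
      then have "c \<noteq> 0" using x(2) by auto
      then have "?w = (\<lambda>k. inverse c * x k)" by (simp add: c mult.assoc[symmetric])
      then have "?w \<in> W" using W x sc.left_idealD(6)[of W x "inverse c"] by metis
      then have "fv.span {?w} \<subseteq> W" using W sc.left_idealD(1) by (intro fv.span_minimal) auto
      then show ?thesis using W by blast
    qed
  qed
  moreover have "{..<1::nat} = {0}" by auto
  moreover have "sc.amul sc.casimir x = (\<lambda>k. sc.eval_char \<kappa> sc.casimir * x k)" if x: "x \<in> fv.span {?w}" for x
    using x by (auto simp: fv.span_singleton sc.amul_scale_right sc.amul_char_vec[OF assms] mult.left_commute)
  ultimately have "sc.eval_char \<kappa> sc.casimir / of_nat 1 \<in> formal_codegrees R"
    using w0 by (intro minimal_left_ideal_codegree[where u = "\<lambda>_. ?w" and V = "fv.span {?w}"]) auto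
  then show ?thesis by simp
qed

end

subsection \<open>The possible dimensions\<close>

text \<open>All summands are positive, so \<open>f\<close> is at least 2 and \<open>m\<close> at
  least 3. Then \<open>D \<ge> 6\<close> bounds \<open>m\<close> by 6, and each \<open>m\<close>
  bounds \<open>f\<close>. The surviving triples (m, f, D) are (3, 6, 6), (3, 4, 12), (4, 3, 6), (5,
  2, 10) and (6, 2, 6), the second factor 5 for \<open>m = 3\<close> failing because
  \<open>D\<close> would be 15/2. Of these only \<open>D\<close> is recorded.\<close>

lemma codegree_equation_solutions:
  fixes D m f :: int
  assumes D: "D \<ge> 6" and m: "m \<ge> 1" "m dvd D" and f: "f \<ge> 1"
    and eq: "1 / real_of_int D + 2 / of_int m + 1 / of_int f = 1"
  shows "D \<in> {6, 10, 12}"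
proof -
  have inv: "1 / real_of_int k \<le> 1 / of_int l" if "l > 0" "k \<ge> l" for k l :: int
    using that by (simp add: frac_le)
  have inv_less: "k < l" if "l > 0" "1 / of_int l < 1 / real_of_int k" for k l :: int
    using inv[of l k] that by (cases "k < l") auto
  have D6: "0 < 1 / real_of_int D" "1 / real_of_int D \<le> 1 / 6" using D inv[of 6 D] by auto
  have pos: "0 < 1 / real_of_int m" "0 < 1 / real_of_int f" using m f by auto
  have eq': "1 / real_of_int D + 2 * (1 / of_int m) + 1 / of_int f = 1" using eq by simp
  have f2: "f \<ge> 2"
    using eq' D6 pos f by (cases "f = 1") auto
  then have f_le: "1 / real_of_int f \<le> 1 / 2" using inv[of 2 f] by simp
  have "m \<noteq> 1"
  proof
    assume "m = 1"
    then have "1 / real_of_int D + 1 + 1 / of_int f = 0" using eq' by simp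
    then show False using D6(1) pos(2) by linarith
  qed
  moreover have "m \<noteq> 2"
  proof
    assume "m = 2"
    then have "1 / real_of_int D + 1 / of_int f = 0" using eq' by simp
    then show False using D6(1) pos(2) by linarith
  qed
  moreover have "\<not> m \<ge> 7"
  proof
    \<comment> \<open>2/7 + 1/6 + 1/2 is 40/42, which is less than 1.\<close>
    assume "m \<ge> 7"
    then have "1 / real_of_int m \<le> 1 / 7" using inv[of 7 m] by simp
    then show False using eq' D6 f_le by linarith
  qed
  ultimately consider "m = 3" | "m = 4" | "m = 5" | "m = 6" using m by linarith
  then show ?thesis
  proof cases
    case 1
    then have e: "1 / real_of_int D + 1 / of_int f = 1 / 3" using eq' by simp
    have "f < 7" by (rule inv_less) (simp, use e D6 in linarith)
    moreover have "f \<noteq> 5"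
    proof
      assume "f = 5"
      then have "real_of_int (2 * D) = of_int 15" using e D by (simp add: field_simps)
      then have "2 * D = 15" by (simp only: of_int_eq_iff)
      then show False by presburger
    qed
    ultimately consider "f = 2" | "f = 3" | "f = 4" | "f = 6" using f2 by linarith
    then show ?thesis using e D by cases (auto simp: field_simps)
  next
    case 2
    then have e: "1 / real_of_int D + 1 / of_int f = 1 / 2" using eq' by simp
    have "f < 4" by (rule inv_less) (simp, use e D6 in linarith)
    then consider "f = 2" | "f = 3" using f2 by linarith
    then show ?thesis using e D by cases (auto simp: field_simps)
  next
    case 3
    then have e: "1 / real_of_int D + 1 / of_int f = 3 / 5" using eq' by simp
    have "f < 3" by (rule inv_less) (simp, use e D6 in linarith)
    then have "f = 2" using f2 by linarith
    then show ?thesis using e D by (auto simp: field_simps)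
  next
    case 4
    then have e: "1 / real_of_int D + 1 / of_int f = 2 / 3" using eq' by simp
    have "f < 3" by (rule inv_less) (simp, use e D6 in linarith)
    then have "f = 2" using f2 by linarith
    then show ?thesis using e D by (auto simp: field_simps)
  qed
qed

section \<open>From noncommutativity to the possible dimensions\<close>

context fusion_ring
begin

lemma noncommuting_basis_elements:
  assumes "\<not> cring R"
  shows "\<exists>a\<in>basis R. \<exists>b\<in>basis R. a \<otimes> b \<noteq> b \<otimes> a"
proof (rule ccontr)
  assume "\<not> ?thesis"
  then have comm: "a \<otimes> b = b \<otimes> a" if "a \<in> basis R" "b \<in> basis R" for a b using that by blast
  have 1: "a \<otimes> y = y \<otimes> a" if a: "a \<in> basis R" and y: "y \<in> carrier R" for a y
  proof (rule coords_eqI)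
    fix k assume k: "k \<in> basis R"
    have "coords R (a \<otimes> y) k = (\<Sum>b\<in>basis R. of_int (coords R y b) * coords R (a \<otimes> b) k)"
      using a y k by (intro additive_expansion) (auto simp: r_distr coords_add)
    also have "\<dots> = (\<Sum>b\<in>basis R. of_int (coords R y b) * coords R (b \<otimes> a) k)"
      using a by (intro sum.cong refl) (simp add: comm)
    also have "\<dots> = coords R (y \<otimes> a) k"
      using a y k by (intro additive_expansion[symmetric]) (auto simp: l_distr coords_add)
    finally show "coords R (a \<otimes> y) k = coords R (y \<otimes> a) k" .
  qed (use a y in auto)
  have "x \<otimes> y = y \<otimes> x" if x: "x \<in> carrier R" and y: "y \<in> carrier R" for x y
  proof (rule coords_eqI)
    fix k assume k: "k \<in> basis R"
    have "coords R (x \<otimes> y) k = (\<Sum>b\<in>basis R. of_int (coords R x b) * coords R (b \<otimes> y) k)"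
      using x y k by (intro additive_expansion) (auto simp: l_distr coords_add)
    also have "\<dots> = (\<Sum>b\<in>basis R. of_int (coords R x b) * coords R (y \<otimes> b) k)"
      using 1[OF _ y] by (intro sum.cong refl) metis
    also have "\<dots> = coords R (y \<otimes> x) k"
      using x y k by (intro additive_expansion[symmetric]) (auto simp: r_distr coords_add)
    finally show "coords R (x \<otimes> y) k = coords R (y \<otimes> x) k" .
  qed (use x y in auto)
  then have "cring R" by (intro cring.intro comm_monoid.intro ring_axioms monoid_axioms) (simp add: comm_monoid_axioms_def)
  then show False using assms by blast
qed

lemma dimension_cases:
  assumes drinfeld: "drinfeld_ring R" and noncomm: "\<not> cring R" and rank: "card (basis R) \<le> 6"
  shows "card (basis R) = 6 \<and> (\<Sum>b\<in>basis R. (FPdim R b)\<^sup>2) \<in> {6, 10, 12}"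
proof -
  define D where "D = (\<Sum>b\<in>basis R. (FPdim R b)\<^sup>2)"
  have int: "FPdim R b \<in> \<int>" if "b \<in> basis R" for b
    using drinfeld that by (simp add: drinfeld_ring_def integral_fusion_ring_def)
  have codeg: "\<exists>m. f = complex_of_int m \<and> (\<exists>D'. D = of_int D' \<and> m dvd D')" if "f \<in> formal_codegrees R" for f
    using drinfeld that by (auto simp: drinfeld_ring_def FPdim_ring_def D_def)
  have ge1: "FPdim R b \<ge> 1" if "b \<in> basis R" for b
    using int[OF that] FPdim_character(2)[OF that] by (auto elim!: Ints_cases)
  have "D \<ge> (\<Sum>b\<in>basis R. 1)"
    unfolding D_def using ge1 by (intro sum_mono) (simp add: one_le_power)
  then have Dcard: "D \<ge> card (basis R)" by simp
  obtain a b where ab: "a \<in> basis R" "b \<in> basis R" "a \<otimes> b \<noteq> b \<otimes> a"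
    using noncommuting_basis_elements[OF noncomm] by blast
  then obtain k where k: "k \<in> basis R" "coords R (a \<otimes> b) k \<noteq> coords R (b \<otimes> a) k"
    using coords_eqI[of "a \<otimes> b" "b \<otimes> a"] by auto
  have uv: "(sc.amul (sc.unit_vec a) (sc.unit_vec b) :: 'a \<Rightarrow> complex) k = of_int (coords R (a \<otimes> b) k)"
    if "a \<in> basis R" "b \<in> basis R" for a b
  proof -
    have "(sc.amul (sc.unit_vec a) (sc.unit_vec b) :: 'a \<Rightarrow> complex) k
        = (\<Sum>l\<in>basis R. of_int (coords R (a \<otimes> b) l) * sc.unit_vec l k)"
      using that by (simp only: sc.unit_vec_amul sc.sum_fun_apply)
    then show ?thesis
      using k by (simp add: sc.unit_vec_def finite_basis if_distrib cong: if_cong)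
  qed
  have nc: "sc.amul (sc.unit_vec a) (sc.unit_vec b) \<noteq> (sc.amul (sc.unit_vec b) (sc.unit_vec a) :: 'a \<Rightarrow> complex)"
    using uv[OF ab(1,2)] uv[OF ab(2,1)] k(2) by auto
  have dpos: "\<forall>b\<in>basis R. 0 < FPdim R b" using FPdim_character(2) by blast
  obtain V v w r where V: "sc.minimal_left_ideal V" "fv.independent {v, w}" "v \<noteq> w" "V = fv.span {v, w}"
    "r \<ge> 1" "\<forall>x\<in>V. sc.amul sc.casimir x = (\<lambda>k. complex_of_real r * x k)"
    and eqs: "card (basis R) \<ge> 5 \<and> 1 / D + 4 / r = 1 \<or>
      card (basis R) \<ge> 6 \<and> (\<exists>\<kappa> t. sc.character \<kappa> \<and> sc.eval_char \<kappa> sc.casimir = complex_of_real t \<and> t \<ge> 1 \<and>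
         1 / D + 4 / r + 1 / t = 1)"
    using sc.trace_equation[OF FPdim_character(1) dpos ab(1,2) nc rank] unfolding D_def[symmetric]
    by - (elim exE conjE, rule that, assumption+)
  define u where "u i = (if i = 0 then v else w)" for i :: nat
  have "{..<2::nat} = {0, 1}" by auto
  then have "inj_on u {..<2}" "u ` {..<2} = {v, w}" using V(3) by (auto simp: u_def)
  then have "complex_of_real r / of_nat 2 \<in> formal_codegrees R"
    using V by (intro minimal_left_ideal_codegree[of V u 2]) auto
  then obtain m D' where m: "complex_of_real r / of_nat 2 = of_int m" "D = of_int D'" "m dvd D'"
    using codeg by blast
  have "complex_of_real r = of_real (2 * of_int m)" using m(1) by (simp add: field_simps)
  then have r: "r = 2 * of_int m" by (simp only: of_real_eq_iff)
  then have m1: "m \<ge> 1" using V(5) by linarith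
  from eqs show ?thesis
  proof
    assume c5: "card (basis R) \<ge> 5 \<and> 1 / D + 4 / r = 1"
    then have "D' \<ge> 5" using Dcard m(2) by linarith
    moreover have "1 / real_of_int D' + 2 / of_int m = 1" using c5 m(2) r by simp
    then have "real_of_int m + 2 * of_int D' = of_int D' * of_int m"
      using m1 \<open>D' \<ge> 5\<close> by (simp add: field_simps)
    then have "real_of_int (m + 2 * D') = of_int (D' * m)" by simp
    then have "m + 2 * D' = D' * m" by (simp only: of_int_eq_iff)
    \<comment> \<open>Completing the product in the cleared equation. It makes \<open>D' - 1\<close>
      a divisor of 2, which is impossible for \<open>D' \<ge> 5\<close>.\<close>
    then have "(D' - 1) * (m - 2) = 2" by (simp add: algebra_simps)
    then have "D' - 1 dvd 2" by (metis dvd_triv_left)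
    ultimately show ?thesis using zdvd_imp_le[of "D' - 1" 2] by linarith
  next
    assume c6: "card (basis R) \<ge> 6 \<and> (\<exists>\<kappa> t. sc.character \<kappa> \<and> sc.eval_char \<kappa> sc.casimir = complex_of_real t \<and> t \<ge> 1 \<and>
         1 / D + 4 / r + 1 / t = 1)"
    then obtain \<kappa> t where t: "sc.character \<kappa>" "sc.eval_char \<kappa> sc.casimir = complex_of_real t" "t \<ge> 1"
      "1 / D + 4 / r + 1 / t = 1" by blast
    obtain f where f: "complex_of_real t = of_int f"
      using codeg[OF character_codegree[OF t(1)]] t(2) by auto
    then have "complex_of_real t = of_real (of_int f)" by simp
    then have tf: "t = of_int f" by (simp only: of_real_eq_iff)
    have card6: "card (basis R) = 6" using c6 rank by simp
    have "D' \<in> {6, 10, 12}"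
    proof (rule codegree_equation_solutions[of D' m f])
      show "D' \<ge> 6" using Dcard card6 m(2) by linarith
      show "f \<ge> 1" using tf t(3) by linarith
      show "1 / real_of_int D' + 2 / of_int m + 1 / of_int f = 1"
        using t(4) unfolding m(2) r tf by simp
    qed (use m m1 in auto)
    then show ?thesis using card6 m(2) by (auto simp: D_def)
  qed
qed

subsection \<open>Invertible basis elements\<close>

lemma FPdim_mult:
  "\<lbrakk>a \<in> basis R; b \<in> basis R\<rbrakk> \<Longrightarrow>
    FPdim R a * FPdim R b = (\<Sum>k\<in>basis R. of_int (coords R (a \<otimes> b) k) * FPdim R k)"
  using FPdim_character(1) by (simp add: sc.character_def)

text \<open>The product of \<open>g\<close> with its star has dimension 1 and contains the unit
  once, which already accounts for all of that dimension; the other coefficients are nonnegative and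
  must vanish.\<close>

lemma star_invertible:
  assumes g: "g \<in> basis R" "FPdim R g = 1"
  shows "star R g \<otimes> g = \<one>" "g \<otimes> star R g = \<one>"
proof -
  have main: "a \<otimes> star R a = \<one>" if a: "a \<in> basis R" "FPdim R a = 1" for a
  proof -
    let ?c = "\<lambda>k. real_of_int (coords R (a \<otimes> star R a) k) * FPdim R k"
    have dpos: "\<forall>b\<in>basis R. 0 < FPdim R b" using FPdim_character(2) by blast
    have s: "FPdim R (star R a) = 1"
      using sc.character_s[OF FPdim_character(1) dpos a(1)] a(2) by simp
    have one: "FPdim R \<one> = 1" using FPdim_character(1) by (simp add: sc.character_def)
    have "(\<Sum>k\<in>basis R. ?c k) = FPdim R a * FPdim R (star R a)"
      by (rule FPdim_mult[symmetric]) (use a star_closed in auto)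
    then have "(\<Sum>k\<in>basis R. ?c k) = 1" using a s by simp
    moreover have "(\<Sum>k\<in>basis R. ?c k) = ?c \<one> + (\<Sum>k\<in>basis R - {\<one>}. ?c k)"
      using finite_basis one_in_basis by (rule sum.remove)
    moreover have "?c \<one> = 1" using star_orth[OF a(1) a(1)] one by simp
    ultimately have "(\<Sum>k\<in>basis R - {\<one>}. ?c k) = 0" by simp
    moreover have nn: "?c k \<ge> 0" if "k \<in> basis R" for k
      using that a star_closed nonneg dpos by (simp add: less_imp_le)
    ultimately have "?c k = 0" if "k \<in> basis R - {\<one>}" for k
      using that finite_basis by (subst (asm) sum_nonneg_eq_0_iff) auto
    then have z: "coords R (a \<otimes> star R a) k = 0" if "k \<in> basis R" "k \<noteq> \<one>" for k
      using that dpos by force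
    show ?thesis
    proof (rule coords_eqI)
      fix k assume "k \<in> basis R"
      then show "coords R (a \<otimes> star R a) k = coords R \<one> k"
        using z star_orth[OF a(1) a(1)] one_in_basis by (cases "k = \<one>") (auto simp: coords_basis)
    qed (use a star_closed in auto)
  qed
  show "g \<otimes> star R g = \<one>" by (rule main[OF g])
  have dpos: "\<forall>b\<in>basis R. 0 < FPdim R b" using FPdim_character(2) by blast
  have "FPdim R (star R g) = 1"
    using sc.character_s[OF FPdim_character(1) dpos g(1)] g(2) by simp
  from main[OF _ this] show "star R g \<otimes> g = \<one>" using g star_closed star_star by simp
qed

lemma basis_of_norm_one:
  assumes "x \<in> carrier R" "\<And>k. k \<in> basis R \<Longrightarrow> coords R x k \<ge> 0"
    and "(\<Sum>k\<in>basis R. coords R x k * coords R x k) = 1"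
  shows "x \<in> basis R"
proof -
  obtain k where k: "k \<in> basis R" "coords R x k \<noteq> 0"
  proof -
    have "\<exists>k\<in>basis R. coords R x k \<noteq> 0"
    proof (rule ccontr)
      assume "\<not> ?thesis"
      then have "(\<Sum>k\<in>basis R. coords R x k * coords R x k) = 0" by (intro sum.neutral) auto
      then show False using assms(3) by simp
    qed
    then show thesis using that by blast
  qed
  have "(\<Sum>k\<in>basis R. coords R x k * coords R x k) =
      coords R x k * coords R x k + (\<Sum>l\<in>basis R - {k}. coords R x l * coords R x l)"
    using finite_basis k(1) by (rule sum.remove)
  moreover have nn: "(\<Sum>l\<in>basis R - {k}. coords R x l * coords R x l) \<ge> 0"
    by (intro sum_nonneg) simp
  moreover have "coords R x k \<ge> 1" using k assms(2)[of k] by simp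
  then have "coords R x k * coords R x k \<ge> coords R x k" "coords R x k \<ge> 1"
    by (auto simp: mult_le_cancel_left1)
  ultimately have ck: "coords R x k = 1" and "(\<Sum>l\<in>basis R - {k}. coords R x l * coords R x l) = 0"
    using assms(3) by linarith+
  then have z: "coords R x l = 0" if "l \<in> basis R - {k}" for l
    using that finite_basis by (subst (asm) sum_nonneg_eq_0_iff) auto
  have "x = k"
    using assms(1) k(1) ck z by (intro coords_eqI) (auto simp: coords_basis)
  then show ?thesis using k by simp
qed

text \<open>Multiplication by \<open>g\<close> is an isometry, since its adjoint is multiplication
  by \<open>star R g\<close>, its inverse. So the image of a basis element has nonnegative integer
  coordinates with square sum 1.\<close>

lemma invertible_mult_closed:
  assumes g: "g \<in> basis R" "FPdim R g = 1" and b: "b \<in> basis R"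
  shows "g \<otimes> b \<in> basis R" "b \<otimes> g \<in> basis R"
proof -
  note inv = star_invertible[OF g]
  have sg: "star R g \<in> basis R" using g star_closed by simp
  show "g \<otimes> b \<in> basis R"
  proof (rule basis_of_norm_one)
    have "(\<Sum>k\<in>basis R. coords R (g \<otimes> b) k * coords R (g \<otimes> b) k) =
        (\<Sum>k\<in>basis R. coords R (g \<otimes> b) k * coords R (star R g \<otimes> k) b)"
      using g b sc.N_adjoint_left[of g b] by (intro sum.cong refl) simp
    also have "\<dots> = (\<Sum>m\<in>basis R. coords R (star R g \<otimes> g) m * coords R (m \<otimes> b) b)"
      using sg g b by (intro sc.N_assoc[symmetric]) auto
    also have "\<dots> = (\<Sum>m\<in>basis R. if m = \<one> then coords R (\<one> \<otimes> b) b else 0)"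
      unfolding inv using one_in_basis by (intro sum.cong refl) (auto simp: coords_basis)
    also have "\<dots> = 1" using b one_in_basis by (simp add: finite_basis coords_basis)
    finally show "(\<Sum>k\<in>basis R. coords R (g \<otimes> b) k * coords R (g \<otimes> b) k) = 1" .
  qed (use g b nonneg in auto)
  show "b \<otimes> g \<in> basis R"
  proof (rule basis_of_norm_one)
    have "(\<Sum>k\<in>basis R. coords R (b \<otimes> g) k * coords R (b \<otimes> g) k) =
        (\<Sum>k\<in>basis R. coords R (b \<otimes> g) k * coords R (k \<otimes> star R g) b)"
      using g b sc.N_adjoint_right[of b g] by (intro sum.cong refl) simp
    also have "\<dots> = (\<Sum>m\<in>basis R. coords R (g \<otimes> star R g) m * coords R (b \<otimes> m) b)"
      using sg g b by (intro sc.N_assoc) auto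
    also have "\<dots> = (\<Sum>m\<in>basis R. if m = \<one> then coords R (b \<otimes> \<one>) b else 0)"
      unfolding inv using one_in_basis by (intro sum.cong refl) (auto simp: coords_basis)
    also have "\<dots> = 1" using b one_in_basis by (simp add: finite_basis coords_basis)
    finally show "(\<Sum>k\<in>basis R. coords R (b \<otimes> g) k * coords R (b \<otimes> g) k) = 1" .
  qed (use g b nonneg in auto)
qed

lemma FPdim_mult_basis:
  assumes "a \<in> basis R" "b \<in> basis R" "a \<otimes> b \<in> basis R"
  shows "FPdim R (a \<otimes> b) = FPdim R a * FPdim R b"
proof -
  have "FPdim R a * FPdim R b = (\<Sum>k\<in>basis R. of_int (coords R (a \<otimes> b) k) * FPdim R k)"
    using assms by (intro FPdim_mult)
  also have "\<dots> = FPdim R (a \<otimes> b)"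
    using assms by (simp add: coords_basis finite_basis if_distrib if_distribR cong: if_cong)
  finally show ?thesis ..
qed

lemma star_mult_basis:
  assumes "a \<in> basis R" "b \<in> basis R" "a \<otimes> b \<in> basis R"
  shows "star R (a \<otimes> b) = star R b \<otimes> star R a"
proof (rule coords_eqI)
  fix k assume k: "k \<in> basis R"
  have "coords R (star R b \<otimes> star R a) k = coords R (a \<otimes> b) (star R k)"
    using sc.N_star[of a b "star R k"] assms k star_closed star_star by simp
  also have "\<dots> = coords R (star R (a \<otimes> b)) k"
    using assms k star_closed star_star by (auto simp: coords_basis)
  finally show "coords R (star R (a \<otimes> b)) k = coords R (star R b \<otimes> star R a) k" ..
qed (use assms star_closed in auto)

text \<open>Dimensions \<open>1, 1, 1, 1, 2, 2\<close>. The invertible elements form an abelian group permuting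
  \<open>{x, y}\<close>, with the same orbits from the left and from the right. If some \<open>g\<close> swaps \<open>x\<close> and \<open>y\<close>,
  then \<open>y = g x = x g\<close> commutes with \<open>x\<close>; otherwise \<open>x y\<close> and \<open>y x\<close> have the same coordinates.\<close>

lemma two_nonpointed_commute:
  assumes card6: "card (basis R) = 6"
    and xy: "x \<in> basis R" "y \<in> basis R" "x \<noteq> y" "FPdim R x = 2" "FPdim R y = 2"
    and pointed: "\<And>g. g \<in> basis R - {x, y} \<Longrightarrow> FPdim R g = 1"
    and ab: "a \<in> basis R" "b \<in> basis R"
  shows "a \<otimes> b = b \<otimes> a"
proof -
  define G where "G = basis R - {x, y}"
  have cardG: "card G = 4" and finG: "finite G"
    using card6 xy finite_basis by (auto simp: G_def card_Diff_subset)
  have Gb: "g \<in> basis R" "FPdim R g = 1" if "g \<in> G" for g using that pointed by (auto simp: G_def)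
  have G_iff: "g \<in> G \<longleftrightarrow> g \<in> basis R \<and> FPdim R g = 1" for g using Gb xy by (auto simp: G_def)
  have xy_iff: "b = x \<or> b = y \<longleftrightarrow> b \<in> basis R \<and> FPdim R b = 2" for b
    by (cases "b = x \<or> b = y") (use pointed[of b] xy in auto)
  have oneG: "\<one> \<in> G"
    using FPdim_character(1) one_in_basis by (simp add: G_iff sc.character_def)
  have dpos: "\<forall>b\<in>basis R. 0 < FPdim R b" using FPdim_character(2) by blast
  note s_dim = sc.character_s[OF FPdim_character(1) dpos]
  have sG: "star R g \<in> G" if "g \<in> G" for g
    using that star_closed s_dim by (simp add: G_iff)
  note invl = star_invertible(1)[OF Gb] and invr = star_invertible(2)[OF Gb]
  have cl: "g \<otimes> b \<in> basis R" "b \<otimes> g \<in> basis R" if "g \<in> G" "b \<in> basis R" for g b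
    using invertible_mult_closed[OF Gb that(2)] that by auto
  have cl_G: "g \<otimes> h \<in> G" if "g \<in> G" "h \<in> G" for g h
    using that cl[of g h] FPdim_mult_basis[of g h] by (simp add: G_iff)
  have Gcarr: "g \<in> carrier R" if "g \<in> G" for g using Gb that by auto
  have undo: "star R g \<otimes> (g \<otimes> p) = p" "(p \<otimes> g) \<otimes> star R g = p" "g \<otimes> (star R g \<otimes> p) = p"
    if "g \<in> G" "p \<in> carrier R" for g p
  proof -
    have gc: "g \<in> carrier R" "star R g \<in> carrier R" using sG Gcarr that by auto
    have inv: "star R g \<otimes> g = \<one>" "g \<otimes> star R g = \<one>" using invl invr that by auto
    show "star R g \<otimes> (g \<otimes> p) = p" using m_assoc[OF gc(2,1) that(2)] inv that by simp
    show "(p \<otimes> g) \<otimes> star R g = p" using m_assoc[OF that(2) gc] inv that by simp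
    show "g \<otimes> (star R g \<otimes> p) = p" using m_assoc[OF gc that(2)] inv that by simp
  qed
  have lcancel: "p = q" if "g \<in> G" "p \<in> carrier R" "q \<in> carrier R" "g \<otimes> p = g \<otimes> q" for g p q
    using undo(1)[OF that(1,2)] undo(1)[OF that(1,3)] that(4) by metis
  have rcancel: "p = q" if "g \<in> G" "p \<in> carrier R" "q \<in> carrier R" "p \<otimes> g = q \<otimes> g" for g p q
    using undo(2)[OF that(1,2)] undo(2)[OF that(1,3)] that(4) by metis
  have comm_G: "g \<otimes> h = h \<otimes> g" if g: "g \<in> G" and h: "h \<in> G" for g h
  proof (rule ccontr)
    assume ne: "g \<otimes> h \<noteq> h \<otimes> g"
    have aux: "p \<otimes> q \<noteq> \<one>" "p \<otimes> q \<noteq> p" "p \<otimes> q \<noteq> q" "p \<noteq> \<one>" if "p \<in> G" "q \<in> G" "p \<otimes> q \<noteq> q \<otimes> p" for p q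
    proof -
      show "p \<noteq> \<one>" using that Gcarr by auto
      have "q \<noteq> \<one>" using that Gcarr by auto
      then show "p \<otimes> q \<noteq> p" using lcancel[of p q \<one>] that Gcarr by auto
      show "p \<otimes> q \<noteq> q" using rcancel[of q p \<one>] that Gcarr \<open>p \<noteq> \<one>\<close> by auto
      show "p \<otimes> q \<noteq> \<one>"
      proof
        assume "p \<otimes> q = \<one>"
        then have "q = star R p" using lcancel[of p q "star R p"] invr that Gcarr sG by auto
        then have "q \<otimes> p = \<one>" using invl that by simp
        then show False using \<open>p \<otimes> q = \<one>\<close> that by simp
      qed
    qed
    \<comment> \<open>A noncommuting pair produces five distinct elements, but \<open>G\<close> has
      only four.\<close>
    have "card {\<one>, g, h, g \<otimes> h, h \<otimes> g} = 5"
    proof -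
      have "g \<noteq> h" using ne by auto
      note d = this aux[OF g h ne] aux[OF h g ne[symmetric]] ne
      show ?thesis using d d[symmetric] by auto
    qed
    moreover have "card {\<one>, g, h, g \<otimes> h, h \<otimes> g} \<le> card G"
      using finG oneG g h cl_G by (intro card_mono) auto
    ultimately show False using cardG by simp
  qed
  have xyc: "x \<in> carrier R" "y \<in> carrier R" using xy by auto
  have act: "g \<otimes> p = x \<or> g \<otimes> p = y" "p \<otimes> g = x \<or> p \<otimes> g = y" if "g \<in> G" "p = x \<or> p = y" for g p
    using that cl[of g p] Gb[of g] xy FPdim_mult_basis[of g p] FPdim_mult_basis[of p g]
    by (auto simp: xy_iff)
  have s_xy: "star R p = x \<or> star R p = y" if "p = x \<or> p = y" for p
    using that xy star_closed s_dim by (auto simp: xy_iff)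
  have fix_both: "g \<otimes> x = x \<longleftrightarrow> g \<otimes> y = y" if "g \<in> G" for g
    using act(1)[OF that, of x] act(1)[OF that, of y] lcancel[OF that, of x y] xy xyc by metis
  have fix_star: "star R g \<otimes> p = p \<longleftrightarrow> g \<otimes> p = p" if g: "g \<in> G" and p: "p = x \<or> p = y" for g p
  proof -
    have pc: "p \<in> carrier R" using p xyc by auto
    show ?thesis using undo(1)[OF g pc] undo(3)[OF g pc] by metis
  qed
  have comm_Gx: "g \<otimes> p = p \<otimes> g" if g: "g \<in> G" and p: "p = x \<or> p = y" for g p
  proof -
    have pb: "p \<in> basis R" using p xy by auto
    \<comment> \<open>The star turns the right action into the left one. On a two-element set each
      \<open>g\<close> acts as the identity or as the swap, so comparing fixed points settles
      equality of the two actions.\<close>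
    have "p \<otimes> g = p \<longleftrightarrow> star R (p \<otimes> g) = star R p"
      using star_star[of p] star_star[of "p \<otimes> g"] pb cl(2)[OF g pb] by metis
    also have "\<dots> \<longleftrightarrow> star R g \<otimes> star R p = star R p"
      using star_mult_basis[of p g] pb cl(2)[OF g pb] Gb(1)[OF g] by simp
    also have "\<dots> \<longleftrightarrow> g \<otimes> star R p = star R p"
      using fix_star[OF g s_xy[OF p]] .
    also have "\<dots> \<longleftrightarrow> g \<otimes> p = p"
      using s_xy[OF p] p fix_both[OF g] by metis
    finally show ?thesis using act[OF g p] p by metis
  qed
  have comm_xy: "x \<otimes> y = y \<otimes> x"
  proof (cases "\<exists>g\<in>G. g \<otimes> x = y")
    case True
    then obtain g where g: "g \<in> G" "g \<otimes> x = y" by blast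
    have "x \<otimes> (g \<otimes> x) = (x \<otimes> g) \<otimes> x" using g xyc Gcarr by (simp add: m_assoc)
    also have "\<dots> = (g \<otimes> x) \<otimes> x" using comm_Gx[OF g(1), of x] by simp
    finally show ?thesis using g by simp
  next
    case False
    then have fixed: "p \<otimes> g = p" if "g \<in> G" "p = x \<or> p = y" for g p
      using that act(1)[of g x] fix_both[of g] comm_Gx[of g] by metis
    have coeff: "coords R (p \<otimes> q) g = (if q = star R p then 1 else 0)"
      if "g \<in> G" "p = x \<or> p = y" "q = x \<or> q = y" for p q g
    proof -
      have pq: "p \<in> basis R" "q \<in> basis R" using that xy by auto
      \<comment> \<open>Rotation moves \<open>g\<close> to the right of \<open>q\<close>, where it
        is absorbed because it fixes \<open>q\<close>.\<close>
      have "coords R (p \<otimes> q) g = coords R (q \<otimes> star R g) (star R p)"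
        using sc.N_rotate[of p q g] pq Gb[OF that(1)] by simp
      also have "q \<otimes> star R g = q" using fixed sG that by auto
      finally show ?thesis using pq star_closed by (simp add: coords_basis)
    qed
    show ?thesis
    proof (rule coords_eqI)
      fix k assume k: "k \<in> basis R"
      show "coords R (x \<otimes> y) k = coords R (y \<otimes> x) k"
      proof (cases "k \<in> G")
        case True
        have "y = star R x \<longleftrightarrow> x = star R y" using star_star xy by metis
        then show ?thesis using coeff[OF True] by simp
      next
        case kxy: False
        then have kxy: "k = x \<or> k = y" using k by (auto simp: G_def)
        show ?thesis
        proof (cases "star R x = x")
          case True
          \<comment> \<open>With \<open>x\<close> and \<open>y\<close> self-dual, the star
            interchanges the two products and fixes \<open>k\<close>, so \<open>N_star\<close> gives
            the equality.\<close>
          then have "star R y = y" using s_xy[of y] star_star xy by metis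
          then show ?thesis
            using True sc.N_star[of y x k] xy kxy k by auto
        next
          case False
          then have sx: "star R x = y" using s_xy[of x] by auto
          then have sy: "star R y = x" using star_star xy by metis
          \<comment> \<open>The four elements of \<open>G\<close> occur once each in the product and
            use up its dimension 2 times 2, so nothing is left for \<open>x\<close> and
            \<open>y\<close>.\<close>
          have zero: "coords R (p \<otimes> q) k = 0" if "p = x \<or> p = y" "q = x \<or> q = y" "q = star R p" for p q
          proof -
            have pq: "p \<in> basis R" "q \<in> basis R" "FPdim R p = 2" "FPdim R q = 2" using that xy by auto
            let ?c = "\<lambda>k. real_of_int (coords R (p \<otimes> q) k) * FPdim R k"
            have "(\<Sum>k\<in>basis R. ?c k) = 4"
              using FPdim_mult[OF pq(1,2)] pq(3,4) by simp
            moreover have "(\<Sum>k\<in>basis R. ?c k) = (\<Sum>k\<in>{x, y}. ?c k) + (\<Sum>k\<in>G. ?c k)"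
              unfolding G_def using xy finite_basis by (subst add.commute, intro sum.subset_diff) auto
            moreover have "(\<Sum>k\<in>G. ?c k) = 4"
              using coeff that Gb cardG by simp
            ultimately have "?c x + ?c y = 0" using xy(3) by simp
            moreover have "?c x \<ge> 0" "?c y \<ge> 0" using nonneg pq xy by auto
            ultimately show ?thesis using kxy xy by auto
          qed
          have "coords R (x \<otimes> y) k = 0" by (rule zero) (simp_all only: sx simp_thms)
          moreover have "coords R (y \<otimes> x) k = 0" by (rule zero) (simp_all only: sy simp_thms)
          ultimately show ?thesis by simp
        qed
      qed
    qed (use xyc in auto)
  qed
  show ?thesis
  proof (cases "a \<in> G")
    case True
    then show ?thesis using comm_G[of a b] comm_Gx[of a b] ab by (auto simp: G_def)
  next
    case aG: False
    then have a: "a = x \<or> a = y" using ab by (auto simp: G_def)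
    show ?thesis
    proof (cases "b \<in> G")
      case True
      then show ?thesis using comm_Gx[of b a] a by auto
    next
      case False
      then have "b = x \<or> b = y" using ab by (auto simp: G_def)
      then show ?thesis using a comm_xy by auto
    qed
  qed
qed

section \<open>All basis elements have dimension one\<close>

lemma drinfeld_noncommutative_pointed:
  assumes drinfeld: "drinfeld_ring R" and noncomm: "\<not> cring R" and rank: "card (basis R) \<le> 6"
  shows "card (basis R) = 6" "\<And>b. b \<in> basis R \<Longrightarrow> FPdim R b = 1"
proof -
  let ?d = "FPdim R"
  show card6: "card (basis R) = 6" using dimension_cases[OF assms] by blast
  have D: "(\<Sum>b\<in>basis R. (?d b)\<^sup>2) \<in> {6, 10, 12}" using dimension_cases[OF assms] by blast
  have "\<exists>n. ?d b = of_int n \<and> n \<ge> 1" if "b \<in> basis R" for b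
  proof -
    have "?d b \<in> \<int>" using drinfeld that by (simp add: drinfeld_ring_def integral_fusion_ring_def)
    then obtain n where "?d b = of_int n" by (elim Ints_cases)
    then show ?thesis using FPdim_character(2)[OF that] by auto
  qed
  then obtain n where n: "\<And>b. b \<in> basis R \<Longrightarrow> ?d b = of_int (n b) \<and> n b \<ge> 1" by metis
  have Dn: "(\<Sum>b\<in>basis R. (n b)\<^sup>2) \<in> {6, 10, 12}"
  proof -
    define S where "S = (\<Sum>b\<in>basis R. (n b)\<^sup>2)"
    have "(\<Sum>b\<in>basis R. (?d b)\<^sup>2) = of_int S"
      using n by (simp add: S_def)
    then have "real_of_int S \<in> {6, 10, 12}" using D by simp
    then show ?thesis unfolding S_def[symmetric] by auto
  qed
  \<comment> \<open>The excess over six ones is 0, 4 or 6. A dimension of 3 or more would alone add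
    at least 8, and a dimension 2 adds 3, so the excess is three times the number of 2s: 4 is
    impossible, and 6 means exactly two of them.\<close>
  have sum: "(\<Sum>b\<in>basis R. (n b)\<^sup>2 - 1) = (\<Sum>b\<in>basis R. (n b)\<^sup>2) - 6"
    using card6 by (simp add: sum_subtractf)
  have nn: "(n b)\<^sup>2 - 1 \<ge> 0" if "b \<in> basis R" for b
    using n[OF that] by (simp add: one_le_power)
  have n12: "n b = 1 \<or> n b = 2" if b: "b \<in> basis R" for b
  proof (rule ccontr)
    assume "\<not> ?thesis"
    then have "n b \<ge> 3" using n[OF b] by auto
    then have "(n b)\<^sup>2 \<ge> 3\<^sup>2" by (intro power_mono) auto
    moreover have "(n b)\<^sup>2 - 1 \<le> (\<Sum>b\<in>basis R. (n b)\<^sup>2 - 1)"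
      using nn b finite_basis by (intro member_le_sum) auto
    ultimately show False using sum Dn by auto
  qed
  define X where "X = {b \<in> basis R. n b = 2}"
  have "(\<Sum>b\<in>basis R. (n b)\<^sup>2 - 1) = (\<Sum>b\<in>basis R. if b \<in> X then 3 else 0)"
    using n12 by (intro sum.cong refl) (fastforce simp: X_def)
  also have "\<dots> = (\<Sum>b\<in>X. 3)"
    using finite_basis by (subst sum.inter_filter[symmetric]) (auto simp: X_def intro!: sum.cong)
  finally have X: "3 * int (card X) = (\<Sum>b\<in>basis R. (n b)\<^sup>2) - 6" using sum by simp
  have "card X \<noteq> 2"
  proof
    assume "card X = 2"
    then obtain x y where xy: "X = {x, y}" "x \<noteq> y" by (auto simp: card_2_iff)
    then have "x \<in> X" "y \<in> X" by auto
    then have "x \<in> basis R" "y \<in> basis R" "?d x = 2" "?d y = 2"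
      using n by (auto simp: X_def)
    moreover have "?d g = 1" if "g \<in> basis R - {x, y}" for g
      using that n[of g] n12[of g] xy(1) by (auto simp: X_def)
    ultimately have "a \<otimes> b = b \<otimes> a" if "a \<in> basis R" "b \<in> basis R" for a b
      using two_nonpointed_commute[OF card6 _ _ xy(2) _ _ _ that] by blast
    then show False using noncommuting_basis_elements[OF noncomm] by blast
  qed
  then have "card X = 0" using X Dn by auto
  then have "X = {}" using finite_basis by (auto simp: X_def)
  then show "?d b = 1" if "b \<in> basis R" for b
    using that n[of b] n12[of b] by (auto simp: X_def)
qed

end

subsection \<open>Noncommutative groups of order six\<close>

lemma (in group) pow_mod:
  assumes "x \<in> carrier G" "x [^] n = \<one>"
  shows "x [^] (k mod n) = x [^] (k::nat)"
proof -
  have "x [^] k = x [^] (n * (k div n) + k mod n)" by simp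
  also have "\<dots> = (x [^] n) [^] (k div n) \<otimes> x [^] (k mod n)"
    using assms(1) by (simp only: nat_pow_mult[symmetric] nat_pow_pow)
  finally show ?thesis using assms by simp
qed

definition order6_elt :: "('g, 'm) monoid_scheme \<Rightarrow> 'g \<Rightarrow> 'g \<Rightarrow> nat \<times> nat \<Rightarrow> 'g" where
  "order6_elt G a t = (\<lambda>(i, j). t [^]\<^bsub>G\<^esub> i \<otimes>\<^bsub>G\<^esub> a [^]\<^bsub>G\<^esub> j)"

text \<open>Multiplication of the normal forms \<open>t^i a^j\<close> of the dihedral group of order
  six: \<open>a t = t a^2\<close>, so moving \<open>a^j\<close> past \<open>t\<close> doubles
  \<open>j\<close>.\<close>

definition order6_mult :: "nat \<times> nat \<Rightarrow> nat \<times> nat \<Rightarrow> nat \<times> nat" where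
  "order6_mult = (\<lambda>(i, j) (k, l). ((i + k) mod 2, ((if k = 0 then j else 2 * j) + l) mod 3))"

text \<open>An element of order 6 would make the group cyclic, and if all squares were trivial it
  would be abelian, so some \<open>a\<close> has order 3. Its powers form a subgroup
  \<open>H\<close> of index two; any \<open>t\<close> outside \<open>H\<close> has order 2. Finally
  \<open>a t = t a^j\<close> for some \<open>j\<close>, where \<open>j = 0\<close> makes
  \<open>a\<close> trivial and \<open>j = 1\<close> makes the group abelian.\<close>

lemma (in group) order6_normal_form:
  assumes card6: "card (carrier G) = 6"
    and nc: "\<exists>x\<in>carrier G. \<exists>y\<in>carrier G. x \<otimes> y \<noteq> y \<otimes> x"
  shows "\<exists>a\<in>carrier G. \<exists>t\<in>carrier G. a [^] (3::nat) = \<one> \<and> t [^] (2::nat) = \<one> \<and>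
    a \<otimes> t = t \<otimes> a [^] (2::nat) \<and> bij_betw (order6_elt G a t) ({0, 1} \<times> {0, 1, 2}) (carrier G)"
proof -
  have fin: "finite (carrier G)" using card6 by (metis card.infinite zero_neq_numeral)
  have ord6: "ord x \<noteq> 6" if x: "x \<in> carrier G" for x
  proof
    assume o: "ord x = 6"
    have "card ((\<lambda>n. x [^] n) ` {0..ord x - 1}) = 6"
      using ord_inj[OF x] o by (simp add: card_image)
    moreover have "(\<lambda>n. x [^] n) ` {0..ord x - 1} \<subseteq> carrier G" using x by auto
    ultimately have cyc: "(\<lambda>n. x [^] n) ` {0..ord x - 1} = carrier G"
      using fin card6 by (intro card_subset_eq) auto
    have "y \<otimes> z = z \<otimes> y" if yz: "y \<in> carrier G" "z \<in> carrier G" for y z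
    proof -
      obtain m n :: nat where "y = x [^] m" "z = x [^] n" using yz unfolding cyc[symmetric] by blast
      then show ?thesis using x by (simp add: nat_pow_mult add.commute)
    qed
    then show False using nc by blast
  qed
  have ord_cases: "ord x \<in> {1, 2, 3}" if x: "x \<in> carrier G" for x
  proof -
    have "ord x dvd 6" using ord_dvd_group_order[OF x] card6 by (simp add: Coset.order_def)
    moreover have "ord x \<le> 6" using calculation by (rule dvd_imp_le) simp
    then have "ord x \<in> {0, 1, 2, 3, 4, 5, 6}" by auto
    ultimately show ?thesis using ord6[OF x] by auto
  qed
  have "\<exists>a\<in>carrier G. a \<otimes> a \<noteq> \<one>"
  proof (rule ccontr)
    assume "\<not> ?thesis"
    then have sq: "x \<otimes> x = \<one>" if "x \<in> carrier G" for x using that by blast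
    have "x \<otimes> y = y \<otimes> x" if xy: "x \<in> carrier G" "y \<in> carrier G" for x y
    proof -
      have inv: "inv z = z" if "z \<in> carrier G" for z using sq that by (simp add: inv_equality)
      have "x \<otimes> y = inv (x \<otimes> y)" using xy by (simp add: inv)
      also have "\<dots> = inv y \<otimes> inv x" using xy by (rule inv_mult_group)
      finally show ?thesis using xy by (simp add: inv)
    qed
    then show False using nc by blast
  qed
  then obtain a where a: "a \<in> carrier G" "a \<otimes> a \<noteq> \<one>" by blast
  have a_sq: "a [^] (2::nat) = a \<otimes> a" using a by (simp add: numeral_2_eq_2)
  have "ord a \<noteq> 1"
  proof
    assume "ord a = 1"
    then have "a = \<one>" using pow_ord_eq_1[OF a(1)] a(1) by simp
    then show False using a by simp
  qed
  moreover have "ord a \<noteq> 2"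
  proof
    assume "ord a = 2"
    then show False using pow_ord_eq_1[OF a(1)] a_sq a(2) by simp
  qed
  ultimately have ord_a: "ord a = 3" using ord_cases[OF a(1)] by auto
  have a3: "a [^] (3::nat) = \<one>" using pow_ord_eq_1[OF a(1)] ord_a by simp
  have inj_a: "inj_on (\<lambda>n. a [^] n) {0, 1, 2::nat}"
  proof -
    have "{0..ord a - 1} = {0, 1, 2}" using ord_a by auto
    then show ?thesis using ord_inj[OF a(1)] by simp
  qed
  define H where "H = (\<lambda>n. a [^] n) ` {0, 1, 2::nat}"
  have H_pow: "a [^] n \<in> H" for n :: nat
  proof -
    have eq: "a [^] n = a [^] (n mod 3)" using pow_mod[OF a(1) a3, of n] by (rule sym)
    have "n mod 3 = 0 \<or> n mod 3 = 1 \<or> n mod 3 = 2" by presburger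
    then have "n mod 3 \<in> {0, 1, 2}" by simp
    then show ?thesis unfolding H_def eq by (rule imageI)
  qed
  have H_E: "\<exists>n::nat. h = a [^] n" if "h \<in> H" for h
    using that unfolding H_def by (elim imageE) (rule exI)
  have H_carr: "H \<subseteq> carrier G" using a by (auto simp: H_def)
  have card_H: "card H = 3" unfolding H_def using card_image[OF inj_a] by simp
  obtain t where t: "t \<in> carrier G" "t \<notin> H"
  proof -
    have "H \<noteq> carrier G" using card_H card6 by auto
    then show thesis using H_carr that by blast
  qed
  have H_mult: "h \<otimes> h' \<in> H" if "h \<in> H" "h' \<in> H" for h h'
  proof -
    obtain m n :: nat where "h = a [^] m" "h' = a [^] n" using H_E[OF \<open>h \<in> H\<close>] H_E[OF \<open>h' \<in> H\<close>] by (elim exE)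
    then show ?thesis using a H_pow[of "m + n"] by (simp add: nat_pow_mult)
  qed
  have undo: "x \<otimes> a [^] n \<otimes> a [^] (2 * n) = x" if "x \<in> carrier G" for x and n :: nat
  proof -
    have "x \<otimes> a [^] n \<otimes> a [^] (2 * n) = x \<otimes> a [^] (3 * n)"
      using that a by (simp add: m_assoc nat_pow_mult)
    also have "a [^] (3 * n) = \<one>" using a a3 by (simp add: nat_pow_pow[symmetric])
    finally show ?thesis using that by simp
  qed
  have t_coset: "t \<otimes> h \<notin> H" if h: "h \<in> H" for h
  proof
    assume *: "t \<otimes> h \<in> H"
    obtain n :: nat where "h = a [^] n" using H_E[OF h] ..
    then have "t = t \<otimes> h \<otimes> a [^] (2 * n)" using undo[OF t(1), of n] by simp
    then show False using H_mult[OF * H_pow[of "2 * n"]] t(2) by simp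
  qed
  have inj_t: "inj_on (\<lambda>h. t \<otimes> h) H"
  proof (rule inj_onI)
    fix h h' assume "h \<in> H" "h' \<in> H" "t \<otimes> h = t \<otimes> h'"
    then show "h = h'" using t(1) H_carr Units_l_cancel[of t h h'] by auto
  qed
  have carr: "carrier G = H \<union> (\<lambda>h. t \<otimes> h) ` H"
  proof -
    have "finite H" by (simp add: H_def)
    moreover have "H \<inter> (\<lambda>h. t \<otimes> h) ` H = {}" using t_coset by blast
    ultimately have "card (H \<union> (\<lambda>h. t \<otimes> h) ` H) = 6"
      using card_H card_image[OF inj_t] by (simp add: card_Un_disjoint)
    moreover have "H \<union> (\<lambda>h. t \<otimes> h) ` H \<subseteq> carrier G" using H_carr t by auto
    ultimately show ?thesis using fin card6 card_subset_eq by metis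
  qed
  \<comment> \<open>Otherwise the square of \<open>t\<close> lies in the coset of \<open>t\<close>,
    and cancelling \<open>t\<close> puts \<open>t\<close> into \<open>H\<close>.\<close>
  have tt: "t \<otimes> t \<in> H"
  proof (rule ccontr)
    assume "t \<otimes> t \<notin> H"
    then obtain h where h: "h \<in> H" "t \<otimes> t = t \<otimes> h" using carr t(1) by (metis UnE imageE m_closed)
    then have "t = h" using t(1) H_carr Units_l_cancel[of t t h] by auto
    then show False using h t by simp
  qed
  have "t \<noteq> \<one>" using t(2) H_pow[of 0] by auto
  have "ord t \<noteq> 1"
  proof
    assume "ord t = 1"
    then have "t = \<one>" using pow_ord_eq_1[OF t(1)] t(1) by simp
    then show False using \<open>t \<noteq> \<one>\<close> by simp
  qed
  moreover have "ord t \<noteq> 3"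
  proof
    assume "ord t = 3"
    then have "t [^] (3::nat) = \<one>" using pow_ord_eq_1[OF t(1)] by simp
    \<comment> \<open>If the cube of \<open>t\<close> is trivial, \<open>t\<close> is its own fourth
      power, the square of an element of \<open>H\<close>.\<close>
    then have "(t \<otimes> t) \<otimes> (t \<otimes> t) = t" using t(1) by (simp add: numeral_3_eq_3 m_assoc)
    then show False using H_mult[OF tt tt] t(2) by simp
  qed
  ultimately have "ord t = 2" using ord_cases[OF t(1)] by auto
  then have t2: "t [^] (2::nat) = \<one>" using pow_ord_eq_1[OF t(1)] by simp
  have "a \<otimes> t \<notin> H"
  proof
    assume "a \<otimes> t \<in> H"
    then have "a [^] (2::nat) \<otimes> (a \<otimes> t) \<in> H" using H_mult H_pow by blast
    moreover have "a [^] (2::nat) \<otimes> (a \<otimes> t) = a [^] (3::nat) \<otimes> t"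
      using a t by (simp add: numeral_2_eq_2 numeral_3_eq_3 m_assoc)
    ultimately show False using a3 t by simp
  qed
  moreover have "a \<otimes> t \<in> carrier G" using a t by simp
  ultimately obtain h where "h \<in> H" "a \<otimes> t = t \<otimes> h" unfolding carr by blast
  then consider "a \<otimes> t = t \<otimes> a [^] (0::nat)" | "a \<otimes> t = t \<otimes> a [^] (1::nat)" | "a \<otimes> t = t \<otimes> a [^] (2::nat)"
    by (auto simp: H_def)
  then have at: "a \<otimes> t = t \<otimes> a [^] (2::nat)"
  proof cases
    case 1
    then have "a \<otimes> t = t" using t by simp
    then have "a = \<one>" using a t by simp
    then show ?thesis using a by simp
  next
    case 2
    then have comm: "a \<otimes> t = t \<otimes> a" using a t by simp
    have powers: "\<exists>(i::nat) (j::nat). x = t [^] i \<otimes> a [^] j" if "x \<in> carrier G" for x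
    proof -
      have "x \<in> H \<union> (\<lambda>h. t \<otimes> h) ` H" using that carr by simp
      then consider j :: nat where "x = a [^] j" | j :: nat where "x = t \<otimes> a [^] j"
        using H_E by (metis UnE imageE)
      then show ?thesis
      proof cases
        case 1
        then have "x = t [^] (0::nat) \<otimes> a [^] j" using a by simp
        then show ?thesis by blast
      next
        case 2
        then have "x = t [^] (1::nat) \<otimes> a [^] j" using t by simp
        then show ?thesis by blast
      qed
    qed
    have cp: "a [^] j \<otimes> t [^] k = t [^] k \<otimes> a [^] j" for j k :: nat
    proof -
      have "a [^] j \<otimes> t = t \<otimes> a [^] j" using group_commutes_pow[OF comm] a t by simp
      then show ?thesis using group_commutes_pow[of t "a [^] j" k] a t by simp
    qed
    have mult: "(t [^] i \<otimes> a [^] j) \<otimes> (t [^] k \<otimes> a [^] l) = t [^] (i + k) \<otimes> a [^] (j + l)" for i j k l :: nat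
    proof -
      have "(t [^] i \<otimes> a [^] j) \<otimes> (t [^] k \<otimes> a [^] l) = t [^] i \<otimes> (a [^] j \<otimes> t [^] k) \<otimes> a [^] l"
        using a t by (simp add: m_assoc)
      also have "\<dots> = (t [^] i \<otimes> t [^] k) \<otimes> (a [^] j \<otimes> a [^] l)"
        unfolding cp using a t by (simp add: m_assoc)
      finally show ?thesis using a t by (simp add: nat_pow_mult)
    qed
    have "x \<otimes> y = y \<otimes> x" if xy: "x \<in> carrier G" "y \<in> carrier G" for x y
    proof -
      obtain i j k l :: nat where "x = t [^] i \<otimes> a [^] j" "y = t [^] k \<otimes> a [^] l"
        using powers[OF xy(1)] powers[OF xy(2)] by blast
      then show ?thesis using mult by (simp add: add.commute)
    qed
    then show ?thesis using nc by blast
  qed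
  have img: "order6_elt G a t ` ({0, 1} \<times> {0, 1, 2}) = carrier G"
  proof -
    have "order6_elt G a t ` ({0, 1} \<times> {0, 1, 2}) = order6_elt G a t ` ({0} \<times> {0, 1, 2}) \<union> order6_elt G a t ` ({1} \<times> {0, 1, 2})"
      by blast
    also have "order6_elt G a t ` ({0} \<times> {0, 1, 2}) = H"
      using a by (auto simp: order6_elt_def H_def)
    also have "order6_elt G a t ` ({1} \<times> {0, 1, 2}) = (\<lambda>h. t \<otimes> h) ` H"
      using a t by (auto simp: order6_elt_def H_def)
    finally show ?thesis using carr by simp
  qed
  have "card ({0, 1} \<times> {0, 1, 2 :: nat} :: (nat \<times> nat) set) = 6" by (simp add: card_cartesian_product)
  then have "inj_on (order6_elt G a t) ({0, 1} \<times> {0, 1, 2})"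
    using img card6 by (intro eq_card_imp_inj_on) auto
  then have "bij_betw (order6_elt G a t) ({0, 1} \<times> {0, 1, 2}) (carrier G)"
    using img by (simp add: bij_betw_def)
  then show ?thesis using a(1) t(1) a3 t2 at by blast
qed

lemma order6_mult_in: "order6_mult p q \<in> {0, 1} \<times> {0, 1, 2}"
proof -
  have "n mod 2 \<in> {0, 1}" "n mod 3 \<in> {0, 1, 2}" for n :: nat by (simp_all, linarith, presburger)
  then show ?thesis by (cases p, cases q) (simp only: order6_mult_def prod.case mem_Times_iff fst_conv snd_conv simp_thms)
qed

lemma (in group) order6_elt_mult:
  assumes at: "a \<in> carrier G" "t \<in> carrier G" and rel: "a [^] (3::nat) = \<one>" "t [^] (2::nat) = \<one>"
    "a \<otimes> t = t \<otimes> a [^] (2::nat)"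
    and pq: "p \<in> {0, 1} \<times> {0, 1, 2}" "q \<in> {0, 1} \<times> {0, 1, 2}"
  shows "order6_elt G a t p \<otimes> order6_elt G a t q = order6_elt G a t (order6_mult p q)"
proof -
  obtain i j k l where [simp]: "p = (i, j)" "q = (k, l)" by (cases p, cases q)
  have powt: "a [^] n \<otimes> t = t \<otimes> a [^] (2 * n)" for n :: nat
  proof (induct n)
    case 0
    then show ?case using at by simp
  next
    case (Suc n)
    have "a [^] Suc n \<otimes> t = a [^] n \<otimes> (a \<otimes> t)" using at by (simp add: m_assoc)
    also have "\<dots> = (a [^] n \<otimes> t) \<otimes> a [^] (2::nat)" using at by (simp add: rel(3) m_assoc)
    also have "\<dots> = t \<otimes> a [^] (2 * n + 2)" using at by (simp add: Suc m_assoc nat_pow_mult)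
    finally show ?case by simp
  qed
  \<comment> \<open>Reduction modulo 2 and 3 does not change the element, so products can be
    computed with unreduced exponents.\<close>
  have norm: "order6_elt G a t (m mod 2, n mod 3) = t [^] m \<otimes> a [^] n" for m n
    by (simp add: order6_elt_def pow_mod[OF at(1) rel(1)] pow_mod[OF at(2) rel(2)])
  have "k = 0 \<or> k = 1" using pq by auto
  then show ?thesis
  proof
    assume k: "k = 0"
    have "order6_elt G a t p \<otimes> order6_elt G a t q = t [^] (i + 0) \<otimes> a [^] (j + l)"
      using at k by (simp add: order6_elt_def m_assoc nat_pow_mult)
    then show ?thesis using k by (simp add: order6_mult_def norm del: add_0_right)
  next
    assume k: "k = 1"
    have "order6_elt G a t p \<otimes> order6_elt G a t q = t [^] i \<otimes> (a [^] j \<otimes> t) \<otimes> a [^] l"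
      using at k by (simp add: order6_elt_def m_assoc)
    also have "\<dots> = (t [^] i \<otimes> t) \<otimes> (a [^] (2 * j) \<otimes> a [^] l)"
      using at by (simp add: powt m_assoc)
    also have "\<dots> = t [^] (i + 1) \<otimes> a [^] (2 * j + l)"
      using at by (simp add: nat_pow_mult)
    finally show ?thesis using k by (simp add: order6_mult_def norm del: add_Suc_right One_nat_def)
  qed
qed

text \<open>Both groups have the multiplication table \<open>order6_mult\<close> on exponent pairs;
  the isomorphism matches equal pairs.\<close>

lemma order6_iso:
  assumes G: "group G" "card (carrier G) = 6" "\<exists>x\<in>carrier G. \<exists>y\<in>carrier G. x \<otimes>\<^bsub>G\<^esub> y \<noteq> y \<otimes>\<^bsub>G\<^esub> x"
    and H: "group H" "card (carrier H) = 6" "\<exists>x\<in>carrier H. \<exists>y\<in>carrier H. x \<otimes>\<^bsub>H\<^esub> y \<noteq> y \<otimes>\<^bsub>H\<^esub> x"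
  shows "\<exists>\<psi>. \<psi> \<in> iso G H"
proof -
  let ?P = "{0, 1} \<times> {0, 1, 2 :: nat} :: (nat \<times> nat) set"
  obtain a t where at: "a \<in> carrier G" "t \<in> carrier G" "a [^]\<^bsub>G\<^esub> (3::nat) = \<one>\<^bsub>G\<^esub>" "t [^]\<^bsub>G\<^esub> (2::nat) = \<one>\<^bsub>G\<^esub>"
    "a \<otimes>\<^bsub>G\<^esub> t = t \<otimes>\<^bsub>G\<^esub> a [^]\<^bsub>G\<^esub> (2::nat)" "bij_betw (order6_elt G a t) ?P (carrier G)"
    using group.order6_normal_form[OF G] by blast
  obtain b u where bu: "b \<in> carrier H" "u \<in> carrier H" "b [^]\<^bsub>H\<^esub> (3::nat) = \<one>\<^bsub>H\<^esub>" "u [^]\<^bsub>H\<^esub> (2::nat) = \<one>\<^bsub>H\<^esub>"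
    "b \<otimes>\<^bsub>H\<^esub> u = u \<otimes>\<^bsub>H\<^esub> b [^]\<^bsub>H\<^esub> (2::nat)" "bij_betw (order6_elt H b u) ?P (carrier H)"
    using group.order6_normal_form[OF H] by blast
  note Gm = group.order6_elt_mult[OF G(1) at(1-5)] and Hm = group.order6_elt_mult[OF H(1) bu(1-5)]
  define \<psi> where "\<psi> = order6_elt H b u \<circ> inv_into ?P (order6_elt G a t)"
  have inv: "inv_into ?P (order6_elt G a t) (order6_elt G a t p) = p" if "p \<in> ?P" for p
    using that at(6) by (simp add: bij_betw_def)
  have bij: "bij_betw \<psi> (carrier G) (carrier H)"
    unfolding \<psi>_def by (rule bij_betw_trans[OF bij_betw_inv_into[OF at(6)] bu(6)])
  have "\<psi> (x \<otimes>\<^bsub>G\<^esub> y) = \<psi> x \<otimes>\<^bsub>H\<^esub> \<psi> y" if xy: "x \<in> carrier G" "y \<in> carrier G" for x y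
  proof -
    have "order6_elt G a t ` ?P = carrier G" using at(6) by (rule bij_betw_imp_surj_on)
    then have img: "x \<in> order6_elt G a t ` ?P" "y \<in> order6_elt G a t ` ?P" using xy by simp_all
    obtain p where p: "x = order6_elt G a t p" "p \<in> ?P" using img(1) by (rule imageE)
    obtain q where q: "y = order6_elt G a t q" "q \<in> ?P" using img(2) by (rule imageE)
    note pq = p(2) q(2) p(1) q(1)
    have "order6_mult p q \<in> ?P" by (rule order6_mult_in)
    then show ?thesis using pq inv Gm[OF pq(1,2)] Hm[OF pq(1,2)] by (simp add: \<psi>_def)
  qed
  then have "\<psi> \<in> hom G H" using bij by (auto simp: hom_def bij_betw_def)
  then show ?thesis using bij by (auto simp: iso_def)
qed

lemma sym_group_3:
  "card (carrier (sym_group 3)) = 6"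
  "\<exists>x\<in>carrier (sym_group 3). \<exists>y\<in>carrier (sym_group 3). x \<otimes>\<^bsub>sym_group 3\<^esub> y \<noteq> y \<otimes>\<^bsub>sym_group 3\<^esub> x"
proof -
  have "card {p. p permutes {1..3::nat}} = fact 3" by (rule card_permutations) auto
  then show "card (carrier (sym_group 3)) = 6" by (simp add: sym_group_def fact_numeral)
  let ?x = "Transposition.transpose 1 (2::nat)" and ?y = "Transposition.transpose 2 (3::nat)"
  have "?x permutes {1..3}" "?y permutes {1..3}" by (auto intro!: permutes_swap_id)
  moreover have "(?x \<circ> ?y) 1 \<noteq> (?y \<circ> ?x) 1" by (simp add: Transposition.transpose_def)
  then have "?x \<circ> ?y \<noteq> ?y \<circ> ?x" by metis
  ultimately show "\<exists>x\<in>carrier (sym_group 3). \<exists>y\<in>carrier (sym_group 3). x \<otimes>\<^bsub>sym_group 3\<^esub> y \<noteq> y \<otimes>\<^bsub>sym_group 3\<^esub> x"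
    by (auto simp: sym_group_def)
qed

subsection \<open>Integral group rings\<close>

locale finite_group = group G for G (structure) +
  assumes fin: "finite (carrier G)"
begin

abbreviation "ZG \<equiv> group_ring G"
abbreviation "\<delta> \<equiv> group_basis_elt G"

lemma ZG_carrier: "carrier ZG = carrier G \<rightarrow>\<^sub>E UNIV"
  and ZG_mult: "g \<in> carrier G \<Longrightarrow> (u \<otimes>\<^bsub>ZG\<^esub> v) g = (\<Sum>h\<in>carrier G. u h * v (inv h \<otimes> g))"
  and ZG_add: "g \<in> carrier G \<Longrightarrow> (u \<oplus>\<^bsub>ZG\<^esub> v) g = u g + v g"
  and ZG_one: "\<one>\<^bsub>ZG\<^esub> = \<delta> \<one>"
  and ZG_zero: "g \<in> carrier G \<Longrightarrow> \<zero>\<^bsub>ZG\<^esub> g = 0"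
  and ZG_basis: "basis ZG = \<delta> ` carrier G"
  and ZG_star: "g \<in> carrier G \<Longrightarrow> star ZG u g = u (inv g)"
  and ZG_closed: "u \<otimes>\<^bsub>ZG\<^esub> v \<in> carrier ZG" "u \<oplus>\<^bsub>ZG\<^esub> v \<in> carrier ZG" "\<zero>\<^bsub>ZG\<^esub> \<in> carrier ZG"
    "star ZG u \<in> carrier ZG"
  by (auto simp: group_ring_def)

lemma delta_closed: "\<delta> g \<in> carrier ZG"
  by (auto simp: ZG_carrier group_basis_elt_def)

lemma delta_apply: "h \<in> carrier G \<Longrightarrow> \<delta> g h = (if h = g then 1 else 0)"
  by (simp add: group_basis_elt_def)

lemma delta_inj: "inj_on \<delta> (carrier G)"
proof (rule inj_onI)
  fix g h assume "g \<in> carrier G" "h \<in> carrier G" "\<delta> g = \<delta> h"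
  then have "\<delta> g g = \<delta> h g" by simp
  then show "g = h" using \<open>g \<in> carrier G\<close> by (auto simp: delta_apply split: if_splits)
qed

lemma ZG_eqI:
  assumes "u \<in> carrier ZG" "v \<in> carrier ZG" "\<And>g. g \<in> carrier G \<Longrightarrow> u g = v g"
  shows "u = v"
  using assms by (intro PiE_ext[of u "carrier G" _ v]) (auto simp: ZG_carrier)

lemma sum_left_shift: "k \<in> carrier G \<Longrightarrow> (\<Sum>h\<in>carrier G. f (k \<otimes> h)) = (\<Sum>h\<in>carrier G. f h)"
proof (rule sum.reindex_bij_betw, rule bij_betwI[where g = "\<lambda>h. inv k \<otimes> h"])
qed (auto simp: m_assoc[symmetric])

lemma sum_delta: "g \<in> carrier G \<Longrightarrow> (\<Sum>h\<in>carrier G. \<delta> g h * f h) = f g"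
  using fin by (simp add: delta_apply if_distrib if_distribR cong: if_cong)

lemma ZG_ring: "ring ZG"
proof (rule ringI)
  show "abelian_group ZG"
  proof (rule abelian_groupI)
    fix u v w assume uvw: "u \<in> carrier ZG" "v \<in> carrier ZG" "w \<in> carrier ZG"
    show "u \<oplus>\<^bsub>ZG\<^esub> v \<oplus>\<^bsub>ZG\<^esub> w = u \<oplus>\<^bsub>ZG\<^esub> (v \<oplus>\<^bsub>ZG\<^esub> w)"
      by (rule ZG_eqI) (simp_all add: ZG_closed ZG_add)
  next
    fix u v assume uv: "u \<in> carrier ZG" "v \<in> carrier ZG"
    show "u \<oplus>\<^bsub>ZG\<^esub> v = v \<oplus>\<^bsub>ZG\<^esub> u"
      by (rule ZG_eqI) (simp_all add: ZG_closed ZG_add)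
  next
    fix u assume u: "u \<in> carrier ZG"
    show "\<zero>\<^bsub>ZG\<^esub> \<oplus>\<^bsub>ZG\<^esub> u = u"
      by (rule ZG_eqI) (simp_all add: ZG_closed ZG_add ZG_zero u)
    have "(\<lambda>g\<in>carrier G. - u g) \<in> carrier ZG" by (simp add: ZG_carrier)
    moreover have "(\<lambda>g\<in>carrier G. - u g) \<oplus>\<^bsub>ZG\<^esub> u = \<zero>\<^bsub>ZG\<^esub>"
      by (rule ZG_eqI) (simp_all add: ZG_closed ZG_add ZG_zero)
    ultimately show "\<exists>v\<in>carrier ZG. v \<oplus>\<^bsub>ZG\<^esub> u = \<zero>\<^bsub>ZG\<^esub>" by blast
  qed (simp_all add: ZG_closed)
  show "monoid ZG"
  proof (rule monoidI)
    fix u v w assume uvw: "u \<in> carrier ZG" "v \<in> carrier ZG" "w \<in> carrier ZG"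
    show "u \<otimes>\<^bsub>ZG\<^esub> v \<otimes>\<^bsub>ZG\<^esub> w = u \<otimes>\<^bsub>ZG\<^esub> (v \<otimes>\<^bsub>ZG\<^esub> w)"
    proof (rule ZG_eqI)
      fix g assume g: "g \<in> carrier G"
      have "(u \<otimes>\<^bsub>ZG\<^esub> v \<otimes>\<^bsub>ZG\<^esub> w) g = (\<Sum>h\<in>carrier G. \<Sum>k\<in>carrier G. u k * (v (inv k \<otimes> h) * w (inv h \<otimes> g)))"
        using g by (simp add: ZG_mult sum_distrib_right mult.assoc)
      also have "\<dots> = (\<Sum>k\<in>carrier G. \<Sum>h\<in>carrier G. u k * (v (inv k \<otimes> h) * w (inv h \<otimes> g)))"
        by (rule sum.swap)
      also have "\<dots> = (\<Sum>k\<in>carrier G. \<Sum>h\<in>carrier G. u k * (v h * w (inv h \<otimes> (inv k \<otimes> g))))"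
      proof (rule sum.cong[OF refl])
        fix k assume k: "k \<in> carrier G"
        have "(\<Sum>h\<in>carrier G. u k * (v (inv k \<otimes> h) * w (inv h \<otimes> g))) =
            (\<Sum>h\<in>carrier G. u k * (v (inv k \<otimes> (k \<otimes> h)) * w (inv (k \<otimes> h) \<otimes> g)))"
          using sum_left_shift[OF k, of "\<lambda>h. u k * (v (inv k \<otimes> h) * w (inv h \<otimes> g))"] by (rule sym)
        also have "\<dots> = (\<Sum>h\<in>carrier G. u k * (v h * w (inv h \<otimes> (inv k \<otimes> g))))"
          using k g by (intro sum.cong refl) (simp add: inv_mult_group m_assoc[symmetric])
        finally show "(\<Sum>h\<in>carrier G. u k * (v (inv k \<otimes> h) * w (inv h \<otimes> g))) =
            (\<Sum>h\<in>carrier G. u k * (v h * w (inv h \<otimes> (inv k \<otimes> g))))" .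
      qed
      also have "\<dots> = (u \<otimes>\<^bsub>ZG\<^esub> (v \<otimes>\<^bsub>ZG\<^esub> w)) g"
        using g by (simp add: ZG_mult sum_distrib_left)
      finally show "(u \<otimes>\<^bsub>ZG\<^esub> v \<otimes>\<^bsub>ZG\<^esub> w) g = (u \<otimes>\<^bsub>ZG\<^esub> (v \<otimes>\<^bsub>ZG\<^esub> w)) g" .
    qed (simp_all add: ZG_closed)
  next
    fix u assume u: "u \<in> carrier ZG"
    show "\<one>\<^bsub>ZG\<^esub> \<otimes>\<^bsub>ZG\<^esub> u = u"
      by (rule ZG_eqI) (simp_all add: ZG_closed ZG_one ZG_mult sum_delta u)
    show "u \<otimes>\<^bsub>ZG\<^esub> \<one>\<^bsub>ZG\<^esub> = u"
    proof (rule ZG_eqI)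
      fix g assume g: "g \<in> carrier G"
      have "(u \<otimes>\<^bsub>ZG\<^esub> \<one>\<^bsub>ZG\<^esub>) g = (\<Sum>h\<in>carrier G. if h = g then u h else 0)"
        unfolding ZG_mult[OF g] ZG_one
      proof (intro sum.cong refl)
        fix h assume h: "h \<in> carrier G"
        have "inv h \<otimes> g = \<one> \<longleftrightarrow> h = g" using g h by (metis inv_equality inv_inv inv_closed l_inv)
        then show "u h * \<delta> \<one> (inv h \<otimes> g) = (if h = g then u h else 0)"
          using g h by (simp add: delta_apply)
      qed
      then show "(u \<otimes>\<^bsub>ZG\<^esub> \<one>\<^bsub>ZG\<^esub>) g = u g" using g fin by simp
    qed (simp_all add: ZG_closed u)
  qed (simp_all add: ZG_closed ZG_one delta_closed)
  fix u v w assume uvw: "u \<in> carrier ZG" "v \<in> carrier ZG" "w \<in> carrier ZG"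
  show "(u \<oplus>\<^bsub>ZG\<^esub> v) \<otimes>\<^bsub>ZG\<^esub> w = u \<otimes>\<^bsub>ZG\<^esub> w \<oplus>\<^bsub>ZG\<^esub> v \<otimes>\<^bsub>ZG\<^esub> w"
    by (rule ZG_eqI) (simp_all add: ZG_closed ZG_add ZG_mult distrib_right sum.distrib)
  show "w \<otimes>\<^bsub>ZG\<^esub> (u \<oplus>\<^bsub>ZG\<^esub> v) = w \<otimes>\<^bsub>ZG\<^esub> u \<oplus>\<^bsub>ZG\<^esub> w \<otimes>\<^bsub>ZG\<^esub> v"
    by (rule ZG_eqI) (simp_all add: ZG_closed ZG_add ZG_mult distrib_left sum.distrib)
qed

lemma delta_mult:
  assumes "g \<in> carrier G" "h \<in> carrier G"
  shows "\<delta> g \<otimes>\<^bsub>ZG\<^esub> \<delta> h = \<delta> (g \<otimes> h)"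
proof (rule ZG_eqI)
  fix k assume k: "k \<in> carrier G"
  have "inv g \<otimes> k = h \<longleftrightarrow> k = g \<otimes> h"
    using assms k by (metis inv_solve_left)
  moreover have "(\<delta> g \<otimes>\<^bsub>ZG\<^esub> \<delta> h) k = \<delta> h (inv g \<otimes> k)"
    unfolding ZG_mult[OF k] by (rule sum_delta[OF assms(1)])
  ultimately show "(\<delta> g \<otimes>\<^bsub>ZG\<^esub> \<delta> h) k = \<delta> (g \<otimes> h) k"
    using assms k by (simp add: delta_apply)
qed (simp_all add: ZG_closed delta_closed)

lemma delta_star: "g \<in> carrier G \<Longrightarrow> star ZG (\<delta> g) = \<delta> (inv g)"
  by (rule ZG_eqI) (auto simp: ZG_closed delta_closed ZG_star delta_apply)

text \<open>Evaluation at \<open>g\<close> is additive, so it passes through the formal sum and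
  picks out the coefficient of \<open>\<delta> g\<close>.\<close>

lemma ZG_is_coords:
  assumes "x \<in> carrier ZG"
  shows "is_coords ZG x c \<longleftrightarrow> c \<in> basis ZG \<rightarrow>\<^sub>E UNIV \<and> (\<forall>g\<in>carrier G. x g = c (\<delta> g))"
proof -
  interpret ZG: ring ZG by (rule ZG_ring)
  have basis_carr: "b \<in> carrier ZG" if "b \<in> basis ZG" for b
    using that delta_closed by (auto simp: ZG_basis)
  have finB: "finite (basis ZG)" using fin by (simp add: ZG_basis)
  have eval: "(\<Oplus>\<^bsub>ZG\<^esub>b\<in>basis ZG. [c b] \<cdot>\<^bsub>ZG\<^esub> b) g = c (\<delta> g)" if g: "g \<in> carrier G" for g
  proof -
    have "(\<Oplus>\<^bsub>ZG\<^esub>b\<in>basis ZG. [c b] \<cdot>\<^bsub>ZG\<^esub> b) g = (\<Sum>b\<in>basis ZG. ([c b] \<cdot>\<^bsub>ZG\<^esub> b) g)"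
      using g finB basis_carr by (intro ZG.additive_finsum[where f = "\<lambda>x. x g"]) (auto simp: ZG_add)
    also have "\<dots> = (\<Sum>b\<in>basis ZG. c b * b g)"
    proof (intro sum.cong refl)
      fix b assume "b \<in> basis ZG"
      then show "([c b] \<cdot>\<^bsub>ZG\<^esub> b) g = c b * b g"
        using ZG.additive_int_pow[of "\<lambda>x. x g" b "c b"] g basis_carr by (simp add: ZG_add)
    qed
    also have "\<dots> = (\<Sum>h\<in>carrier G. c (\<delta> h) * \<delta> h g)"
      unfolding ZG_basis by (rule sum.reindex[OF delta_inj, unfolded o_def])
    also have "\<dots> = (\<Sum>h\<in>carrier G. if h = g then c (\<delta> h) else 0)"
      using g by (intro sum.cong refl) (auto simp: delta_apply)
    finally show ?thesis using g fin by simp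
  qed
  have closed: "(\<Oplus>\<^bsub>ZG\<^esub>b\<in>basis ZG. [c b] \<cdot>\<^bsub>ZG\<^esub> b) \<in> carrier ZG"
    using basis_carr by (intro ZG.finsum_closed) auto
  show ?thesis
    unfolding is_coords_def using ZG_eqI[OF assms closed] eval by auto
qed

lemma ZG_free: "x \<in> carrier ZG \<Longrightarrow> \<exists>!c. is_coords ZG x c"
proof -
  assume x: "x \<in> carrier ZG"
  let ?c = "\<lambda>b\<in>basis ZG. x (inv_into (carrier G) \<delta> b)"
  have "?c (\<delta> g) = x g" if "g \<in> carrier G" for g
    using that by (simp add: ZG_basis inv_into_f_f[OF delta_inj])
  then have "is_coords ZG x ?c" using x by (simp add: ZG_is_coords)
  moreover have "c = ?c" if "is_coords ZG x c" for c
  proof (rule PiE_ext)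
    show "c \<in> basis ZG \<rightarrow>\<^sub>E UNIV" using that x by (simp add: ZG_is_coords)
    show "?c \<in> basis ZG \<rightarrow>\<^sub>E UNIV" by simp
    fix b assume "b \<in> basis ZG"
    then obtain g where "g \<in> carrier G" "b = \<delta> g" by (auto simp: ZG_basis)
    then show "c b = ?c b"
      using that x \<open>\<And>g. g \<in> carrier G \<Longrightarrow> ?c (\<delta> g) = x g\<close> by (simp add: ZG_is_coords)
  qed
  ultimately show "\<exists>!c. is_coords ZG x c" by blast
qed

lemma ZG_coords:
  assumes "x \<in> carrier ZG" "g \<in> carrier G"
  shows "coords ZG x (\<delta> g) = x g"
proof -
  have "is_coords ZG x (coords ZG x)"
    unfolding coords_def using ZG_free[OF assms(1)] by (rule theI')
  then show ?thesis using assms by (simp add: ZG_is_coords)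
qed

lemma ZG_star_anti: "star ZG \<in> ring_iso ZG (opposite_ring ZG)"
proof (rule ring_iso_memI)
  fix u v assume uv: "u \<in> carrier ZG" "v \<in> carrier ZG"
  have "star ZG (u \<otimes>\<^bsub>ZG\<^esub> v) = star ZG v \<otimes>\<^bsub>ZG\<^esub> star ZG u"
  proof (rule ZG_eqI)
    fix g assume g: "g \<in> carrier G"
    have "(star ZG v \<otimes>\<^bsub>ZG\<^esub> star ZG u) g = (\<Sum>h\<in>carrier G. v (inv h) * u (inv (inv h \<otimes> g)))"
      using g by (simp add: ZG_mult ZG_star)
    also have "\<dots> = (\<Sum>h\<in>carrier G. v (inv (g \<otimes> h)) * u (inv (inv (g \<otimes> h) \<otimes> g)))"
      using sum_left_shift[OF g, of "\<lambda>h. v (inv h) * u (inv (inv h \<otimes> g))"] by (rule sym)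
    also have "\<dots> = (\<Sum>h\<in>carrier G. u h * v (inv h \<otimes> inv g))"
      using g by (intro sum.cong refl) (simp add: inv_mult_group m_assoc mult.commute)
    also have "\<dots> = star ZG (u \<otimes>\<^bsub>ZG\<^esub> v) g"
      using g by (simp add: ZG_star ZG_mult)
    finally show "star ZG (u \<otimes>\<^bsub>ZG\<^esub> v) g = (star ZG v \<otimes>\<^bsub>ZG\<^esub> star ZG u) g" ..
  qed (simp_all add: ZG_closed)
  then show "star ZG (u \<otimes>\<^bsub>ZG\<^esub> v) = star ZG u \<otimes>\<^bsub>opposite_ring ZG\<^esub> star ZG v"
    by (simp add: opposite_ring_def)
  have "star ZG (u \<oplus>\<^bsub>ZG\<^esub> v) = star ZG u \<oplus>\<^bsub>ZG\<^esub> star ZG v"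
    by (rule ZG_eqI) (simp_all add: ZG_closed ZG_star ZG_add)
  then show "star ZG (u \<oplus>\<^bsub>ZG\<^esub> v) = star ZG u \<oplus>\<^bsub>opposite_ring ZG\<^esub> star ZG v"
    by (simp add: opposite_ring_def)
next
  show "star ZG \<one>\<^bsub>ZG\<^esub> = \<one>\<^bsub>opposite_ring ZG\<^esub>"
    using delta_star[OF one_closed] by (simp add: opposite_ring_def ZG_one)
  have ss: "star ZG (star ZG u) = u" if "u \<in> carrier ZG" for u
    using that by (intro ZG_eqI) (simp_all add: ZG_closed ZG_star)
  show "bij_betw (star ZG) (carrier ZG) (carrier (opposite_ring ZG))"
    by (rule bij_betwI[where g = "star ZG"]) (auto simp: opposite_ring_def ZG_closed ss)
qed (simp add: opposite_ring_def ZG_closed)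

lemma ZG_fusion_ring: "fusion_ring ZG"
proof (intro fusion_ring.intro ZG_ring fusion_ring_axioms.intro)
  have basisE: "\<exists>g\<in>carrier G. b = \<delta> g" if "b \<in> basis ZG" for b using that by (auto simp: ZG_basis)
  show "finite (basis ZG)" using fin by (simp add: ZG_basis)
  show "basis ZG \<subseteq> carrier ZG" using delta_closed by (auto simp: ZG_basis)
  show "\<And>x. x \<in> carrier ZG \<Longrightarrow> \<exists>!c. is_coords ZG x c" by (rule ZG_free)
  show "\<one>\<^bsub>ZG\<^esub> \<in> basis ZG" by (simp add: ZG_one ZG_basis)
  show "0 \<le> coords ZG (a \<otimes>\<^bsub>ZG\<^esub> b) c" if abc: "a \<in> basis ZG" "b \<in> basis ZG" "c \<in> basis ZG" for a b c
  proof -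
    obtain g h k where "g \<in> carrier G" "h \<in> carrier G" "k \<in> carrier G" "a = \<delta> g" "b = \<delta> h" "c = \<delta> k"
      using basisE[OF abc(1)] basisE[OF abc(2)] basisE[OF abc(3)] by blast
    then show ?thesis by (simp add: delta_mult ZG_coords delta_closed delta_apply)
  qed
  show "star ZG b \<in> basis ZG" "star ZG (star ZG b) = b" if "b \<in> basis ZG" for b
    using basisE[OF that] by (auto simp: delta_star ZG_basis)
  show "\<exists>\<phi>\<in>ring_iso ZG (opposite_ring ZG). \<forall>b\<in>basis ZG. \<phi> b = star ZG b"
    using ZG_star_anti by blast
  show "coords ZG (a \<otimes>\<^bsub>ZG\<^esub> star ZG b) \<one>\<^bsub>ZG\<^esub> = (if a = b then 1 else 0)"
    if ab: "a \<in> basis ZG" "b \<in> basis ZG" for a b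
  proof -
    obtain g h where gh: "g \<in> carrier G" "h \<in> carrier G" "a = \<delta> g" "b = \<delta> h"
      using basisE[OF ab(1)] basisE[OF ab(2)] by blast
    have "\<one> = g \<otimes> inv h \<longleftrightarrow> g = h" using gh by (metis inv_solve_right l_one one_closed)
    moreover have "a = b \<longleftrightarrow> g = h" using gh delta_inj by (auto simp: inj_on_def)
    ultimately show ?thesis
      using gh by (simp add: delta_star delta_mult ZG_one ZG_coords delta_closed delta_apply)
  qed
qed

end

sublocale finite_group \<subseteq> ZG: fusion_ring "group_ring G"
  by (rule ZG_fusion_ring)

context finite_group
begin

text \<open>By uniqueness it suffices that the constant 1 is a character, and it is because a
  product of basis elements is a single basis element.\<close>

lemma ZG_FPdim: "b \<in> basis ZG \<Longrightarrow> FPdim ZG b = 1"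
proof (rule ZG.FPdim_eq)
  show "ZG.sc.character (\<lambda>_. 1 :: real)"
    unfolding ZG.sc.character_def
  proof safe
    fix a b assume "a \<in> basis ZG" "b \<in> basis ZG"
    then have "a \<otimes>\<^bsub>ZG\<^esub> b \<in> basis ZG" by (auto simp: ZG_basis delta_mult)
    moreover from this have "(\<Sum>k\<in>basis ZG. of_int (coords ZG (a \<otimes>\<^bsub>ZG\<^esub> b) k) * (1 :: real))
        = (\<Sum>k\<in>basis ZG. if a \<otimes>\<^bsub>ZG\<^esub> b = k then 1 else 0)"
      by (intro sum.cong refl) (simp add: ZG.coords_basis)
    ultimately show "1 * (1 :: real) = (\<Sum>k\<in>basis ZG. of_int (coords ZG (a \<otimes>\<^bsub>ZG\<^esub> b) k) * 1)"
      by (simp add: ZG.finite_basis)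
  qed
qed auto

lemma ZG_rank: "card (basis ZG) = card (carrier G)"
  unfolding ZG_basis using card_image[OF delta_inj] .

lemma ZG_FPdim_ring: "FPdim_ring ZG = card (carrier G)"
  by (simp add: FPdim_ring_def ZG_FPdim ZG_rank)

lemma ZG_integral: "integral_fusion_ring ZG"
  by (simp add: integral_fusion_ring_def ZG_fusion_ring ZG_FPdim)

text \<open>Each basis element times its star is the unit, so \<open>central_Z\<close> is the group
  order times the unit. The scalar is read off at entry (0, 0), which exists as
  \<open>n > 0\<close>.\<close>

lemma ZG_central_Z:
  assumes "irreducible_rep (complexification ZG) n \<rho>"
    "\<rho> (to_complexification ZG (central_Z ZG)) = \<alpha> \<cdot>\<^sub>m 1\<^sub>m n"
  shows "\<alpha> = of_nat (card (carrier G))"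
proof -
  let ?A = "complexification ZG"
  have n: "n > 0" and rep: "algebra_rep ?A n \<rho>" using assms(1) by (auto simp: irreducible_rep_def)
  have Zk: "coords ZG (central_Z ZG) k = (if k = \<one>\<^bsub>ZG\<^esub> then int (card (carrier G)) else 0)" if k: "k \<in> basis ZG" for k
  proof -
    have "coords ZG (central_Z ZG) k = (\<Sum>b\<in>basis ZG. coords ZG (b \<otimes>\<^bsub>ZG\<^esub> star ZG b) k)"
      unfolding central_Z_def using ZG.finite_basis ZG.star_closed k
      by (intro ZG.additive_finsum) (auto simp: ZG.coords_add)
    also have "\<dots> = (\<Sum>b\<in>basis ZG. if k = \<one>\<^bsub>ZG\<^esub> then 1 else 0)"
    proof (intro sum.cong refl)
      fix b assume "b \<in> basis ZG"
      then have "b \<otimes>\<^bsub>ZG\<^esub> star ZG b = \<one>\<^bsub>ZG\<^esub>"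
        by (auto simp: ZG_basis delta_star delta_mult ZG_one)
      then show "coords ZG (b \<otimes>\<^bsub>ZG\<^esub> star ZG b) k = (if k = \<one>\<^bsub>ZG\<^esub> then 1 else 0)"
        using k by (simp add: ZG.coords_basis ZG.one_in_basis)
    qed
    finally show ?thesis by (simp add: ZG_rank)
  qed
  have one_in: "\<one>\<^bsub>?A\<^esub> \<in> carrier ?A" by (simp add: complexification_def)
  have "to_complexification ZG (central_Z ZG) = of_nat (card (carrier G)) \<odot>\<^bsub>?A\<^esub> \<one>\<^bsub>?A\<^esub>"
    by (auto simp: to_complexification_def complexification_def Zk)
  moreover have "\<rho> \<one>\<^bsub>?A\<^esub> = 1\<^sub>m n"
    using rep by (simp add: algebra_rep_def Ring.ring_hom_def ring_mat_def)
  ultimately have "\<alpha> \<cdot>\<^sub>m 1\<^sub>m n = of_nat (card (carrier G)) \<cdot>\<^sub>m (1\<^sub>m n :: complex mat)"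
    using assms(2) rep one_in by (simp add: algebra_rep_def)
  then have "(\<alpha> \<cdot>\<^sub>m 1\<^sub>m n) $$ (0, 0) = (of_nat (card (carrier G)) \<cdot>\<^sub>m (1\<^sub>m n :: complex mat)) $$ (0, 0)"
    by simp
  then show ?thesis using n by simp
qed

end

lemma module_vec_subspaceI:
  assumes "W \<subseteq> carrier_vec n" "0\<^sub>v n \<in> W" "\<And>v w. \<lbrakk>v \<in> W; w \<in> W\<rbrakk> \<Longrightarrow> v + w \<in> W"
    "\<And>c v. v \<in> W \<Longrightarrow> c \<cdot>\<^sub>v v \<in> W"
  shows "VectorSpace.subspace class_ring W (module_vec TYPE('f::field) n)"
proof (rule VectorSpace.subspace.intro)
  show vs: "vectorspace class_ring (module_vec TYPE('f) n)" by (rule vec_vs)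
  show "submodule class_ring W (module_vec TYPE('f) n)"
    by (rule submodule.intro) (use assms vs in \<open>auto simp: module_vec_def vectorspace_def\<close>)
qed

context finite_group
begin

subsection \<open>Irreducible representations of the symmetric group\<close>

abbreviation "CG \<equiv> complexification ZG"

definition rep_elt :: "'a \<Rightarrow> ('a \<Rightarrow> int) \<Rightarrow> complex" where
  "rep_elt g = (\<lambda>k\<in>basis ZG. if k = \<delta> g then 1 else 0)"

lemma rep_elt_closed: "rep_elt g \<in> carrier CG"
  by (simp add: rep_elt_def complexification_def)

lemma rep_elt_one: "rep_elt \<one> = \<one>\<^bsub>CG\<^esub>"
  by (simp add: rep_elt_def complexification_def ZG_one)

lemma rep_elt_mult:
  assumes "g \<in> carrier G" "h \<in> carrier G"
  shows "rep_elt g \<otimes>\<^bsub>CG\<^esub> rep_elt h = rep_elt (g \<otimes> h)"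
proof (rule ext)
  fix k
  show "(rep_elt g \<otimes>\<^bsub>CG\<^esub> rep_elt h) k = rep_elt (g \<otimes> h) k"
  proof (cases "k \<in> basis ZG")
    case True
    have mem: "\<delta> g \<in> basis ZG" "\<delta> h \<in> basis ZG" using assms by (auto simp: ZG_basis)
    have "(rep_elt g \<otimes>\<^bsub>CG\<^esub> rep_elt h) k = (\<Sum>i\<in>basis ZG. \<Sum>j\<in>basis ZG.
        rep_elt g i * rep_elt h j * of_int (coords ZG (i \<otimes>\<^bsub>ZG\<^esub> j) k))"
      using True by (simp add: complexification_def)
    also have "\<dots> = (\<Sum>i\<in>basis ZG. if i = \<delta> g then (\<Sum>j\<in>basis ZG. if j = \<delta> h then of_int (coords ZG (i \<otimes>\<^bsub>ZG\<^esub> j) k) else 0) else 0)"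
      by (intro sum.cong refl) (auto simp: rep_elt_def intro!: sum.cong)
    also have "\<dots> = of_int (coords ZG (\<delta> g \<otimes>\<^bsub>ZG\<^esub> \<delta> h) k)"
      using mem ZG.finite_basis by simp
    also have "\<dots> = rep_elt (g \<otimes> h) k"
      using True assms by (auto simp: delta_mult ZG.coords_basis ZG_basis rep_elt_def)
    finally show ?thesis .
  qed (simp add: complexification_def rep_elt_def)
qed

text \<open>Group elements span the algebra, so invariance under them suffices. The induction builds
  \<open>x\<close> up by one basis coordinate at a time.\<close>

lemma rep_invariant:
  assumes rep: "algebra_rep CG n \<rho>"
    and W: "W \<subseteq> carrier_vec n" "0\<^sub>v n \<in> W" "\<And>v w. \<lbrakk>v \<in> W; w \<in> W\<rbrakk> \<Longrightarrow> v + w \<in> W"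
      "\<And>c v. v \<in> W \<Longrightarrow> c \<cdot>\<^sub>v v \<in> W"
    and inv: "\<And>g w. \<lbrakk>g \<in> carrier G; w \<in> W\<rbrakk> \<Longrightarrow> \<rho> (rep_elt g) *\<^sub>v w \<in> W"
    and x: "x \<in> carrier CG" and w: "w \<in> W"
  shows "\<rho> x *\<^sub>v w \<in> W"
proof -
  have \<rho>_closed: "\<rho> y \<in> carrier_mat n n" if "y \<in> carrier CG" for y
    using rep that by (auto simp: algebra_rep_def Ring.ring_hom_def ring_mat_def)
  have \<rho>_add: "\<rho> (y \<oplus>\<^bsub>CG\<^esub> z) = \<rho> y + \<rho> z" if "y \<in> carrier CG" "z \<in> carrier CG" for y z
    using rep that by (auto simp: algebra_rep_def Ring.ring_hom_def ring_mat_def)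
  have \<rho>_smult: "\<rho> (c \<odot>\<^bsub>CG\<^esub> y) = c \<cdot>\<^sub>m \<rho> y" if "y \<in> carrier CG" for c y
    using rep that by (auto simp: algebra_rep_def)
  have wc: "w \<in> carrier_vec n" using w W(1) by blast
  have smult_vec: "(c \<cdot>\<^sub>m M) *\<^sub>v w = c \<cdot>\<^sub>v (M *\<^sub>v w)" if "M \<in> carrier_mat n n" for c M
    using that wc by (intro eq_vecI) (auto simp: scalar_prod_def sum_distrib_left mult.assoc)
  define part where "part T = (\<lambda>k\<in>basis ZG. if k \<in> T then x k else 0)" for T
  have part_closed: "part T \<in> carrier CG" for T by (simp add: part_def complexification_def)
  have smult_closed: "c \<odot>\<^bsub>CG\<^esub> y \<in> carrier CG" for c y by (simp add: complexification_def)
  have "\<rho> (part T) *\<^sub>v w \<in> W" if "finite T" "T \<subseteq> basis ZG" for T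
    using that
  proof (induct T)
    case empty
    \<comment> \<open>The zero element is written as 0 times a group element, so that the scalar law
      for \<open>\<rho>\<close> computes its image.\<close>
    have "part {} = 0 \<odot>\<^bsub>CG\<^esub> rep_elt \<one>"
      by (auto simp: part_def complexification_def)
    then have "\<rho> (part {}) *\<^sub>v w = 0 \<cdot>\<^sub>v (\<rho> (rep_elt \<one>) *\<^sub>v w)"
      by (simp only: \<rho>_smult[OF rep_elt_closed] smult_vec[OF \<rho>_closed[OF rep_elt_closed]])
    then show ?case using inv[OF one_closed w] W(4) by simp
  next
    case (insert b T)
    then obtain g where g: "g \<in> carrier G" "b = \<delta> g" by (auto simp: ZG_basis)
    have "part (insert b T) = part T \<oplus>\<^bsub>CG\<^esub> (x b \<odot>\<^bsub>CG\<^esub> rep_elt g)"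
      using insert by (auto simp: part_def complexification_def rep_elt_def g(2))
    then have "\<rho> (part (insert b T)) *\<^sub>v w = (\<rho> (part T) + x b \<cdot>\<^sub>m \<rho> (rep_elt g)) *\<^sub>v w"
      by (simp only: \<rho>_add part_closed smult_closed \<rho>_smult rep_elt_closed)
    also have "\<dots> = \<rho> (part T) *\<^sub>v w + x b \<cdot>\<^sub>v (\<rho> (rep_elt g) *\<^sub>v w)"
      using \<rho>_closed[OF part_closed] \<rho>_closed[OF rep_elt_closed] wc
      by (subst add_mult_distrib_mat_vec[of _ n n]) (auto simp: smult_vec)
    finally show ?case using insert W(3,4) inv[OF g(1) w] by simp
  qed
  from this[OF ZG.finite_basis order_refl] have "\<rho> (part (basis ZG)) *\<^sub>v w \<in> W" .
  moreover have "part (basis ZG) = x"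
    using x by (auto simp: part_def complexification_def PiE_def extensional_def)
  ultimately show ?thesis by simp
qed

text \<open>If \<open>v\<close> is an eigenvector of \<open>a\<close>, then \<open>v\<close> and \<open>t v\<close> span a subrepresentation.\<close>

lemma order6_irrep_dim:
  assumes irr: "irreducible_rep CG n \<rho>"
    and at: "a \<in> carrier G" "t \<in> carrier G" and rel: "t [^] (2::nat) = \<one>" "a \<otimes> t = t \<otimes> a [^] (2::nat)"
    and gen: "order6_elt G a t ` ({0, 1} \<times> {0, 1, 2}) = carrier G"
  shows "n \<le> 2"
proof -
  have rep: "algebra_rep CG n \<rho>" and n: "n > 0" using irr by (auto simp: irreducible_rep_def)
  define P where "P g = \<rho> (rep_elt g)" for g
  have Pc: "P g \<in> carrier_mat n n" for g
    using rep rep_elt_closed by (auto simp: P_def algebra_rep_def Ring.ring_hom_def ring_mat_def)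
  have P_mult: "P (g \<otimes> h) = P g * P h" if "g \<in> carrier G" "h \<in> carrier G" for g h
    using rep rep_elt_closed rep_elt_mult[OF that, symmetric]
    by (simp add: P_def algebra_rep_def Ring.ring_hom_def ring_mat_def)
  have P_one: "P \<one> = 1\<^sub>m n"
    using rep by (simp add: P_def rep_elt_one algebra_rep_def Ring.ring_hom_def ring_mat_def)
  obtain l where "eigenvalue (P a) l"
    using spectrum_non_empty[OF Pc n, of a] by (auto simp: spectrum_def)
  then obtain v where v: "v \<in> carrier_vec n" "v \<noteq> 0\<^sub>v n" "P a *\<^sub>v v = l \<cdot>\<^sub>v v"
    using Pc[of a] by (auto simp: eigenvalue_def eigenvector_def)
  define u where "u = P t *\<^sub>v v"
  have uc: "u \<in> carrier_vec n" using Pc[of t] v by (simp add: u_def)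
  have tt: "t \<otimes> t = \<one>" using rel(1) at by (simp add: numeral_2_eq_2)
  have tu: "P t *\<^sub>v u = v"
  proof -
    have "P t *\<^sub>v u = (P t * P t) *\<^sub>v v" unfolding u_def by (rule assoc_mult_mat_vec[OF Pc Pc v(1), symmetric])
    also have "P t * P t = 1\<^sub>m n" using P_mult[OF at(2,2)] tt P_one by simp
    finally show ?thesis using v by simp
  qed
  \<comment> \<open>The relation \<open>a t = t a^2\<close> makes \<open>t v\<close> an eigenvector
    of \<open>a\<close> for the square of \<open>l\<close>.\<close>
  have au: "P a *\<^sub>v u = (l * l) \<cdot>\<^sub>v u"
  proof -
    have "P a *\<^sub>v u = (P a * P t) *\<^sub>v v" unfolding u_def by (rule assoc_mult_mat_vec[OF Pc Pc v(1), symmetric])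
    also have "P a * P t = P t * (P a * P a)"
      using at rel(2) by (simp add: P_mult[symmetric] numeral_2_eq_2)
    also have "(P t * (P a * P a)) *\<^sub>v v = P t *\<^sub>v ((P a * P a) *\<^sub>v v)"
      by (rule assoc_mult_mat_vec[OF Pc mult_carrier_mat[OF Pc Pc] v(1)])
    also have "(P a * P a) *\<^sub>v v = P a *\<^sub>v (P a *\<^sub>v v)" by (rule assoc_mult_mat_vec[OF Pc Pc v(1)])
    also have "\<dots> = (l * l) \<cdot>\<^sub>v v"
      using v Pc[of a] by (simp add: mult_mat_vec smult_smult_assoc)
    also have "P t *\<^sub>v ((l * l) \<cdot>\<^sub>v v) = (l * l) \<cdot>\<^sub>v u"
      unfolding u_def by (rule mult_mat_vec[OF Pc v(1)])
    finally show ?thesis .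
  qed
  define W where "W = {p \<cdot>\<^sub>v v + q \<cdot>\<^sub>v u | p q. True}"
  have W_I: "p \<cdot>\<^sub>v v + q \<cdot>\<^sub>v u \<in> W" for p q by (auto simp: W_def)
  have W_carr: "W \<subseteq> carrier_vec n" using v uc by (auto simp: W_def)
  have W_zero: "0\<^sub>v n \<in> W"
  proof -
    have "0 \<cdot>\<^sub>v v + 0 \<cdot>\<^sub>v u = 0\<^sub>v n" using v(1) uc by (intro eq_vecI) auto
    then show ?thesis using W_I[of 0 0] by simp
  qed
  have W_add: "x + y \<in> W" if xy: "x \<in> W" "y \<in> W" for x y
  proof -
    obtain p q p' q' where "x = p \<cdot>\<^sub>v v + q \<cdot>\<^sub>v u" "y = p' \<cdot>\<^sub>v v + q' \<cdot>\<^sub>v u" using xy by (auto simp: W_def)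
    then have "x + y = (p + p') \<cdot>\<^sub>v v + (q + q') \<cdot>\<^sub>v u"
      using v(1) uc by (intro eq_vecI) (auto simp: algebra_simps)
    then show ?thesis using W_I by simp
  qed
  have W_scale: "c \<cdot>\<^sub>v x \<in> W" if x: "x \<in> W" for c x
  proof -
    obtain p q where "x = p \<cdot>\<^sub>v v + q \<cdot>\<^sub>v u" using x by (auto simp: W_def)
    then have "c \<cdot>\<^sub>v x = (c * p) \<cdot>\<^sub>v v + (c * q) \<cdot>\<^sub>v u"
      using v(1) uc by (intro eq_vecI) (auto simp: algebra_simps)
    then show ?thesis using W_I by simp
  qed
  have P_lin: "P g *\<^sub>v (p \<cdot>\<^sub>v v + q \<cdot>\<^sub>v u) = p \<cdot>\<^sub>v (P g *\<^sub>v v) + q \<cdot>\<^sub>v (P g *\<^sub>v u)" for g p q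
    using v(1) uc Pc[of g] by (simp add: mult_add_distrib_mat_vec[OF Pc] mult_mat_vec)
  \<comment> \<open>The group elements preserving \<open>W\<close> are closed under products;
    containing \<open>a\<close> and \<open>t\<close>, they contain all normal forms and hence the
    whole group.\<close>
  define I where "I = {g \<in> carrier G. \<forall>w\<in>W. P g *\<^sub>v w \<in> W}"
  have I_one: "\<one> \<in> I" using W_carr by (auto simp: I_def P_one)
  have I_mult: "g \<otimes> h \<in> I" if "g \<in> I" "h \<in> I" for g h
  proof -
    have "P (g \<otimes> h) *\<^sub>v w = P g *\<^sub>v (P h *\<^sub>v w)" if "w \<in> W" for w
      using that W_carr \<open>g \<in> I\<close> \<open>h \<in> I\<close> assoc_mult_mat_vec[OF Pc Pc, of w g h] by (auto simp: I_def P_mult)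
    then show ?thesis using that by (auto simp: I_def)
  qed
  have I_a: "a \<in> I"
  proof -
    have "P a *\<^sub>v w \<in> W" if w: "w \<in> W" for w
    proof -
      obtain p q where "w = p \<cdot>\<^sub>v v + q \<cdot>\<^sub>v u" using w by (auto simp: W_def)
      then have "P a *\<^sub>v w = (p * l) \<cdot>\<^sub>v v + (q * (l * l)) \<cdot>\<^sub>v u"
        by (simp add: P_lin v(3) au smult_smult_assoc)
      then show ?thesis using W_I by simp
    qed
    then show ?thesis using at by (simp add: I_def)
  qed
  have I_t: "t \<in> I"
  proof -
    have "P t *\<^sub>v w \<in> W" if w: "w \<in> W" for w
    proof -
      obtain p q where "w = p \<cdot>\<^sub>v v + q \<cdot>\<^sub>v u" using w by (auto simp: W_def)
      then have "P t *\<^sub>v w = p \<cdot>\<^sub>v u + q \<cdot>\<^sub>v v"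
        by (simp add: P_lin tu u_def[symmetric])
      also have "\<dots> = q \<cdot>\<^sub>v v + p \<cdot>\<^sub>v u" using v(1) uc by (intro comm_add_vec[of _ n]) auto
      finally show ?thesis using W_I by simp
    qed
    then show ?thesis using at by (simp add: I_def)
  qed
  have I_pow: "g [^] k \<in> I" if "g \<in> I" for g and k :: nat
    by (induct k) (auto simp: I_one I_mult that)
  have "order6_elt G a t p \<in> I" for p
    by (cases p) (simp add: order6_elt_def I_mult I_pow I_a I_t)
  then have "carrier G \<subseteq> I" unfolding gen[symmetric] by (intro image_subsetI)
  then have inv: "\<rho> (rep_elt g) *\<^sub>v w \<in> W" if "g \<in> carrier G" "w \<in> W" for g w
    using that by (auto simp: I_def P_def)
  have "VectorSpace.subspace class_ring W (module_vec TYPE(complex) n)"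
    by (rule module_vec_subspaceI[OF W_carr W_zero W_add W_scale])
  moreover have "\<forall>x\<in>carrier CG. \<forall>w\<in>W. \<rho> x *\<^sub>v w \<in> W"
    using rep_invariant[OF rep W_carr W_zero W_add W_scale inv] by blast
  ultimately have "W = {0\<^sub>v n} \<or> W = carrier_vec n"
    using irr by (simp add: irreducible_rep_def)
  moreover have "v \<in> W"
  proof -
    have "v = 1 \<cdot>\<^sub>v v + 0 \<cdot>\<^sub>v u" using v(1) uc by (intro eq_vecI) auto
    then show ?thesis using W_I[of 1 0] by simp
  qed
  ultimately have W_all: "W = carrier_vec n" using v(2) by blast
  show "n \<le> 2"
  proof (rule ccontr)
    assume "\<not> n \<le> 2"
    then have n3: "n > 2" by simp
    have "\<exists>p q. Matrix.unit_vec n i = p \<cdot>\<^sub>v v + q \<cdot>\<^sub>v u" for i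
    proof -
      have "Matrix.unit_vec n i \<in> W" using W_all by simp
      then show ?thesis by (auto simp: W_def)
    qed
    then obtain p q where pq: "\<And>i. Matrix.unit_vec n i = p i \<cdot>\<^sub>v v + q i \<cdot>\<^sub>v u" by metis
    have c: "p i * v $ j + q i * u $ j = (if i = j then 1 else 0)" if "i < n" "j < n" for i j
    proof -
      have "(p i \<cdot>\<^sub>v v + q i \<cdot>\<^sub>v u) $ j = (Matrix.unit_vec n i :: complex vec) $ j" using pq by simp
      then show ?thesis using that v(1) uc by auto
    qed
    \<comment> \<open>The determinant of a 3 by 3 matrix that factors through a two-dimensional
      space vanishes. If \<open>n > 2\<close>, this matrix would be the identity.\<close>
    have det: "(p0 * v0 + q0 * u0) * ((p1 * v1 + q1 * u1) * (p2 * v2 + q2 * u2) - (p1 * v2 + q1 * u2) * (p2 * v1 + q2 * u1))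
      - (p0 * v1 + q0 * u1) * ((p1 * v0 + q1 * u0) * (p2 * v2 + q2 * u2) - (p1 * v2 + q1 * u2) * (p2 * v0 + q2 * u0))
      + (p0 * v2 + q0 * u2) * ((p1 * v0 + q1 * u0) * (p2 * v1 + q2 * u1) - (p1 * v1 + q1 * u1) * (p2 * v0 + q2 * u0)) = 0"
      for p0 p1 p2 q0 q1 q2 v0 v1 v2 u0 u1 u2 :: complex
      by (simp add: algebra_simps)
    show False
      using det[of "p 0" "v $ 0" "q 0" "u $ 0" "p 1" "v $ 1" "q 1" "u $ 1" "p 2" "v $ 2" "q 2" "u $ 2"] n3
      by (simp add: c)
  qed
qed

text \<open>\<open>Z\<close> acts by 6 and irreducible representations have dimension 1 or 2, so
  every codegree is 6 or 3, and both divide 6.\<close>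

lemma order6_drinfeld:
  assumes "card (carrier G) = 6" "\<exists>x\<in>carrier G. \<exists>y\<in>carrier G. x \<otimes> y \<noteq> y \<otimes> x"
  shows "drinfeld_ring ZG"
  unfolding drinfeld_ring_def
proof (intro conjI ZG_integral ballI)
  fix f assume "f \<in> formal_codegrees ZG"
  then obtain \<alpha> n \<rho> where f: "f = \<alpha> / of_nat n" "irreducible_rep CG n \<rho>"
    "\<rho> (to_complexification ZG (central_Z ZG)) = \<alpha> \<cdot>\<^sub>m 1\<^sub>m n"
    by (auto simp: formal_codegrees_def)
  obtain a t where "a \<in> carrier G" "t \<in> carrier G" "t [^] (2::nat) = \<one>"
    "a \<otimes> t = t \<otimes> a [^] (2::nat)" "bij_betw (order6_elt G a t) ({0, 1} \<times> {0, 1, 2}) (carrier G)"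
    using order6_normal_form[OF assms] by blast
  then have "n \<le> 2" using order6_irrep_dim[OF f(2)] by (simp add: bij_betw_def)
  moreover have "n > 0" using f(2) by (simp add: irreducible_rep_def)
  ultimately have "n = 1 \<or> n = 2" by auto
  moreover have "\<alpha> = 6" using ZG_central_Z[OF f(2,3)] assms(1) by simp
  moreover have "FPdim_ring ZG = of_int 6" using ZG_FPdim_ring assms(1) by simp
  ultimately show "\<exists>m D. f = of_int m \<and> FPdim_ring ZG = of_int D \<and> m dvd D"
    using f(1) by (auto intro: exI[of _ 6] exI[of _ 3])
qed

lemma ZG_noncommutative:
  assumes "\<exists>x\<in>carrier G. \<exists>y\<in>carrier G. x \<otimes> y \<noteq> y \<otimes> x"
  shows "\<not> cring ZG"
proof
  assume "cring ZG"
  obtain x y where xy: "x \<in> carrier G" "y \<in> carrier G" "x \<otimes> y \<noteq> y \<otimes> x" using assms by blast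
  have "\<delta> x \<otimes>\<^bsub>ZG\<^esub> \<delta> y = \<delta> y \<otimes>\<^bsub>ZG\<^esub> \<delta> x"
    using \<open>cring ZG\<close> by (intro cring.cring_simprules(14)) (auto simp: delta_closed)
  then have "\<delta> (x \<otimes> y) = \<delta> (y \<otimes> x)" using xy by (simp add: delta_mult)
  then show False using xy delta_inj by (auto simp: inj_on_def)
qed

end

subsection \<open>Pointed fusion rings are group rings\<close>

context fusion_ring
begin

definition basis_group :: "'a monoid" where
  "basis_group = \<lparr>carrier = basis R, monoid.mult = (\<otimes>), one = \<one>\<rparr>"

context
  assumes pointed: "\<And>b. b \<in> basis R \<Longrightarrow> FPdim R b = 1"
begin

lemma basis_mult_closed: "\<lbrakk>a \<in> basis R; b \<in> basis R\<rbrakk> \<Longrightarrow> a \<otimes> b \<in> basis R"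
  using invertible_mult_closed pointed by blast

lemma basis_group_group: "group basis_group"
proof (rule groupI)
  fix x assume "x \<in> carrier basis_group"
  then show "\<exists>y\<in>carrier basis_group. y \<otimes>\<^bsub>basis_group\<^esub> x = \<one>\<^bsub>basis_group\<^esub>"
    using star_invertible(1)[of x] pointed star_closed by (auto simp: basis_group_def)
qed (auto simp: basis_group_def basis_mult_closed one_in_basis m_assoc)

text \<open>Left multiplication by \<open>a\<close> permutes the basis, with inverse given by
  \<open>star R a\<close>. In this form the product in \<open>R\<close> matches the convolution that
  defines \<open>group_ring\<close>.\<close>

lemma coords_mult_pointed:
  assumes a: "a \<in> basis R" and y: "y \<in> carrier R" and b: "b \<in> basis R"
  shows "coords R (a \<otimes> y) b = coords R y (star R a \<otimes> b)"
proof -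
  note inv = star_invertible[OF a pointed[OF a]]
  have sa: "star R a \<in> basis R" using a star_closed by simp
  have "coords R (a \<otimes> y) b = (\<Sum>c\<in>basis R. of_int (coords R y c) * coords R (a \<otimes> c) b)"
    using assms by (intro additive_expansion) (auto simp: r_distr coords_add)
  also have "\<dots> = (\<Sum>c\<in>basis R. if c = star R a \<otimes> b then coords R y c else 0)"
  proof (intro sum.cong refl)
    fix c assume c: "c \<in> basis R"
    have "a \<otimes> c = b \<longleftrightarrow> c = star R a \<otimes> b"
      using m_assoc[of a "star R a" b] m_assoc[of "star R a" a c] inv a b c sa by auto
    then show "of_int (coords R y c) * coords R (a \<otimes> c) b = (if c = star R a \<otimes> b then coords R y c else 0)"
      using a b c by (simp add: coords_basis basis_mult_closed)
  qed
  also have "\<dots> = coords R y (star R a \<otimes> b)"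
    using sa b by (simp add: finite_basis basis_mult_closed)
  finally show ?thesis .
qed

text \<open>The isomorphism sends an element to its coordinate function, transported along
  \<open>\<psi>\<close>. By \<open>coords_mult_pointed\<close>, multiplicativity is the convolution
  formula after reindexing the sum by \<open>\<psi>\<close>.\<close>

lemma pointed_isomorphic_group_ring:
  fixes H :: "'b monoid"
  assumes H: "finite_group H" and \<psi>: "\<psi> \<in> iso basis_group H"
  shows "fusion_ring_isomorphic R (group_ring H)"
proof -
  interpret H: finite_group H by (rule H)
  have bij: "bij_betw \<psi> (basis R) (carrier H)"
    using \<psi> by (simp add: iso_def basis_group_def)
  have \<psi>_mult: "\<psi> (a \<otimes> b) = \<psi> a \<otimes>\<^bsub>H\<^esub> \<psi> b" if "a \<in> basis R" "b \<in> basis R" for a b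
    using \<psi> that by (simp add: iso_def hom_def basis_group_def)
  have \<psi>_in: "\<psi> b \<in> carrier H" if "b \<in> basis R" for b using bij that by (auto simp: bij_betw_def)
  define \<phi> where "\<phi> = inv_into (basis R) \<psi>"
  have \<phi>_\<psi>: "\<phi> (\<psi> b) = b" if "b \<in> basis R" for b using bij that by (simp add: \<phi>_def bij_betw_def)
  have \<phi>_in: "\<phi> g \<in> basis R" and \<psi>_\<phi>: "\<psi> (\<phi> g) = g" if "g \<in> carrier H" for g
    using bij that by (auto simp: \<phi>_def bij_betw_def inv_into_into f_inv_into_f)
  define h where "h x = (\<lambda>g\<in>carrier H. coords R x (\<phi> g))" for x
  have h_closed: "h x \<in> carrier H.ZG" for x by (simp add: h_def H.ZG_carrier)
  have h_\<psi>: "h x (\<psi> b) = coords R x b" if "b \<in> basis R" for x b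
    using that by (simp add: h_def \<psi>_in \<phi>_\<psi>)
  have eqI: "u = v" if "u \<in> carrier H.ZG" "v \<in> carrier H.ZG" "\<And>b. b \<in> basis R \<Longrightarrow> u (\<psi> b) = v (\<psi> b)" for u v
  proof (rule H.ZG_eqI[OF that(1,2)])
    fix g assume "g \<in> carrier H"
    then show "u g = v g" using that(3)[of "\<phi> g"] \<phi>_in \<psi>_\<phi> by simp
  qed
  have h_basis: "h b = H.\<delta> (\<psi> b)" if b: "b \<in> basis R" for b
  proof (rule eqI[OF h_closed H.delta_closed])
    fix c assume "c \<in> basis R"
    then show "h b (\<psi> c) = H.\<delta> (\<psi> b) (\<psi> c)"
      using b bij by (auto simp: h_\<psi> H.delta_apply \<psi>_in coords_basis bij_betw_def inj_on_def)
  qed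
  have "h \<in> ring_iso R H.ZG"
  proof (rule ring_iso_memI)
    fix x y assume xy: "x \<in> carrier R" "y \<in> carrier R"
    show "h (x \<otimes> y) = h x \<otimes>\<^bsub>H.ZG\<^esub> h y"
    proof (rule eqI[OF h_closed H.ZG_closed(1)])
      fix b assume b: "b \<in> basis R"
      have "(h x \<otimes>\<^bsub>H.ZG\<^esub> h y) (\<psi> b) = (\<Sum>k\<in>carrier H. h x k * h y (inv\<^bsub>H\<^esub> k \<otimes>\<^bsub>H\<^esub> \<psi> b))"
        using b by (simp add: H.ZG_mult \<psi>_in)
      also have "\<dots> = (\<Sum>a\<in>basis R. h x (\<psi> a) * h y (inv\<^bsub>H\<^esub> \<psi> a \<otimes>\<^bsub>H\<^esub> \<psi> b))"
        by (rule sum.reindex_bij_betw[OF bij, symmetric])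
      also have "\<dots> = (\<Sum>a\<in>basis R. coords R x a * coords R y (star R a \<otimes> b))"
      proof (intro sum.cong refl)
        fix a assume a: "a \<in> basis R"
        have sa: "star R a \<in> basis R" using a star_closed by simp
        have sab: "star R a \<otimes> b \<in> basis R" using sa b by (rule basis_mult_closed)
        have "a \<otimes> (star R a \<otimes> b) = b"
          using star_invertible(2)[OF a pointed[OF a]] a b sa by (simp add: m_assoc[symmetric])
        then have "\<psi> b = \<psi> a \<otimes>\<^bsub>H\<^esub> \<psi> (star R a \<otimes> b)"
          using \<psi>_mult[OF a sab] by simp
        then have "inv\<^bsub>H\<^esub> \<psi> a \<otimes>\<^bsub>H\<^esub> \<psi> b = \<psi> (star R a \<otimes> b)"
          using H.inv_solve_left[of "\<psi> (star R a \<otimes> b)" "\<psi> a" "\<psi> b"] a b sab \<psi>_in by metis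
        then show "h x (\<psi> a) * h y (inv\<^bsub>H\<^esub> \<psi> a \<otimes>\<^bsub>H\<^esub> \<psi> b) = coords R x a * coords R y (star R a \<otimes> b)"
          using a sab by (simp add: h_\<psi>)
      qed
      also have "\<dots> = (\<Sum>a\<in>basis R. of_int (coords R x a) * coords R (a \<otimes> y) b)"
        using b xy by (intro sum.cong refl) (simp add: coords_mult_pointed)
      also have "\<dots> = coords R (x \<otimes> y) b"
        using b xy by (intro additive_expansion[symmetric]) (auto simp: l_distr coords_add)
      finally show "h (x \<otimes> y) (\<psi> b) = (h x \<otimes>\<^bsub>H.ZG\<^esub> h y) (\<psi> b)"
        using b by (simp add: h_\<psi>)
    qed
    show "h (x \<oplus> y) = h x \<oplus>\<^bsub>H.ZG\<^esub> h y"
    proof (rule eqI[OF h_closed H.ZG_closed(2)])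
      fix b assume "b \<in> basis R"
      then show "h (x \<oplus> y) (\<psi> b) = (h x \<oplus>\<^bsub>H.ZG\<^esub> h y) (\<psi> b)"
        using xy by (simp add: h_\<psi> H.ZG_add \<psi>_in coords_add)
    qed
  next
    have "\<psi> \<one> \<otimes>\<^bsub>H\<^esub> \<psi> \<one> = \<psi> \<one>"
      using \<psi>_mult[OF one_in_basis one_in_basis] by simp
    then have "\<psi> \<one> = \<one>\<^bsub>H\<^esub>" using \<psi>_in[OF one_in_basis] by simp
    then show "h \<one> = \<one>\<^bsub>H.ZG\<^esub>" by (simp add: h_basis one_in_basis H.ZG_one)
    show "bij_betw h (carrier R) (carrier H.ZG)"
      unfolding bij_betw_def
    proof
      show "inj_on h (carrier R)"
      proof (rule inj_onI)
        fix x y assume xy: "x \<in> carrier R" "y \<in> carrier R" "h x = h y"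
        show "x = y"
          by (rule coords_eqI[OF xy(1,2)]) (metis h_\<psi> xy(3))
      qed
      show "h ` carrier R = carrier H.ZG"
      proof
        show "h ` carrier R \<subseteq> carrier H.ZG" using h_closed by blast
        show "carrier H.ZG \<subseteq> h ` carrier R"
        proof
          fix u assume u: "u \<in> carrier H.ZG"
          define c where "c = (\<lambda>b\<in>basis R. u (\<psi> b))"
          define x where "x = (\<Oplus>b\<in>basis R. [c b] \<cdot> b)"
          have x: "x \<in> carrier R" unfolding x_def by (intro finsum_closed) auto
          have "c \<in> basis R \<rightarrow>\<^sub>E UNIV" unfolding c_def by auto
          then have "coords R x = c" unfolding x_def by (rule coords_lincomb)
          then have "h x = u"
            by (intro eqI[OF h_closed u]) (simp add: h_\<psi> c_def)
          then show "u \<in> h ` carrier R" using x by blast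
        qed
      qed
    qed
  qed (rule h_closed)
  moreover have "h ` basis R = basis H.ZG"
  proof -
    have "h ` basis R = H.\<delta> ` \<psi> ` basis R" using h_basis by (auto simp: image_image)
    then show ?thesis using bij by (simp add: bij_betw_def H.ZG_basis)
  qed
  ultimately show ?thesis
    unfolding fusion_ring_isomorphic_def fusion_ring_iso_def by blast
qed

end

end

theorem theorem1p5:
  shows "(drinfeld_ring (group_ring (sym_group 3)) \<and>
            \<not> cring (group_ring (sym_group 3)) \<and>
            fusion_rank (group_ring (sym_group 3)) \<le> 6) \<and>
         (\<forall>R :: 'a based_ring.
            drinfeld_ring R \<and> \<not> cring R \<and> fusion_rank R \<le> 6 \<longrightarrow>
            fusion_ring_isomorphic R (group_ring (sym_group 3)))"
proof -
  have fin: "finite (carrier (sym_group 3))"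
    using sym_group_3(1) by (metis card.infinite zero_neq_numeral)
  interpret S3: finite_group "sym_group 3"
    by (intro finite_group.intro finite_group_axioms.intro sym_group_is_group fin)
  have "fusion_ring_isomorphic R (group_ring (sym_group 3))"
    if R: "drinfeld_ring R" "\<not> cring R" "fusion_rank R \<le> 6" for R :: "'a based_ring"
  proof -
    interpret R: fusion_ring R
      using R(1) by (simp add: drinfeld_ring_def integral_fusion_ring_def)
    note pointed = R.drinfeld_noncommutative_pointed[OF R(1,2) R(3)[unfolded fusion_rank_def]]
    have grp: "group R.basis_group" by (rule R.basis_group_group) (rule pointed(2))
    moreover have "card (carrier R.basis_group) = 6"
      using pointed(1) by (simp add: R.basis_group_def)
    moreover have "\<exists>x\<in>carrier R.basis_group. \<exists>y\<in>carrier R.basis_group.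
        x \<otimes>\<^bsub>R.basis_group\<^esub> y \<noteq> y \<otimes>\<^bsub>R.basis_group\<^esub> x"
      using R.noncommuting_basis_elements[OF R(2)] by (simp add: R.basis_group_def)
    ultimately obtain \<psi> where "\<psi> \<in> iso R.basis_group (sym_group 3)"
      using order6_iso[OF _ _ _ sym_group_is_group sym_group_3] by blast
    then show ?thesis
      using R.pointed_isomorphic_group_ring[OF pointed(2) S3.finite_group_axioms] by blast
  qed
  moreover have "drinfeld_ring (group_ring (sym_group 3))"
    by (rule S3.order6_drinfeld[OF sym_group_3])
  moreover have "\<not> cring (group_ring (sym_group 3))"
    by (rule S3.ZG_noncommutative[OF sym_group_3(2)])
  moreover have "fusion_rank (group_ring (sym_group 3)) \<le> 6"
    unfolding fusion_rank_def S3.ZG_rank sym_group_3(1) by simp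
  ultimately show ?thesis by blast
qed

end
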